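(* Let $A,B\in\mathcal M_n$ be accretive with $W(A),W(B)\subset S_\alpha$ for some $0\le\alpha<\pi/2$. Then for every unitarily invariant norm $\|\cdot\|$ on $\mathcal M_n$ and every $f\in\mathfrak m$, $$\|f(A+B)\|\le\sec^3(\alpha)\,\|f(A)+f(B)\|.$$
   Context: A matrix $A$ is accretive if $\Re A=\frac{A+A^*}{2}$ is positive definite. $W(A)$ is the numerical range, $S_\alpha=\{z:\Re z>0,\ |\Im z|\le\tan(\alpha)\Re z\}$. A norm is unitarily invariant if $\|UXV\|=\|X\|$ for all unitary $U,V$. $\mathfrak m$ is the set of matrix monotone $f:(0,\infty)\to(0,\infty)$ with $f(1)=1$; each extends analytically to $\mathbb C\setminus(-\infty,0]$, and for $X$ with spectrum in $D=\mathbb C\setminus(-\infty,0]$, $f(X)=\frac1{2\pi i}\int_\Gamma f(z)(z\mathcal I-X)^{-1}dz$ with $\Gamma\subset D$ a simple closed curve winding once around each eigenvalue of $X$. *)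

theory Defs
  imports "Jordan_Normal_Form.Schur_Decomposition" "HOL-Complex_Analysis.Complex_Analysis"
begin

definition qform :: "complex mat \<Rightarrow> complex Matrix.vec \<Rightarrow> complex" where
  "qform A x = (\<Sum>i<dim_vec x. cnj (vec_index x i) * vec_index (mult_mat_vec A x) i)"

definition numerical_range :: "complex mat \<Rightarrow> complex set" where
  "numerical_range A = {qform A x | x. x \<in> carrier_vec (dim_row A) \<and>
      (\<Sum>i<dim_row A. (cmod (vec_index x i))^2) = 1}"

definition hermitian_mat :: "complex mat \<Rightarrow> bool" where
  "hermitian_mat H \<longleftrightarrow> H \<in> carrier_mat (dim_row H) (dim_row H) \<and> mat_adjoint H = H"

definition pos_def_mat :: "complex mat \<Rightarrow> bool" where
  "pos_def_mat H \<longleftrightarrow> hermitian_mat H \<and>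
     (\<forall>x \<in> carrier_vec (dim_row H). x \<noteq> 0\<^sub>v (dim_row H) \<longrightarrow> Re (qform H x) > 0)"

definition pos_semidef_mat :: "complex mat \<Rightarrow> bool" where
  "pos_semidef_mat H \<longleftrightarrow> hermitian_mat H \<and>
     (\<forall>x \<in> carrier_vec (dim_row H). Re (qform H x) \<ge> 0)"

definition accretive :: "complex mat \<Rightarrow> bool" where
  "accretive A \<longleftrightarrow> A \<in> carrier_mat (dim_row A) (dim_row A) \<and>
     pos_def_mat ((1/2 :: complex) \<cdot>\<^sub>m (A + mat_adjoint A))"

definition sector :: "real \<Rightarrow> complex set" where
  "sector \<alpha> = {z. Re z > 0 \<and> \<bar>Im z\<bar> \<le> tan \<alpha> * Re z}"

definition unitary_mat :: "nat \<Rightarrow> complex mat \<Rightarrow> bool" where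
  "unitary_mat n U \<longleftrightarrow> U \<in> carrier_mat n n \<and> mat_adjoint U * U = 1\<^sub>m n"

definition diag_of :: "nat \<Rightarrow> (nat \<Rightarrow> complex) \<Rightarrow> complex mat" where
  "diag_of n d = Matrix.mat n n (\<lambda>(i,j). if i = j then d i else 0)"

definition herm_fun :: "(real \<Rightarrow> real) \<Rightarrow> complex mat \<Rightarrow> complex mat" where
  "herm_fun f A = (SOME M. \<exists>U d. unitary_mat (dim_row A) U \<and>
      A = U * diag_of (dim_row A) (\<lambda>i. complex_of_real (d i)) * mat_adjoint U \<and>
      M = U * diag_of (dim_row A) (\<lambda>i. complex_of_real (f (d i))) * mat_adjoint U)"

definition matrix_monotone_class :: "(real \<Rightarrow> real) \<Rightarrow> bool" where
  "matrix_monotone_class f \<longleftrightarrow> (\<forall>x>0. f x > 0) \<and> f 1 = 1 \<and>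
     (\<forall>m A B. A \<in> carrier_mat m m \<longrightarrow> B \<in> carrier_mat m m \<longrightarrow>
        pos_def_mat A \<longrightarrow> pos_def_mat B \<longrightarrow> pos_semidef_mat (B - A) \<longrightarrow>
        pos_semidef_mat (herm_fun f B - herm_fun f A))"

definition slit_plane :: "complex set" where
  "slit_plane = UNIV - complex_of_real ` {..0}"

definition minv :: "nat \<Rightarrow> complex mat \<Rightarrow> complex mat" where
  "minv n M = (SOME R. R \<in> carrier_mat n n \<and> M * R = 1\<^sub>m n \<and> R * M = 1\<^sub>m n)"

definition holo_fun :: "(complex \<Rightarrow> complex) \<Rightarrow> complex mat \<Rightarrow> complex mat" where
  "holo_fun F X = (SOME M. \<exists>\<gamma>. valid_path \<gamma> \<and> simple_path \<gamma> \<and> pathfinish \<gamma> = pathstart \<gamma> \<and>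
      path_image \<gamma> \<subseteq> slit_plane \<and>
      (\<forall>w. eigenvalue X w \<longrightarrow> w \<notin> path_image \<gamma> \<and> winding_number \<gamma> w = 1) \<and>
      M = Matrix.mat (dim_row X) (dim_row X) (\<lambda>(i,j).
            contour_integral \<gamma> (\<lambda>z. F z * minv (dim_row X) (z \<cdot>\<^sub>m 1\<^sub>m (dim_row X) - X) $$ (i,j))
              / (2 * complex_of_real pi * \<i>)))"

definition unitarily_invariant_norm :: "nat \<Rightarrow> (complex mat \<Rightarrow> real) \<Rightarrow> bool" where
  "unitarily_invariant_norm n N \<longleftrightarrow>
     (\<forall>X \<in> carrier_mat n n. N X \<ge> 0 \<and> (N X = 0 \<longleftrightarrow> X = 0\<^sub>m n n)) \<and>
     (\<forall>c. \<forall>X \<in> carrier_mat n n. N (c \<cdot>\<^sub>m X) = cmod c * N X) \<and>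
     (\<forall>X \<in> carrier_mat n n. \<forall>Y \<in> carrier_mat n n. N (X + Y) \<le> N X + N Y) \<and>
     (\<forall>U V X. unitary_mat n U \<longrightarrow> unitary_mat n V \<longrightarrow> X \<in> carrier_mat n n \<longrightarrow>
        N (U * X * V) = N X)"

end

(*
  Write h_t(x) = x / ((1 - t) x + t) for 0 <= t <= 1.  Everything is proved for finite convex
  combinations g of the h_t and transferred to f by a limit.

  Approximation.  Applying monotonicity of f to the bordered matrix [[D, s], [s, y]] <= (D + e) + (K)
  and letting s -> 0 shows that a third-order difference kernel of f is negative semidefinite; y -> 0
  and y -> oo give two positive semidefinite kernels.  At finitely many points these two forms
  are diagonalized simultaneously, which interpolates f by some g.  By Montel's theorem and the
  identity theorem such g converge to F locally uniformly on the slit plane, hence in the Cauchy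
  functional calculus.

  Matrices.  Let k = sec alpha, S = g(A + B), Z = g(A) + g(B), C = Re(A + B).  Comparing the solutions of
  ((1 - t) A + t) w = x and ((1 - t) Re A + t) w' = x gives g(Re A) <= Re g(A) <= k^2 g(Re A), and S is
  sectorial, so |<q, S p>| <= k/2 (<q, Re S q> + <p, Re S p>).  For W with singular value decomposition
  P diag(s) Q^* this yields |tr(W S)| <= k^3 sum_j s_j g(lambda_j), where C has the decreasingly ordered
  eigenvalues lambda_j with eigenvectors u_j.  As in Ando and Zhan's subadditivity theorem, the sum
  is at most sum_j s_j <u_j, Re Z u_j>, which is Re tr(W U Z V) for suitable unitary U, V.  Separating S
  from the ball {X. N X <= k^3 N Z} by a functional X |-> Re tr(W X) then gives N S <= k^3 N Z.
*)

theory Submission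
  imports Defs "HOL-Real_Asymp.Real_Asymp"
begin

subsection \<open>Adjoints, forms and unitary matrices\<close>

text \<open>The exponent 3 is lost on one side only: comparing S with g(C) costs k^2, the
  off-diagonal values of S cost one more k, and the passage to Z has constant 1.

  The h_t are convenient because h_t(A) x = A w, where w solves a linear equation; every comparison
  thus becomes one between quadratic forms of A. Interpolating f at finitely many points requires
  only the spectral theorem, and since f(1) = 1 makes the weights sum to 1, the interpolants form a
  normal family.

  The first obstacle is that monotonicity speaks of \<open>herm_fun\<close> and the theorem of
  \<open>holo_fun\<close>, which choose a decomposition and a curve respectively. A Cauchy integral
  over a circle around the spectrum is the common value of both. Contour integrals also make sense
  of divided differences at coinciding points and carry the limit in the border s.

  The second obstacle is that the norm is accessible only through its axioms. Hence the final step
  argues by duality, and the trace bound has to hold for every invertible W, with unitary factors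
  that may depend on W.\<close>

lemma mat_adjoint_carrier[simp]:
  "A \<in> carrier_mat n m \<Longrightarrow> mat_adjoint A \<in> carrier_mat m n"
  by (auto simp: mat_adjoint_def mat_of_rows_def)

lemma mat_adjoint_dims[simp]:
  "dim_row (mat_adjoint A) = dim_col A" "dim_col (mat_adjoint A) = dim_row A"
  by (auto simp: mat_adjoint_def)

lemma mat_adjoint_index[simp]:
  fixes A :: "complex mat"
  assumes "i < dim_col A" "j < dim_row A"
  shows "mat_adjoint A $$ (i,j) = cnj (A $$ (j,i))"
  using assms by (auto simp: mat_adjoint_def mat_of_rows_def)

lemma mat_adjoint_adjoint[simp]: "mat_adjoint (mat_adjoint A) = (A :: complex mat)"
  by (rule eq_matI) auto

lemma mat_mult_index:
  assumes "A \<in> carrier_mat n m" "B \<in> carrier_mat m k" "i < n" "j < k"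
  shows "(A * B) $$ (i,j) = (\<Sum>l<m. A $$ (i,l) * B $$ (l,j))"
  using assms by (auto simp: scalar_prod_def atLeast0LessThan)

lemma mat_vec_index:
  assumes "A \<in> carrier_mat n m" "x \<in> carrier_vec m" "i < n"
  shows "(A *\<^sub>v x) $ i = (\<Sum>l<m. A $$ (i,l) * x $ l)"
  using assms by (auto simp: scalar_prod_def atLeast0LessThan)

lemma mat_adjoint_mult:
  fixes A B :: "complex mat"
  assumes "A \<in> carrier_mat n m" "B \<in> carrier_mat m k"
  shows "mat_adjoint (A * B) = mat_adjoint B * mat_adjoint A"
proof (rule eq_matI)
  fix i j assume *: "i < dim_row (mat_adjoint B * mat_adjoint A)" "j < dim_col (mat_adjoint B * mat_adjoint A)"
  then have ij: "i < k" "j < n" using assms by auto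
  have "mat_adjoint (A * B) $$ (i,j) = cnj ((A * B) $$ (j,i))"
    using assms ij by (subst mat_adjoint_index) auto
  also have "\<dots> = (\<Sum>l<m. mat_adjoint B $$ (i,l) * mat_adjoint A $$ (l,j))"
    using assms ij by (subst mat_mult_index[of _ n m _ k]) (auto simp: mult.commute)
  also have "\<dots> = (mat_adjoint B * mat_adjoint A) $$ (i,j)"
    using assms ij by (subst mat_mult_index[of _ k m _ n]) auto
  finally show "mat_adjoint (A * B) $$ (i,j) = (mat_adjoint B * mat_adjoint A) $$ (i,j)" .
qed (use assms in auto)

lemma mat_adjoint_add:
  fixes A B :: "complex mat"
  assumes "A \<in> carrier_mat n m" "B \<in> carrier_mat n m"
  shows "mat_adjoint (A + B) = mat_adjoint A + mat_adjoint B"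
  by (rule eq_matI) (use assms in auto)

lemma mat_adjoint_smult:
  fixes A :: "complex mat"
  shows "mat_adjoint (c \<cdot>\<^sub>m A) = cnj c \<cdot>\<^sub>m mat_adjoint A"
  by (rule eq_matI) auto

lemma mat_adjoint_one[simp]: "mat_adjoint (1\<^sub>m n :: complex mat) = 1\<^sub>m n"
  by (rule eq_matI) auto

lemma diag_of_carrier[simp]: "diag_of n d \<in> carrier_mat n n"
  by (simp add: diag_of_def)

text \<open>Proves identities between words in n x n matrices under \<open>simp only\<close>:
  products are associated to the right, adjoints are pushed inside, units are removed, and the
  carrier conditions are discharged by the same rules.\<close>

lemmas sq_mat_simps =
  assoc_mult_mat[of _ n n _ n _ n] mat_adjoint_mult[of _ n n _ n] mult_carrier_mat[of _ n n _ n]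
  mat_adjoint_carrier[of _ n n] diag_of_carrier[of n] one_carrier_mat[of n]
  left_mult_one_mat[of _ n n] right_mult_one_mat[of _ n n] for n

section \<open>Inner products and quadratic forms\<close>

definition cinner :: "complex Matrix.vec \<Rightarrow> complex Matrix.vec \<Rightarrow> complex" where
  "cinner x y = (\<Sum>i<dim_vec x. cnj (x $ i) * y $ i)"

lemma qform_cinner: "qform A x = cinner x (A *\<^sub>v x)"
  by (simp add: qform_def cinner_def)

lemma cinner_commute:
  "dim_vec x = dim_vec y \<Longrightarrow> cinner y x = cnj (cinner x y)"
  by (simp add: cinner_def mult.commute)

lemma cinner_self: "cinner x x = complex_of_real (\<Sum>i<dim_vec x. (cmod (x $ i))\<^sup>2)"
  by (simp add: cinner_def complex_norm_square mult.commute del: of_real_power)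

lemma cinner_add_right:
  "\<lbrakk>x \<in> carrier_vec n; y \<in> carrier_vec n; z \<in> carrier_vec n\<rbrakk> \<Longrightarrow> cinner x (y + z) = cinner x y + cinner x z"
  by (auto simp: cinner_def ring_distribs sum.distrib)

lemma cinner_add_left:
  "\<lbrakk>x \<in> carrier_vec n; y \<in> carrier_vec n; z \<in> carrier_vec n\<rbrakk> \<Longrightarrow> cinner (y + z) x = cinner y x + cinner z x"
  by (auto simp: cinner_def ring_distribs sum.distrib)

lemma cinner_smult_right:
  "\<lbrakk>x \<in> carrier_vec n; y \<in> carrier_vec n\<rbrakk> \<Longrightarrow> cinner x (c \<cdot>\<^sub>v y) = c * cinner x y"
  by (auto simp: cinner_def sum_distrib_left ac_simps)

lemma cinner_smult_left:
  "\<lbrakk>x \<in> carrier_vec n; y \<in> carrier_vec n\<rbrakk> \<Longrightarrow> cinner (c \<cdot>\<^sub>v y) x = cnj c * cinner y x"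
  by (auto simp: cinner_def sum_distrib_left ac_simps)

lemma cinner_mat:
  assumes "A \<in> carrier_mat n m" "x \<in> carrier_vec n" "y \<in> carrier_vec m"
  shows "cinner x (A *\<^sub>v y) = (\<Sum>i<n. \<Sum>j<m. cnj (x $ i) * A $$ (i,j) * y $ j)"
  using assms unfolding cinner_def
  by (auto intro!: sum.cong simp: mat_vec_index[OF assms(1) assms(3)] sum_distrib_left ac_simps
      simp del: index_mult_mat_vec)

lemma cinner_adjoint:
  assumes A: "A \<in> carrier_mat n m" and x: "x \<in> carrier_vec n" and y: "y \<in> carrier_vec m"
  shows "cinner (mat_adjoint A *\<^sub>v x) y = cinner x (A *\<^sub>v y)"
proof -
  have "cinner (mat_adjoint A *\<^sub>v x) y = cnj (cinner y (mat_adjoint A *\<^sub>v x))"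
    using assms by (intro cinner_commute) auto
  also have "\<dots> = (\<Sum>i<m. \<Sum>j<n. y $ i * A $$ (j,i) * cnj (x $ j))"
    using assms by (subst cinner_mat[of _ m n]) auto
  also have "\<dots> = (\<Sum>j<n. \<Sum>i<m. y $ i * A $$ (j,i) * cnj (x $ j))"
    by (rule sum.swap)
  finally show ?thesis
    using assms by (simp add: cinner_mat[of _ n m] ac_simps)
qed

section \<open>Unitary and diagonal matrices\<close>

lemma unitary_matD:
  assumes "unitary_mat n U"
  shows "U \<in> carrier_mat n n" "mat_adjoint U \<in> carrier_mat n n"
    "mat_adjoint U * U = 1\<^sub>m n" "U * mat_adjoint U = 1\<^sub>m n"
proof -
  show 1: "U \<in> carrier_mat n n" "mat_adjoint U * U = 1\<^sub>m n" using assms by (auto simp: unitary_mat_def)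
  then show 2: "mat_adjoint U \<in> carrier_mat n n" by simp
  show "U * mat_adjoint U = 1\<^sub>m n" using mat_mult_left_right_inverse[OF 2 1] .
qed

lemma unitary_mat_adjoint: "unitary_mat n U \<Longrightarrow> unitary_mat n (mat_adjoint U)"
  unfolding unitary_mat_def[of n "mat_adjoint U"] by (simp add: unitary_matD)

lemma unitary_mat_mult:
  assumes "unitary_mat n U" "unitary_mat n V"
  shows "unitary_mat n (U * V)"
proof -
  note U = unitary_matD[OF assms(1)] and V = unitary_matD[OF assms(2)]
  have "mat_adjoint (U * V) * (U * V) = mat_adjoint V * ((mat_adjoint U * U) * V)"
    by (simp only: mat_adjoint_adjoint sq_mat_simps[where n = n] U(1) V(1))
  also have "\<dots> = 1\<^sub>m n" using U V by simp
  finally show ?thesis using U V by (simp add: unitary_mat_def)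
qed

lemma diag_of_index[simp]: "i < n \<Longrightarrow> j < n \<Longrightarrow> diag_of n d $$ (i,j) = (if i = j then d i else 0)"
  by (simp add: diag_of_def)

lemma diag_of_dims[simp]: "dim_row (diag_of n d) = n" "dim_col (diag_of n d) = n"
  by (simp_all add: diag_of_def)

lemma mult_diag_of_right:
  assumes "A \<in> carrier_mat m n"
  shows "A * diag_of n d = Matrix.mat m n (\<lambda>(i,j). A $$ (i,j) * d j)"
proof (rule eq_matI)
  fix i j assume "i < dim_row (Matrix.mat m n (\<lambda>(i,j). A $$ (i,j) * d j))" "j < dim_col (Matrix.mat m n (\<lambda>(i,j). A $$ (i,j) * d j))"
  then have ij: "i < m" "j < n" by auto
  have "(A * diag_of n d) $$ (i,j) = (\<Sum>l<n. if l = j then A $$ (i,l) * d l else 0)"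
    using assms ij by (subst mat_mult_index[of _ m n _ n]) (auto intro!: sum.cong simp del: sum.delta sum.delta')
  then show "(A * diag_of n d) $$ (i,j) = Matrix.mat m n (\<lambda>(i,j). A $$ (i,j) * d j) $$ (i,j)"
    using ij by (simp add: sum.delta)
qed (use assms in auto)

lemma mult_diag_of_left:
  assumes "A \<in> carrier_mat n m"
  shows "diag_of n d * A = Matrix.mat n m (\<lambda>(i,j). d i * A $$ (i,j))"
proof (rule eq_matI)
  fix i j assume "i < dim_row (Matrix.mat n m (\<lambda>(i,j). d i * A $$ (i,j)))" "j < dim_col (Matrix.mat n m (\<lambda>(i,j). d i * A $$ (i,j)))"
  then have ij: "i < n" "j < m" by auto
  have "(diag_of n d * A) $$ (i,j) = (\<Sum>l<n. if l = i then d l * A $$ (l,j) else 0)"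
    using assms ij by (subst mat_mult_index[of _ n n _ m]) (auto intro!: sum.cong simp del: sum.delta sum.delta')
  then show "(diag_of n d * A) $$ (i,j) = Matrix.mat n m (\<lambda>(i,j). d i * A $$ (i,j)) $$ (i,j)"
    using ij by (simp add: sum.delta)
qed (use assms in auto)

lemma diag_of_mult: "diag_of n d * diag_of n e = diag_of n (\<lambda>i. d i * e i)"
  by (subst mult_diag_of_right[of _ n n]) (auto simp: diag_of_def)

lemma mat_adjoint_diag_of: "mat_adjoint (diag_of n d) = diag_of n (\<lambda>i. cnj (d i))"
  by (rule eq_matI) auto

lemma diag_of_mult_vec:
  assumes "x \<in> carrier_vec n" "i < n"
  shows "(diag_of n d *\<^sub>v x) $ i = d i * x $ i"
proof -
  have "(diag_of n d *\<^sub>v x) $ i = (\<Sum>l<n. if l = i then d l * x $ l else 0)"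
    using assms by (subst mat_vec_index[of _ n n]) (auto intro!: sum.cong simp del: sum.delta sum.delta')
  then show ?thesis using assms by (simp add: sum.delta)
qed

lemma conj_diag_index:
  assumes "U \<in> carrier_mat n n" "i < n" "j < n"
  shows "(U * diag_of n d * mat_adjoint U) $$ (i,j) = (\<Sum>k<n. U $$ (i,k) * d k * cnj (U $$ (j,k)))"
  using assms by (subst mat_mult_index[of _ n n _ n]) (auto simp: mult_diag_of_right[of _ n n])

subsection \<open>The spectral theorem\<close>

text \<open>Deflation, by induction on the list of roots. In an orthonormal basis that starts with
  an eigenvector, the first column is e times the first unit vector; Hermitian symmetry clears the
  first row as well, and a block of size n - 1 remains. The eigenvalues appear in the order in which
  the linear factors are listed.\<close>

lemma hermitian_unitary_diag:
  assumes "A \<in> carrier_mat n n" "mat_adjoint A = A"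
    and "char_poly A = (\<Prod>(e::complex)\<leftarrow>es. [:- e, 1:])"
  shows "\<exists>U. unitary_mat n U \<and> A = U * diag_of n (\<lambda>i. es ! i) * mat_adjoint U"
  using assms
proof (induct es arbitrary: n A)
  case Nil
  with degree_monic_char_poly[of A n] have "n = 0" by auto
  with Nil have "unitary_mat n (1\<^sub>m 0)" "A = 1\<^sub>m 0 * diag_of n (\<lambda>i. [] ! i) * mat_adjoint (1\<^sub>m 0)"
    by (auto simp: unitary_mat_def intro!: eq_matI)
  then show ?case by blast
next
  case (Cons e es n A)
  let ?n1 = "n - 1"
  from Cons have A: "A \<in> carrier_mat n n" and hA: "mat_adjoint A = A" by auto
  let ?cp = "char_poly A"
  from Cons have cp: "?cp = [: -e, 1 :] * (\<Prod>e \<leftarrow> es. [:- e, 1:])" by auto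
  have mon: "monic (\<Prod>e\<leftarrow> es. [:- e, 1:])" by (rule monic_prod_list, auto)
  have deg: "degree ?cp = Suc (degree (\<Prod>e\<leftarrow> es. [:- e, 1:]))" unfolding cp
    by (subst degree_mult_eq, insert mon, auto)
  with degree_monic_char_poly[OF A] have n: "n \<noteq> 0" by auto
  define v where "v = find_eigenvector A e"
  define b where "b = basis_completion v"
  define ws where "ws = gram_schmidt n b"
  have e: "eigenvalue A e"
    unfolding eigenvalue_root_char_poly[OF A] cp by simp
  from find_eigenvector[OF A e] have ev: "eigenvector A v e" unfolding v_def .
  from this[unfolded eigenvector_def]
  have v[simp]: "v \<in> carrier_vec n" and v0: "v \<noteq> 0\<^sub>v n" and Av: "A *\<^sub>v v = e \<cdot>\<^sub>v v" using A by auto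
  interpret cof_vec_space n "TYPE(complex)" .
  from basis_completion[OF v v0, folded b_def]
  have dist_b: "distinct b"
    and indep: "\<not> lin_dep (set b)" and b: "set b \<subseteq> carrier_vec n" and hdb: "hd b = v"
    and len_b: "length b = n" by auto
  from hdb len_b n obtain vs where bv: "b = v # vs" by (cases b, auto)
  from gram_schmidt_result[OF b dist_b indep refl, folded ws_def]
  have ws: "set ws \<subseteq> carrier_vec n" "corthogonal ws" "length ws = n"
    by (auto simp: len_b)
  from gram_schmidt_hd[OF v, of vs, folded bv] have hdws: "hd ws = v" unfolding ws_def .
  have ws0: "ws ! 0 = v" using hdws ws n by (metis hd_conv_nth length_0_conv)
  have wsc: "ws ! i \<in> carrier_vec n" if "i < n" for i using ws that by auto
  have orth: "cinner (ws ! i) (ws ! j) = 0 \<longleftrightarrow> i \<noteq> j" if "i < n" "j < n" for i j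
  proof -
    have "cinner (ws ! i) (ws ! j) = ws ! j \<bullet>c ws ! i"
      using wsc[OF that(1)] wsc[OF that(2)] by (auto simp: cinner_def scalar_prod_def atLeast0LessThan mult.commute)
    then show ?thesis using corthogonalD[OF ws(2), of j i] that ws(3) by auto
  qed
  \<comment> \<open>The Gram-Schmidt vectors are orthogonal but not normalised; dividing the columns
    by their lengths \<nu> makes W unitary.\<close>
  define \<nu> where "\<nu> i = sqrt (Re (cinner (ws ! i) (ws ! i)))" for i
  have \<nu>sq: "complex_of_real (\<nu> i) * complex_of_real (\<nu> i) = cinner (ws ! i) (ws ! i)" and \<nu>0: "\<nu> i \<noteq> 0" if "i < n" for i
  proof -
    have ge: "Re (cinner (ws ! i) (ws ! i)) \<ge> 0" by (simp add: cinner_self sum_nonneg)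
    have re: "cinner (ws ! i) (ws ! i) = complex_of_real (Re (cinner (ws ! i) (ws ! i)))"
      by (simp add: cinner_self)
    show "complex_of_real (\<nu> i) * complex_of_real (\<nu> i) = cinner (ws ! i) (ws ! i)"
      using ge re unfolding \<nu>_def by (metis of_real_mult real_sqrt_mult_self abs_of_nonneg)
    then show "\<nu> i \<noteq> 0" using orth[OF that that] by auto
  qed
  define W where "W = Matrix.mat n n (\<lambda>(i,j). ws ! j $ i / complex_of_real (\<nu> j))"
  have W: "W \<in> carrier_mat n n" by (simp add: W_def)
  have W'W: "mat_adjoint W * W = 1\<^sub>m n"
  proof (rule eq_matI)
    fix i j assume "i < dim_row (1\<^sub>m n :: complex mat)" "j < dim_col (1\<^sub>m n :: complex mat)"
    then have ij: "i < n" "j < n" by auto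
    have "(mat_adjoint W * W) $$ (i,j) = (\<Sum>l<n. cnj (ws ! i $ l / complex_of_real (\<nu> i)) * (ws ! j $ l / complex_of_real (\<nu> j)))"
      using W ij by (subst mat_mult_index[of _ n n _ n]) (auto simp: W_def)
    also have "\<dots> = cinner (ws ! i) (ws ! j) / (complex_of_real (\<nu> i) * complex_of_real (\<nu> j))"
      using wsc[OF ij(1)] by (auto simp: cinner_def sum_divide_distrib)
    also have "\<dots> = 1\<^sub>m n $$ (i,j)"
      using ij orth[OF ij] \<nu>sq[OF ij(1)] \<nu>0[OF ij(1)] by (cases "i = j") auto
    finally show "(mat_adjoint W * W) $$ (i,j) = 1\<^sub>m n $$ (i,j)" .
  qed (use W in auto)
  then have uW: "unitary_mat n W" using W by (simp add: unitary_mat_def)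
  note W' = unitary_matD[OF uW]
  define A' where "A' = mat_adjoint W * A * W"
  have A': "A' \<in> carrier_mat n n" using W' A by (auto simp: A'_def)
  have hA': "mat_adjoint A' = A'"
    using W' A hA unfolding A'_def
    by (simp add: mat_adjoint_mult[of _ n n _ n] assoc_mult_mat[of _ n n _ n _ n])
  have AW0: "(A * W) $$ (i,0) = e * W $$ (i,0)" if "i < n" for i
  proof -
    have "(A * W) $$ (i,0) = (\<Sum>l<n. A $$ (i,l) * v $ l) / complex_of_real (\<nu> 0)"
      using A W n that by (subst mat_mult_index[of _ n n _ n]) (auto simp: W_def ws0 sum_divide_distrib)
    also have "(\<Sum>l<n. A $$ (i,l) * v $ l) = (A *\<^sub>v v) $ i"
      using A that by (simp add: mat_vec_index[of _ n n] del: index_mult_mat_vec)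
    finally show ?thesis using that n v by (auto simp: Av W_def ws0)
  qed
  have A'0: "A' $$ (i,0) = (if i = 0 then e else 0)" if "i < n" for i
  proof -
    have "A' $$ (i,0) = (mat_adjoint W * (A * W)) $$ (i,0)"
      unfolding A'_def using W' A by (simp add: assoc_mult_mat[of _ n n _ n _ n])
    also have "\<dots> = (\<Sum>l<n. mat_adjoint W $$ (i,l) * (A * W) $$ (l,0))"
      by (rule mat_mult_index[of _ n n _ n]) (use W' A that n in auto)
    also have "\<dots> = (\<Sum>l<n. e * (mat_adjoint W $$ (i,l) * W $$ (l,0)))"
      by (rule sum.cong) (use AW0 in \<open>auto simp del: index_mult_mat\<close>)
    also have "\<dots> = e * (mat_adjoint W * W) $$ (i,0)"
      unfolding sum_distrib_left[symmetric]
      by (subst mat_mult_index[of _ n n _ n]) (use W' that n in auto)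
    finally show ?thesis using that n W' by simp
  qed
  have A'0': "A' $$ (0,i) = (if i = 0 then e else 0)" if "i < n" for i
  proof -
    have "A' $$ (0,i) = cnj (A' $$ (i,0))" using mat_adjoint_index[of 0 A' i] A' that hA' n by auto
    moreover have "e = cnj e" using mat_adjoint_index[of 0 A' 0] A' hA' n A'0[of 0] by auto
    ultimately show ?thesis using A'0[OF that] by auto
  qed
  define A1 where "A1 = Matrix.mat 1 1 (\<lambda>_. e)"
  define A3 where "A3 = Matrix.mat ?n1 ?n1 (\<lambda>(i,j). A' $$ (Suc i, Suc j))"
  have A1: "A1 \<in> carrier_mat 1 1" and A3: "A3 \<in> carrier_mat ?n1 ?n1" by (auto simp: A1_def A3_def)
  have A'block: "A' = four_block_mat A1 (0\<^sub>m 1 ?n1) (0\<^sub>m ?n1 1) A3"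
    using A' n A'0 A'0' by (intro eq_matI) (auto simp: A1_def A3_def)
  have hA3: "mat_adjoint A3 = A3"
  proof (rule eq_matI)
    fix i j assume "i < dim_row A3" "j < dim_col A3"
    then have ij: "i < ?n1" "j < ?n1" by (auto simp: A3_def)
    then have "A' $$ (Suc i, Suc j) = cnj (A' $$ (Suc j, Suc i))"
      using mat_adjoint_index[of "Suc i" A' "Suc j"] A' hA' by auto
    then show "mat_adjoint A3 $$ (i,j) = A3 $$ (i,j)" using ij by (simp add: A3_def)
  qed (auto simp: A3_def)
  have AW: "A = W * A' * mat_adjoint W"
  proof -
    have "W * A' * mat_adjoint W = (W * mat_adjoint W) * A * (W * mat_adjoint W)"
      unfolding A'_def by (simp only: mat_adjoint_adjoint sq_mat_simps[where n = n] W A)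
    then show ?thesis using W' A by simp
  qed
  have "similar_mat A' A" unfolding similar_mat_def
    by (intro exI, rule similar_mat_witI[of "mat_adjoint W" W n]) (use W' A A' A'_def in auto)
  from char_poly_similar[OF this] cp
  have "char_poly A' = [: -e,1 :] * (\<Prod> e \<leftarrow> es. [:- e, 1:])" by simp
  also have "char_poly A' = char_poly A1 * char_poly A3"
    unfolding A'block
    by (rule char_poly_four_block_zeros_col[OF A1 _ A3]) auto
  also have "char_poly A1 = [: -e,1 :]"
    by (simp add: A1_def char_poly_defs Determinant.det_def sign_def)
  finally have cp3: "char_poly A3 = (\<Prod> e \<leftarrow> es. [:- e, 1:])"
    by (metis mult_cancel_left pCons_eq_0_iff zero_neq_one)
  from Cons(1)[OF A3 hA3 cp3] obtain P where uP: "unitary_mat ?n1 P"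
    and A3P: "A3 = P * diag_of ?n1 (\<lambda>i. es ! i) * mat_adjoint P" by blast
  note P = unitary_matD[OF uP]
  define P' where "P' = four_block_mat (1\<^sub>m 1) (0\<^sub>m 1 ?n1) (0\<^sub>m ?n1 1) P"
  have P': "P' \<in> carrier_mat n n" using P n by (intro carrier_matI) (auto simp: P'_def)
  have aP': "mat_adjoint P' = four_block_mat (1\<^sub>m 1) (0\<^sub>m 1 ?n1) (0\<^sub>m ?n1 1) (mat_adjoint P)"
    using P n by (intro eq_matI) (auto simp: P'_def)
  have "mat_adjoint P' * P' = four_block_mat (1\<^sub>m 1) (0\<^sub>m 1 ?n1) (0\<^sub>m ?n1 1) (1\<^sub>m ?n1)"
    unfolding aP' unfolding P'_def using P
    by (subst mult_four_block_mat[of _ 1 1 _ ?n1 _ ?n1 _ _ 1 _ ?n1]) auto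
  also have "\<dots> = 1\<^sub>m n" using n by (intro eq_matI) auto
  finally have uP': "unitary_mat n P'" using P' by (simp add: unitary_mat_def)
  have D: "diag_of n (\<lambda>i. (e # es) ! i) = four_block_mat A1 (0\<^sub>m 1 ?n1) (0\<^sub>m ?n1 1) (diag_of ?n1 (\<lambda>i. es ! i))"
    using n by (intro eq_matI) (auto simp: A1_def nth_Cons')
  have "P' * diag_of n (\<lambda>i. (e # es) ! i) * mat_adjoint P' = A'"
    unfolding A'block D aP' unfolding P'_def A3P using P A1
    by (simp add: mult_four_block_mat[of _ 1 1 _ ?n1 _ ?n1 _ _ 1 _ ?n1]
        left_add_zero_mat[of _ "n - Suc 0" "n - Suc 0"] mult_carrier_mat[of _ "n - Suc 0" "n - Suc 0" _ "n - Suc 0"])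
  then have "A = W * (P' * diag_of n (\<lambda>i. (e # es) ! i) * mat_adjoint P') * mat_adjoint W"
    using AW by simp
  also have "\<dots> = (W * P') * diag_of n (\<lambda>i. (e # es) ! i) * mat_adjoint (W * P')"
    by (simp only: mat_adjoint_adjoint sq_mat_simps[where n = n] W P')
  finally have "A = (W * P') * diag_of n (\<lambda>i. (e # es) ! i) * mat_adjoint (W * P')" .
  then show ?case using unitary_mat_mult[OF uW uP'] by blast
qed

text \<open>The free order of the linear factors is used to sort the roots by real part. Hermitian
  symmetry of U^* A U then shows that the roots are real, so this is the decreasing order on which
  the rearrangement arguments rely.\<close>

lemma hermitian_spectral:
  assumes A: "A \<in> carrier_mat n n" and hA: "mat_adjoint A = A"
  obtains U d where "unitary_mat n U" "A = U * diag_of n (\<lambda>i. complex_of_real (d i)) * mat_adjoint U"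
    "\<And>i j. i \<le> j \<Longrightarrow> j < n \<Longrightarrow> d j \<le> d i"
proof -
  obtain as where as: "char_poly A = (\<Prod>a\<leftarrow>as. [:- a, 1:])" "length as = n"
    using char_poly_factorized[OF A] by blast
  define es where "es = rev (sort_key Re as)"
  have "mset es = mset as" by (simp add: es_def)
  then have cp: "char_poly A = (\<Prod>a\<leftarrow>es. [:- a, 1:])"
    unfolding as(1) by (simp flip: prod_mset_prod_list)
  have len: "length es = n" using as(2) by (simp add: es_def)
  obtain U where U: "unitary_mat n U" and AU: "A = U * diag_of n (\<lambda>i. es ! i) * mat_adjoint U"
    using hermitian_unitary_diag[OF A hA cp] by blast
  note u = unitary_matD[OF U]
  have D: "diag_of n (\<lambda>i. es ! i) = mat_adjoint U * A * U"
  proof -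
    have "mat_adjoint U * A * U = (mat_adjoint U * U) * diag_of n (\<lambda>i. es ! i) * (mat_adjoint U * U)"
      unfolding AU by (simp only: mat_adjoint_adjoint sq_mat_simps[where n = n] u(1))
    then show ?thesis using u by simp
  qed
  have "mat_adjoint (diag_of n (\<lambda>i. es ! i)) = diag_of n (\<lambda>i. es ! i)"
    unfolding D using u A hA by (simp add: mat_adjoint_mult[of _ n n _ n] assoc_mult_mat[of _ n n _ n _ n])
  then have "cnj (es ! i) = es ! i" if "i < n" for i
    using that mat_adjoint_index[of i "diag_of n (\<lambda>i. es ! i)" i] by auto
  then have re: "es ! i = complex_of_real (Re (es ! i))" if "i < n" for i
    using that by (simp add: complex_eq_iff)
  have "A = U * diag_of n (\<lambda>i. complex_of_real (Re (es ! i))) * mat_adjoint U"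
  proof -
    have "diag_of n (\<lambda>i. complex_of_real (Re (es ! i))) = diag_of n (\<lambda>i. es ! i)"
      using re by (intro eq_matI) auto
    then show ?thesis using AU by simp
  qed
  moreover have "Re (es ! j) \<le> Re (es ! i)" if "i \<le> j" "j < n" for i j
  proof -
    have "sorted (map Re (sort_key Re as))" by simp
    then have "map Re (sort_key Re as) ! (n - Suc j) \<le> map Re (sort_key Re as) ! (n - Suc i)"
      by (rule sorted_nth_mono) (use that as(2) in auto)
    then show ?thesis using that as(2) unfolding es_def by (simp add: rev_nth)
  qed
  ultimately show ?thesis using that[OF U, of "\<lambda>i. Re (es ! i)"] by blast
qed

subsection \<open>Inverses and resolvents\<close>

text \<open>A right inverse of a square matrix is two-sided and unique, hence it is the value chosen
  in \<open>minv\<close>.\<close>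

lemma minv_eqI:
  assumes M: "M \<in> carrier_mat n n" and R: "R \<in> carrier_mat n n" and MR: "M * R = 1\<^sub>m n"
  shows "minv n M = R"
proof -
  have RM: "R * M = 1\<^sub>m n" using mat_mult_left_right_inverse[OF M R MR] .
  show ?thesis unfolding minv_def
  proof (rule some_equality)
    fix S assume S: "S \<in> carrier_mat n n \<and> M * S = 1\<^sub>m n \<and> S * M = 1\<^sub>m n"
    then have "S = S * (M * R)" using MR S by (simp add: right_mult_one_mat[of _ n n])
    also have "\<dots> = (S * M) * R" using S M R assoc_mult_mat[of S n n M n R n] by simp
    finally show "S = R" using S R by simp
  qed (use R MR RM in auto)
qed

lemma minv_eq_adj_mat:
  assumes M: "M \<in> carrier_mat n n" and d: "Determinant.det M \<noteq> 0"
  shows "minv n M = (1 / Determinant.det M) \<cdot>\<^sub>m adj_mat M"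
proof (rule minv_eqI[OF M])
  show "(1 / Determinant.det M) \<cdot>\<^sub>m adj_mat M \<in> carrier_mat n n" using adj_mat(1)[OF M] by simp
  show "M * ((1 / Determinant.det M) \<cdot>\<^sub>m adj_mat M) = 1\<^sub>m n"
    using adj_mat[OF M] M d by (subst mult_smult_distrib[of _ n n _ n]) (auto intro!: eq_matI)
qed

lemma minv_inverse:
  assumes M: "M \<in> carrier_mat n n" and d: "Determinant.det M \<noteq> 0"
  shows "minv n M \<in> carrier_mat n n" "M * minv n M = 1\<^sub>m n" "minv n M * M = 1\<^sub>m n"
proof -
  show 1: "minv n M \<in> carrier_mat n n" using adj_mat(1)[OF M] by (simp add: minv_eq_adj_mat[OF assms])
  show 2: "M * minv n M = 1\<^sub>m n"
    unfolding minv_eq_adj_mat[OF assms]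
    using adj_mat[OF M] M d by (subst mult_smult_distrib[of _ n n _ n]) (auto intro!: eq_matI)
  show "minv n M * M = 1\<^sub>m n" using mat_mult_left_right_inverse[OF M 1 2] .
qed

lemma resolvent_carrier: "X \<in> carrier_mat n n \<Longrightarrow> z \<cdot>\<^sub>m 1\<^sub>m n - X \<in> carrier_mat n n"
  by (rule minus_carrier_mat)

lemma det_resolvent_nonzero:
  assumes X: "(X :: complex mat) \<in> carrier_mat n n" and z: "\<not> eigenvalue X z"
  shows "Determinant.det (z \<cdot>\<^sub>m 1\<^sub>m n - X) \<noteq> 0"
proof
  assume "Determinant.det (z \<cdot>\<^sub>m 1\<^sub>m n - X) = 0"
  then obtain v where v: "v \<in> carrier_vec n" "v \<noteq> 0\<^sub>v n" "(z \<cdot>\<^sub>m 1\<^sub>m n - X) *\<^sub>v v = 0\<^sub>v n"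
    using det_0_iff_vec_prod_zero[of "z \<cdot>\<^sub>m 1\<^sub>m n - X" n] resolvent_carrier[OF X] by auto
  have "(z \<cdot>\<^sub>m 1\<^sub>m n - X) *\<^sub>v v = z \<cdot>\<^sub>v v - X *\<^sub>v v"
    using X v by (subst minus_mult_distrib_mat_vec[of _ n n]) auto
  then have "z \<cdot>\<^sub>v v - X *\<^sub>v v = 0\<^sub>v n" using v by simp
  then have "(z \<cdot>\<^sub>v v - X *\<^sub>v v) $ i = 0" if "i < n" for i using that by simp
  then have "X *\<^sub>v v = z \<cdot>\<^sub>v v"
    using X v by (intro eq_vecI) auto
  then show False using z v X by (auto simp: eigenvalue_def eigenvector_def)
qed

lemma resolvent_inverse:
  assumes X: "(X :: complex mat) \<in> carrier_mat n n" and z: "\<not> eigenvalue X z"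
  shows "minv n (z \<cdot>\<^sub>m 1\<^sub>m n - X) \<in> carrier_mat n n"
    "(z \<cdot>\<^sub>m 1\<^sub>m n - X) * minv n (z \<cdot>\<^sub>m 1\<^sub>m n - X) = 1\<^sub>m n"
    "minv n (z \<cdot>\<^sub>m 1\<^sub>m n - X) * (z \<cdot>\<^sub>m 1\<^sub>m n - X) = 1\<^sub>m n"
  by (rule minv_inverse[OF resolvent_carrier[OF X] det_resolvent_nonzero[OF X z]])+

lemma holomorphic_on_det:
  assumes "\<And>z. M z \<in> carrier_mat n n"
    and "\<And>i j. i < n \<Longrightarrow> j < n \<Longrightarrow> (\<lambda>z. M z $$ (i,j)) holomorphic_on S"
  shows "(\<lambda>z. Determinant.det (M z)) holomorphic_on S"
proof -
  have "(\<lambda>z. \<Sum>p | p permutes {0..<n}. signof p * (\<Prod>i = 0..<n. M z $$ (i, p i))) holomorphic_on S"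
    by (intro holomorphic_intros assms(2)) (auto simp: permutes_in_image)
  then show ?thesis using det_def'[OF assms(1)] by simp
qed

text \<open>Cramer's rule: the entries are cofactors divided by det(z - X). Both are polynomial in
  z, and the determinant vanishes only at eigenvalues.\<close>

lemma holomorphic_on_resolvent:
  assumes X: "(X :: complex mat) \<in> carrier_mat n n" and ij: "i < n" "j < n"
  shows "(\<lambda>z. minv n (z \<cdot>\<^sub>m 1\<^sub>m n - X) $$ (i,j)) holomorphic_on {z. \<not> eigenvalue X z}"
proof -
  let ?M = "\<lambda>z. z \<cdot>\<^sub>m 1\<^sub>m n - X"
  have M: "?M z \<in> carrier_mat n n" for z using resolvent_carrier[OF X] .
  have Mij: "(\<lambda>z. ?M z $$ (k,l)) holomorphic_on S" if "k < n" "l < n" for k l S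
  proof -
    have "(\<lambda>z. ?M z $$ (k,l)) = (\<lambda>z. z * (if k = l then 1 else 0) - X $$ (k,l))"
      using X that by (auto simp: fun_eq_iff)
    then show ?thesis by (auto intro!: holomorphic_intros)
  qed
  have cof: "(\<lambda>z. cofactor (?M z) j i) holomorphic_on S" for S
    unfolding cofactor_def
  proof (intro holomorphic_intros holomorphic_on_det[of _ "n - 1"])
    fix k l assume kl: "k < n - 1" "l < n - 1"
    have "(\<lambda>z. mat_delete (?M z) j i $$ (k,l)) = (\<lambda>z. ?M z $$ (if k < j then k else Suc k, if l < i then l else Suc l))"
      using kl X by (auto simp: mat_delete_def fun_eq_iff)
    then show "(\<lambda>z. mat_delete (?M z) j i $$ (k,l)) holomorphic_on S"
      using kl by (simp only:, intro Mij) auto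
  qed (use X in \<open>auto simp: mat_delete_def\<close>)
  have "(\<lambda>z. 1 / Determinant.det (?M z) * cofactor (?M z) j i) holomorphic_on {z. \<not> eigenvalue X z}"
    by (intro holomorphic_intros cof holomorphic_on_det[of _ n] M Mij)
      (auto simp: det_resolvent_nonzero[OF X])
  then show ?thesis
    by (rule holomorphic_transform)
      (use X ij in \<open>auto simp: minv_eq_adj_mat[OF M det_resolvent_nonzero[OF X]] adj_mat_def\<close>)
qed

lemma finite_eigenvalues:
  assumes "(X :: complex mat) \<in> carrier_mat n n"
  shows "finite {z. eigenvalue X z}"
proof -
  have "char_poly X \<noteq> 0" using degree_monic_char_poly[OF assms] by auto
  then show ?thesis using poly_roots_finite by (simp add: eigenvalue_root_char_poly[OF assms])
qed

subsection \<open>The Cauchy functional calculus\<close>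

lemma slit_plane_eq: "slit_plane = - (complex_of_real ` {..0})"
  by (auto simp: slit_plane_def)

lemma open_slit_plane: "open slit_plane"
  unfolding slit_plane_eq by (rule open_Compl, rule closed_slot_left)

lemma simply_connected_slit_plane: "simply_connected slit_plane"
  unfolding slit_plane_eq by (rule starlike_imp_simply_connected, rule starlike_slotted_complex_plane_left)

lemma connected_slit_plane: "connected slit_plane"
  using simply_connected_slit_plane simply_connected_imp_connected by blast

lemma mem_slit_plane_iff: "z \<in> slit_plane \<longleftrightarrow> Re z > 0 \<or> Im z \<noteq> 0"
proof -
  have "z \<in> complex_of_real ` {..0} \<longleftrightarrow> Re z \<le> 0 \<and> Im z = 0"
    by (metis (no_types, lifting) Im_complex_of_real Re_complex_of_real atMost_iff complex_of_real_def
        complex_surj image_iff)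
  then show ?thesis by (auto simp: slit_plane_def)
qed

text \<open>The matrix in the body of \<open>holo_fun\<close>, with the curve as a parameter, so
  that independence of the curve can be stated.\<close>

definition cfc :: "(real \<Rightarrow> complex) \<Rightarrow> (complex \<Rightarrow> complex) \<Rightarrow> complex mat \<Rightarrow> complex mat" where
  "cfc \<gamma> F X = Matrix.mat (dim_row X) (dim_row X) (\<lambda>(i,j).
     contour_integral \<gamma> (\<lambda>z. F z * minv (dim_row X) (z \<cdot>\<^sub>m 1\<^sub>m (dim_row X) - X) $$ (i,j))
       / (2 * complex_of_real pi * \<i>))"

lemma cfc_carrier[simp]: "X \<in> carrier_mat n n \<Longrightarrow> cfc \<gamma> F X \<in> carrier_mat n n"
  by (auto simp: cfc_def)

lemma cfc_dims[simp]: "dim_row (cfc \<gamma> F X) = dim_row X" "dim_col (cfc \<gamma> F X) = dim_row X"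
  by (simp_all add: cfc_def)

lemma cfc_index:
  "\<lbrakk>X \<in> carrier_mat n n; i < n; j < n\<rbrakk> \<Longrightarrow> cfc \<gamma> F X $$ (i,j) =
     contour_integral \<gamma> (\<lambda>z. F z * minv n (z \<cdot>\<^sub>m 1\<^sub>m n - X) $$ (i,j)) / (2 * complex_of_real pi * \<i>)"
  by (auto simp: cfc_def)

text \<open>Both integrals are the same residue sum, which sees a closed curve only through its
  winding numbers around the singularities.\<close>

lemma contour_integral_eq_by_winding:
  assumes "open S" "connected S" "finite P" "g holomorphic_on S - P"
    and "valid_path \<gamma>1" "pathfinish \<gamma>1 = pathstart \<gamma>1" "path_image \<gamma>1 \<subseteq> S - P"
    and "valid_path \<gamma>2" "pathfinish \<gamma>2 = pathstart \<gamma>2" "path_image \<gamma>2 \<subseteq> S - P"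
    and "\<forall>z. z \<notin> S \<longrightarrow> winding_number \<gamma>1 z = 0" "\<forall>z. z \<notin> S \<longrightarrow> winding_number \<gamma>2 z = 0"
    and "\<And>p. p \<in> P \<Longrightarrow> winding_number \<gamma>1 p = winding_number \<gamma>2 p"
  shows "contour_integral \<gamma>1 g = contour_integral \<gamma>2 g"
proof -
  have "contour_integral \<gamma>1 g = 2 * pi * \<i> * (\<Sum>p\<in>P. winding_number \<gamma>1 p * residue g p)"
    by (rule Residue_theorem[where S = S]) (use assms in auto)
  also have "\<dots> = 2 * pi * \<i> * (\<Sum>p\<in>P. winding_number \<gamma>2 p * residue g p)"
    using assms(13) by simp
  also have "\<dots> = contour_integral \<gamma>2 g"
    by (rule Residue_theorem[where S = S, symmetric]) (use assms in auto)
  finally show ?thesis .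
qed

text \<open>The slit plane is simply connected, so closed curves inside it do not wind around points
  outside, and the eigenvalues of X are the only singularities of the integrand.\<close>

lemma cfc_cong_path:
  assumes X: "X \<in> carrier_mat n n" and F: "F holomorphic_on slit_plane"
    and \<gamma>: "valid_path \<gamma>" "pathfinish \<gamma> = pathstart \<gamma>" "path_image \<gamma> \<subseteq> slit_plane"
      "\<And>w. eigenvalue X w \<Longrightarrow> w \<notin> path_image \<gamma> \<and> winding_number \<gamma> w = 1"
    and \<gamma>': "valid_path \<gamma>'" "pathfinish \<gamma>' = pathstart \<gamma>'" "path_image \<gamma>' \<subseteq> slit_plane"
      "\<And>w. eigenvalue X w \<Longrightarrow> w \<notin> path_image \<gamma>' \<and> winding_number \<gamma>' w = 1"
  shows "cfc \<gamma> F X = cfc \<gamma>' F X"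
proof -
  have w: "winding_number \<delta> z = 0" if "valid_path \<delta>" "pathfinish \<delta> = pathstart \<delta>" "path_image \<delta> \<subseteq> slit_plane" "z \<notin> slit_plane" for \<delta> z
    using that simply_connected_imp_winding_number_zero[OF simply_connected_slit_plane]
    by (auto simp: valid_path_imp_path)
  have "contour_integral \<gamma> (\<lambda>z. F z * minv n (z \<cdot>\<^sub>m 1\<^sub>m n - X) $$ (i,j))
      = contour_integral \<gamma>' (\<lambda>z. F z * minv n (z \<cdot>\<^sub>m 1\<^sub>m n - X) $$ (i,j))" if ij: "i < n" "j < n" for i j
  proof (rule contour_integral_eq_by_winding[OF open_slit_plane connected_slit_plane finite_eigenvalues[OF X]])
    show "(\<lambda>z. F z * minv n (z \<cdot>\<^sub>m 1\<^sub>m n - X) $$ (i,j)) holomorphic_on slit_plane - {z. eigenvalue X z}"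
      by (intro holomorphic_intros holomorphic_on_subset[OF F] holomorphic_on_subset[OF holomorphic_on_resolvent[OF X ij]]) auto
  qed (use \<gamma> \<gamma>' w in auto)
  then show ?thesis using X by (intro eq_matI) (auto simp: cfc_def)
qed

text \<open>The condition r < c keeps the closed disc in the open right half-plane, hence off the
  slit. The spectra that occur below are finite subsets of that half-plane, so such a circle can
  always be put around them.\<close>

locale disc_contour =
  fixes c r :: real and \<gamma> :: "real \<Rightarrow> complex"
  assumes rc: "0 < r" "r < c"
  defines "\<gamma> \<equiv> circlepath (complex_of_real c) r"
begin

lemma cball_slit: "cball (complex_of_real c) r \<subseteq> slit_plane"
proof
  fix z assume "z \<in> cball (complex_of_real c) r"
  then have "\<bar>Re (complex_of_real c - z)\<bar> \<le> r"
    using abs_Re_le_cmod[of "complex_of_real c - z"] by (auto simp: dist_norm)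
  then show "z \<in> slit_plane" using rc by (auto simp: mem_slit_plane_iff)
qed

lemma sphere_slit: "sphere (complex_of_real c) r \<subseteq> slit_plane"
  using cball_slit sphere_cball by blast

lemma path_image_gamma[simp]: "path_image \<gamma> = sphere (complex_of_real c) r"
  using rc by (simp add: \<gamma>_def)

lemma gamma_path[simp]: "valid_path \<gamma>" "pathfinish \<gamma> = pathstart \<gamma>" "simple_path \<gamma>"
  using rc by (simp_all add: \<gamma>_def simple_path_circlepath)

lemma winding_gamma: "w \<in> ball (complex_of_real c) r \<Longrightarrow> winding_number \<gamma> w = 1"
  by (simp add: \<gamma>_def winding_number_circlepath dist_norm norm_minus_commute)

text \<open>All admissible curves give the same matrix, so the choice in \<open>holo_fun\<close> is
  determined once one admissible curve exists; the circle is one.\<close>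

lemma holo_fun_eq_cfc:
  assumes X: "X \<in> carrier_mat n n" and F: "F holomorphic_on slit_plane"
    and ev: "\<And>w. eigenvalue X w \<Longrightarrow> w \<in> ball (complex_of_real c) r"
  shows "holo_fun F X = cfc \<gamma> F X"
proof -
  let ?P = "\<lambda>\<gamma>. valid_path \<gamma> \<and> simple_path \<gamma> \<and> pathfinish \<gamma> = pathstart \<gamma> \<and>
      path_image \<gamma> \<subseteq> slit_plane \<and>
      (\<forall>w. eigenvalue X w \<longrightarrow> w \<notin> path_image \<gamma> \<and> winding_number \<gamma> w = 1)"
  have P: "?P \<gamma>" using ev winding_gamma sphere_slit by auto
  have eq: "holo_fun F X = (SOME M. \<exists>\<gamma>. ?P \<gamma> \<and> M = cfc \<gamma> F X)"
    unfolding holo_fun_def cfc_def by (simp only: conj_assoc)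
  show ?thesis unfolding eq
  proof (rule some_equality)
    show "\<exists>\<gamma>'. ?P \<gamma>' \<and> cfc \<gamma> F X = cfc \<gamma>' F X" using P by blast
    fix M assume "\<exists>\<gamma>'. ?P \<gamma>' \<and> M = cfc \<gamma>' F X"
    then obtain \<gamma>' where g: "?P \<gamma>'" "M = cfc \<gamma>' F X" by blast
    show "M = cfc \<gamma> F X" unfolding g(2)
      by (rule cfc_cong_path[OF X F]) (use g(1) P in blast)+
  qed
qed

lemma resolvent_continuous:
  assumes X: "X \<in> carrier_mat n n" and ij: "i < n" "j < n"
    and ev: "\<And>w. eigenvalue X w \<Longrightarrow> w \<in> ball (complex_of_real c) r"
  shows "continuous_on (sphere (complex_of_real c) r) (\<lambda>z. minv n (z \<cdot>\<^sub>m 1\<^sub>m n - X) $$ (i,j))"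
  by (rule holomorphic_on_imp_continuous_on, rule holomorphic_on_subset[OF holomorphic_on_resolvent[OF X ij]])
    (use ev in fastforce)

lemma integrable_gamma:
  "continuous_on (sphere (complex_of_real c) r) g \<Longrightarrow> g contour_integrable_on \<gamma>"
  unfolding \<gamma>_def using rc by (intro contour_integrable_continuous_circlepath) simp

lemma Cauchy_gamma:
  assumes "F holomorphic_on slit_plane" "w \<in> ball (complex_of_real c) r"
  shows "((\<lambda>z. F z / (z - w)) has_contour_integral (2 * complex_of_real pi * \<i> * F w)) \<gamma>"
  unfolding \<gamma>_def
  by (rule Cauchy_integral_circlepath_simple[OF holomorphic_on_subset[OF assms(1) cball_slit]])
    (use assms(2) in \<open>auto simp: dist_norm norm_minus_commute\<close>)

text \<open>The resolvent is diagonal in the same basis as X, so each entry of the integral is a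
  combination of scalar Cauchy integrals.\<close>

lemma cfc_unitary_diag:
  assumes U: "unitary_mat n U" and X: "X = U * diag_of n d * mat_adjoint U"
    and d: "\<And>i. i < n \<Longrightarrow> d i \<in> ball (complex_of_real c) r"
    and F: "F holomorphic_on slit_plane"
  shows "cfc \<gamma> F X = U * diag_of n (\<lambda>i. F (d i)) * mat_adjoint U"
proof -
  note u = unitary_matD[OF U]
  have Xc: "X \<in> carrier_mat n n" using u X by auto
  have inv: "minv n (z \<cdot>\<^sub>m 1\<^sub>m n - X) = U * diag_of n (\<lambda>i. 1 / (z - d i)) * mat_adjoint U"
    if z: "z \<in> sphere (complex_of_real c) r" for z
  proof (rule minv_eqI)
    have zd: "z - d i \<noteq> 0" if "i < n" for i using d[OF that] z by auto
    have "z \<cdot>\<^sub>m 1\<^sub>m n = U * diag_of n (\<lambda>i. z) * mat_adjoint U"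
    proof -
      have "diag_of n (\<lambda>i. z) = z \<cdot>\<^sub>m 1\<^sub>m n" by (rule eq_matI) auto
      then have "U * diag_of n (\<lambda>i. z) * mat_adjoint U = z \<cdot>\<^sub>m (U * 1\<^sub>m n * mat_adjoint U)"
        using u(1,2) by (simp add: mult_smult_distrib[of _ n n _ n] mult_smult_assoc_mat[of _ n n _ n])
      then show ?thesis using u by simp
    qed
    then have "z \<cdot>\<^sub>m 1\<^sub>m n - X = U * diag_of n (\<lambda>i. z) * mat_adjoint U - U * diag_of n d * mat_adjoint U"
      using X by simp
    also have "\<dots> = U * diag_of n (\<lambda>i. z - d i) * mat_adjoint U"
      using u(1) by (intro eq_matI)
        (auto simp: conj_diag_index sum_subtractf[symmetric] algebra_simps simp del: index_mult_mat(1))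
    finally have zX: "z \<cdot>\<^sub>m 1\<^sub>m n - X = U * diag_of n (\<lambda>i. z - d i) * mat_adjoint U" .
    have "(z \<cdot>\<^sub>m 1\<^sub>m n - X) * (U * diag_of n (\<lambda>i. 1 / (z - d i)) * mat_adjoint U)
      = U * (diag_of n (\<lambda>i. z - d i) * ((mat_adjoint U * U) * diag_of n (\<lambda>i. 1 / (z - d i)))) * mat_adjoint U"
      unfolding zX by (simp only: sq_mat_simps[where n = n] u(1))
    also have "\<dots> = U * diag_of n (\<lambda>i. (z - d i) * (1 / (z - d i))) * mat_adjoint U"
      using u by (simp add: diag_of_mult left_mult_one_mat[of _ n n])
    also have "diag_of n (\<lambda>i. (z - d i) * (1 / (z - d i))) = 1\<^sub>m n"
      using zd by (intro eq_matI) auto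
    finally show "(z \<cdot>\<^sub>m 1\<^sub>m n - X) * (U * diag_of n (\<lambda>i. 1 / (z - d i)) * mat_adjoint U) = 1\<^sub>m n"
      using u by simp
  qed (use u Xc in auto)
  show ?thesis
  proof (rule eq_matI)
    fix i j assume "i < dim_row (U * diag_of n (\<lambda>i. F (d i)) * mat_adjoint U)" "j < dim_col (U * diag_of n (\<lambda>i. F (d i)) * mat_adjoint U)"
    then have ij: "i < n" "j < n" using u by auto
    have "((\<lambda>z. \<Sum>k<n. U $$ (i,k) * cnj (U $$ (j,k)) * (F z / (z - d k))) has_contour_integral
       (\<Sum>k<n. U $$ (i,k) * cnj (U $$ (j,k)) * (2 * complex_of_real pi * \<i> * F (d k)))) \<gamma>"
      by (intro has_contour_integral_sum has_contour_integral_lmul Cauchy_gamma F d) auto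
    then have "contour_integral \<gamma> (\<lambda>z. \<Sum>k<n. U $$ (i,k) * cnj (U $$ (j,k)) * (F z / (z - d k)))
      = (\<Sum>k<n. U $$ (i,k) * cnj (U $$ (j,k)) * (2 * complex_of_real pi * \<i> * F (d k)))"
      by (rule contour_integral_unique)
    moreover have "contour_integral \<gamma> (\<lambda>z. F z * minv n (z \<cdot>\<^sub>m 1\<^sub>m n - X) $$ (i,j)) =
      contour_integral \<gamma> (\<lambda>z. \<Sum>k<n. U $$ (i,k) * cnj (U $$ (j,k)) * (F z / (z - d k)))"
      by (rule contour_integral_eq)
        (use ij in \<open>simp add: inv conj_diag_index[OF u(1)] sum_distrib_left ac_simps del: index_mult_mat(1)\<close>)
    ultimately show "cfc \<gamma> F X $$ (i,j) = (U * diag_of n (\<lambda>i. F (d i)) * mat_adjoint U) $$ (i,j)"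
      using ij by (simp add: cfc_index[OF Xc] conj_diag_index[OF u(1)] sum_distrib_left sum_divide_distrib
         ac_simps del: index_mult_mat(1))
  qed (use u Xc in auto)
qed

end

lemma eigenvalue_unitary_diag:
  assumes U: "unitary_mat n U" and X: "X = U * diag_of n d * mat_adjoint U" and i: "i < n"
  shows "eigenvalue X (d i)"
proof -
  note u = unitary_matD[OF U]
  have Xc: "X \<in> carrier_mat n n" using u X by auto
  have XU: "X * U = U * diag_of n d"
  proof -
    have "X * U = U * diag_of n d * (mat_adjoint U * U)" unfolding X
      by (simp only: sq_mat_simps[where n = n] u(1))
    then show ?thesis using u by simp
  qed
  have "X *\<^sub>v Matrix.col U i = Matrix.col (X * U) i"
    using Xc u(1) i by (intro eq_vecI) auto
  also have "\<dots> = d i \<cdot>\<^sub>v Matrix.col U i"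
    unfolding XU using u(1) i by (intro eq_vecI) (auto simp: mult_diag_of_right[of _ n n] mult.commute)
  finally have "X *\<^sub>v Matrix.col U i = d i \<cdot>\<^sub>v Matrix.col U i" .
  moreover have "Matrix.col U i \<noteq> 0\<^sub>v n"
  proof
    assume *: "Matrix.col U i = 0\<^sub>v n"
    have "U $$ (k,i) = 0" if "k < n" for k
    proof -
      have "Matrix.col U i $ k = 0" unfolding * using that by simp
      then show ?thesis using that u(1) i by simp
    qed
    then have "(mat_adjoint U * U) $$ (i,i) = 0"
      using u(1,2) i by (subst mat_mult_index[of _ n n _ n]) auto
    then show False using u(3) i by simp
  qed
  ultimately show ?thesis using Xc u(1) unfolding eigenvalue_def eigenvector_def
    by (intro exI[of _ "Matrix.col U i"]) auto
qed

context disc_contour begin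

text \<open>The bridge between the two functional calculi. The decomposition chosen in
  \<open>herm_fun\<close> is not unique, but each one reproduces the Cauchy integral, which does not
  mention it. F and f agree at the eigenvalues because the disc meets the real axis in positive
  numbers only.\<close>

lemma herm_fun_eq_cfc:
  assumes X: "X \<in> carrier_mat n n" and hX: "mat_adjoint X = X"
    and ev: "\<And>w. eigenvalue X w \<Longrightarrow> w \<in> ball (complex_of_real c) r"
    and F: "F holomorphic_on slit_plane"
    and fF: "\<And>x. x > 0 \<Longrightarrow> F (complex_of_real x) = complex_of_real (f x)"
  shows "herm_fun f X = cfc \<gamma> F X"
proof -
  have dims: "dim_row X = n" using X by auto
  have *: "U * diag_of n (\<lambda>i. complex_of_real (f (d i))) * mat_adjoint U = cfc \<gamma> F X"
    if U: "unitary_mat n U" and Xd: "X = U * diag_of n (\<lambda>i. complex_of_real (d i)) * mat_adjoint U" for U d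
  proof -
    have b: "complex_of_real (d i) \<in> ball (complex_of_real c) r" if "i < n" for i
      using ev eigenvalue_unitary_diag[OF U Xd that] by blast
    have pos: "d i > 0" if "i < n" for i
    proof -
      have "dist (complex_of_real c) (complex_of_real (d i)) < r" using b[OF that] by simp
      then have "\<bar>c - d i\<bar> < r" unfolding dist_norm of_real_diff[symmetric] norm_of_real by simp
      then show ?thesis using rc by linarith
    qed
    have "diag_of n (\<lambda>i. complex_of_real (f (d i))) = diag_of n (\<lambda>i. F (complex_of_real (d i)))"
      using pos fF by (intro eq_matI) auto
    then show ?thesis using cfc_unitary_diag[OF U Xd b F] by simp
  qed
  obtain U d where Ud: "unitary_mat n U" "X = U * diag_of n (\<lambda>i. complex_of_real (d i)) * mat_adjoint U"
    using hermitian_spectral[OF X hX] by metis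
  show ?thesis unfolding herm_fun_def dims
  proof (rule some_equality)
    show "\<exists>U d. unitary_mat n U \<and> X = U * diag_of n (\<lambda>i. complex_of_real (d i)) * mat_adjoint U \<and>
      cfc \<gamma> F X = U * diag_of n (\<lambda>i. complex_of_real (f (d i))) * mat_adjoint U"
      using Ud *[OF Ud] by metis
  qed (use * in metis)
qed

end

text \<open>As c grows, the discs about c of radius c - \<delta> exhaust the half-plane Re z >
  \<delta>.\<close>

lemma ex_disc_contour:
  assumes "finite S" "\<And>z. z \<in> S \<Longrightarrow> Re z > 0"
  obtains c r where "disc_contour c r" "S \<subseteq> ball (complex_of_real c) r"
proof -
  define \<delta> where "\<delta> = Min (insert 1 (Re ` S)) / 2"
  define M where "M = Max (insert 1 ((\<lambda>z. (cmod z)\<^sup>2) ` S))"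
  have \<delta>: "\<delta> > 0" using assms by (auto simp: \<delta>_def)
  have \<delta>S: "Re z \<ge> 2 * \<delta>" if "z \<in> S" for z using assms that by (auto simp: \<delta>_def)
  have M: "(cmod z)\<^sup>2 \<le> M" if "z \<in> S" for z using assms that by (auto simp: M_def)
  have M1: "M \<ge> 1" using assms by (auto simp: M_def)
  \<comment> \<open>With |z|^2 \<le> M and Re z \<ge> 2\<delta>, the point z is within c - \<delta>
    of c as soon as M < 2c\<delta> + \<delta>^2; this c gives 2c\<delta> = M + 2\<delta>^2.\<close>
  define c where "c = M / (2 * \<delta>) + \<delta>"
  have c: "c > \<delta>" using M1 \<delta> by (simp add: c_def)
  have "z \<in> ball (complex_of_real c) (c - \<delta>)" if z: "z \<in> S" for z
  proof -
    have "(cmod (complex_of_real c - z))\<^sup>2 = (cmod z)\<^sup>2 - 2 * c * Re z + c\<^sup>2"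
      unfolding cmod_power2 by (simp add: power2_eq_square algebra_simps)
    also have "\<dots> \<le> M - 2 * c * (2 * \<delta>) + c\<^sup>2"
    proof -
      have "2 * c * (2 * \<delta>) \<le> 2 * c * Re z" using \<delta>S[OF z] c \<delta> by (intro mult_left_mono) auto
      then show ?thesis using M[OF z] by linarith
    qed
    also have "\<dots> < (c - \<delta>)\<^sup>2"
    proof -
      have "2 * c * \<delta> = M + 2 * \<delta>\<^sup>2" using \<delta> by (simp add: c_def field_simps power2_eq_square)
      moreover have "\<delta>\<^sup>2 > 0" using \<delta> by simp
      ultimately show ?thesis by (simp add: power2_eq_square algebra_simps)
    qed
    finally have "cmod (complex_of_real c - z) < c - \<delta>"
      using c by (intro power2_less_imp_less[of _ "c - \<delta>"]) auto
    then show ?thesis by (simp add: dist_norm)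
  qed
  moreover have "disc_contour c (c - \<delta>)" using c \<delta> by unfold_locales auto
  ultimately show ?thesis using that by blast
qed

text \<open>Two passes through z R = 1 + X R. Summing moduli bounds the entry sum s of R by 2n/|z|,
  because K is at most |z|/2; inserting this into R - 1/z = X R / z gives the second power of |z| in
  the denominator.\<close>

lemma resolvent_entry_bound:
  assumes X: "(X :: complex mat) \<in> carrier_mat n n" and ij: "i < n" "j < n"
    and z: "\<not> eigenvalue X z"
    and K: "K = (\<Sum>i<n. \<Sum>j<n. cmod (X $$ (i,j)))" and zK: "cmod z \<ge> 2 * K + 1"
  shows "cmod (minv n (z \<cdot>\<^sub>m 1\<^sub>m n - X) $$ (i,j) - (if i = j then 1 else 0) / z) \<le> 2 * n * K / (cmod z)\<^sup>2"
proof -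
  define R where "R = minv n (z \<cdot>\<^sub>m 1\<^sub>m n - X)"
  note R = resolvent_inverse[OF X z, folded R_def]
  have eq: "z * R $$ (i,j) - (\<Sum>k<n. X $$ (i,k) * R $$ (k,j)) = (if i = j then 1 else 0)" if "i < n" "j < n" for i j
  proof -
    have "(if i = j then 1 else 0) = ((z \<cdot>\<^sub>m 1\<^sub>m n - X) * R) $$ (i,j)" using R(2) that by simp
    also have "\<dots> = (\<Sum>k<n. (z \<cdot>\<^sub>m 1\<^sub>m n - X) $$ (i,k) * R $$ (k,j))"
      by (rule mat_mult_index[OF resolvent_carrier[OF X] R(1) that])
    also have "\<dots> = (\<Sum>k<n. (if k = i then z * R $$ (k,j) else 0) - X $$ (i,k) * R $$ (k,j))"
      by (rule sum.cong) (use X that in \<open>auto simp: algebra_simps\<close>)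
    also have "\<dots> = z * R $$ (i,j) - (\<Sum>k<n. X $$ (i,k) * R $$ (k,j))"
      using that by (simp add: sum_subtractf sum.delta)
    finally show ?thesis by simp
  qed
  have K0: "K \<ge> 0" unfolding K by (intro sum_nonneg) auto
  define s where "s = (\<Sum>i<n. \<Sum>j<n. cmod (R $$ (i,j)))"
  have s0: "s \<ge> 0" unfolding s_def by (intro sum_nonneg) auto
  have col: "(\<Sum>j<n. cmod (R $$ (k,j))) \<le> s" if "k < n" for k
    unfolding s_def using that by (intro member_le_sum[of k "{..<n}" "\<lambda>k. \<Sum>j<n. cmod (R $$ (k,j))"]) (auto intro: sum_nonneg)
  have "cmod z * s = (\<Sum>i<n. \<Sum>j<n. cmod (z * R $$ (i,j)))"
    by (simp add: s_def sum_distrib_left norm_mult)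
  also have "\<dots> \<le> (\<Sum>i<n. \<Sum>j<n. (if i = j then 1 else 0) + (\<Sum>k<n. cmod (X $$ (i,k)) * cmod (R $$ (k,j))))"
  proof (intro sum_mono)
    fix i j assume "i \<in> {..<n}" "j \<in> {..<n}"
    then have ij: "i < n" "j < n" by auto
    have "z * R $$ (i,j) = (if i = j then 1 else 0) + (\<Sum>k<n. X $$ (i,k) * R $$ (k,j))"
      using eq[OF ij] by (simp add: algebra_simps)
    also have "cmod \<dots> \<le> cmod (if i = j then 1 else 0) + (\<Sum>k<n. cmod (X $$ (i,k) * R $$ (k,j)))"
      by (intro order_trans[OF norm_triangle_ineq] add_left_mono norm_sum)
    finally show "cmod (z * R $$ (i,j)) \<le> (if i = j then 1 else 0) + (\<Sum>k<n. cmod (X $$ (i,k)) * cmod (R $$ (k,j)))"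
      by (simp add: norm_mult split: if_splits)
  qed
  also have "\<dots> = n + (\<Sum>i<n. \<Sum>k<n. cmod (X $$ (i,k)) * (\<Sum>j<n. cmod (R $$ (k,j))))"
  proof -
    have "(\<Sum>i<n. \<Sum>j<n. \<Sum>k<n. cmod (X $$ (i,k)) * cmod (R $$ (k,j)))
       = (\<Sum>i<n. \<Sum>k<n. cmod (X $$ (i,k)) * (\<Sum>j<n. cmod (R $$ (k,j))))"
      by (rule sum.cong[OF refl], subst sum.swap) (simp add: sum_distrib_left)
    then show ?thesis by (simp add: sum.distrib)
  qed
  also have "\<dots> \<le> n + (\<Sum>i<n. \<Sum>k<n. cmod (X $$ (i,k)) * s)"
    by (intro add_left_mono sum_mono mult_left_mono col) auto
  also have "\<dots> = n + K * s" by (simp add: K sum_distrib_right)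
  finally have 1: "cmod z * s \<le> n + K * s" .
  have "K * s \<le> (cmod z / 2) * s" using zK s0 by (intro mult_right_mono) auto
  then have zs: "s * cmod z \<le> 2 * n" using 1 by (simp add: mult.commute)
  have z0: "z \<noteq> 0" using zK K0 by auto
  have "R $$ (i,j) - (if i = j then 1 else 0) / z = (\<Sum>k<n. X $$ (i,k) * R $$ (k,j)) / z"
    using eq[OF ij] z0 by (simp add: field_simps)
  then have "cmod (R $$ (i,j) - (if i = j then 1 else 0) / z) * cmod z = cmod (\<Sum>k<n. X $$ (i,k) * R $$ (k,j))"
    using z0 by (simp add: norm_divide)
  also have "\<dots> \<le> (\<Sum>k<n. cmod (X $$ (i,k)) * cmod (R $$ (k,j)))"
    by (rule order_trans[OF norm_sum]) (simp add: norm_mult)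
  also have "\<dots> \<le> (\<Sum>k<n. cmod (X $$ (i,k)) * s)"
  proof (intro sum_mono mult_left_mono)
    fix k assume "k \<in> {..<n}"
    then show "cmod (R $$ (k,j)) \<le> s"
      using member_le_sum[of j "{..<n}" "\<lambda>j. cmod (R $$ (k,j))"] ij col[of k] by auto
  qed auto
  also have "\<dots> \<le> K * s"
    unfolding sum_distrib_right[symmetric] K using s0 ij
    by (intro mult_right_mono member_le_sum[of i "{..<n}" "\<lambda>i. \<Sum>k<n. cmod (X $$ (i,k))"]) (auto intro: sum_nonneg)
  finally have "cmod (R $$ (i,j) - (if i = j then 1 else 0) / z) * cmod z \<le> K * s" .
  from mult_right_mono[OF this norm_ge_zero[of z]]
  have "cmod (R $$ (i,j) - (if i = j then 1 else 0) / z) * cmod z * cmod z \<le> K * (s * cmod z)"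
    by (simp only: mult.assoc)
  also have "\<dots> \<le> K * (2 * n)" using zs K0 by (intro mult_left_mono) auto
  finally show ?thesis using z0 unfolding R_def
    by (simp add: field_simps power2_eq_square)
qed

context disc_contour begin

text \<open>Without a factor F the integrand is holomorphic in the whole plane off the eigenvalues,
  so the circle may be enlarged across the slit to a circle of radius \<rho> about 0. There the
  resolvent is 1/z up to O(\<rho>^-2), and the error in the integral is O(1/\<rho>).\<close>

lemma cfc_one:
  assumes X: "X \<in> carrier_mat n n"
    and ev: "\<And>w. eigenvalue X w \<Longrightarrow> w \<in> ball (complex_of_real c) r"
  shows "cfc \<gamma> (\<lambda>z. 1) X = 1\<^sub>m n"
proof (rule eq_matI)
  fix i j assume "i < dim_row (1\<^sub>m n :: complex mat)" "j < dim_col (1\<^sub>m n :: complex mat)"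
  then have ij: "i < n" "j < n" by auto
  define R where "R z = minv n (z \<cdot>\<^sub>m 1\<^sub>m n - X) $$ (i,j)" for z
  define K where "K = (\<Sum>i<n. \<Sum>j<n. cmod (X $$ (i,j)))"
  define \<delta> where "\<delta> = (if i = j then 1 else 0 :: complex)"
  define I where "I = contour_integral \<gamma> R"
  have K0: "K \<ge> 0" unfolding K_def by (intro sum_nonneg) auto
  have holR: "R holomorphic_on UNIV - {z. eigenvalue X z}"
    unfolding R_def by (rule holomorphic_on_subset[OF holomorphic_on_resolvent[OF X ij]]) auto
  \<comment> \<open>The part 2K + 1 is demanded by the resolvent estimate, and c + r keeps all
    eigenvalues inside the large circle.\<close>
  define \<rho>0 where "\<rho>0 = 2 * K + 1 + c + r"
  have bound: "cmod (I - 2 * pi * \<i> * \<delta>) \<le> 4 * pi * n * K / \<rho>" if \<rho>: "\<rho> \<ge> \<rho>0" for \<rho>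
  proof -
    have \<rho>pos: "\<rho> > 0" using \<rho> K0 rc by (simp add: \<rho>0_def)
    have evr: "cmod w < \<rho>" if "eigenvalue X w" for w
    proof -
      have "cmod w \<le> cmod (complex_of_real c) + cmod (complex_of_real c - w)"
        using norm_triangle_ineq4[of "complex_of_real c" "complex_of_real c - w"] by simp
      also have "\<dots> < c + r" using ev[OF that] rc by (simp add: dist_norm)
      finally show ?thesis using \<rho> K0 by (simp add: \<rho>0_def)
    qed
    have eqI: "contour_integral \<gamma> R = contour_integral (circlepath 0 \<rho>) R"
    proof (rule contour_integral_eq_by_winding[OF open_UNIV connected_UNIV finite_eigenvalues[OF X] holR])
      show "path_image \<gamma> \<subseteq> UNIV - {z. eigenvalue X z}" using ev by fastforce
      show "path_image (circlepath 0 \<rho>) \<subseteq> UNIV - {z. eigenvalue X z}" using evr \<rho>pos by fastforce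
      show "winding_number \<gamma> p = winding_number (circlepath 0 \<rho>) p" if "p \<in> {z. eigenvalue X z}" for p
        using that ev evr by (simp add: winding_gamma winding_number_circlepath)
    qed auto
    have "R contour_integrable_on circlepath 0 \<rho>"
    proof (rule contour_integrable_continuous_circlepath)
      show "continuous_on (path_image (circlepath 0 \<rho>)) R"
        by (rule holomorphic_on_imp_continuous_on, rule holomorphic_on_subset[OF holR]) (use evr \<rho>pos in fastforce)
    qed
    then have 1: "(R has_contour_integral I) (circlepath 0 \<rho>)"
      unfolding I_def eqI by (rule has_contour_integral_integral)
    have "((\<lambda>z. \<delta> / (z - 0)) has_contour_integral (2 * of_real pi * \<i> * \<delta>)) (circlepath 0 \<rho>)"
      by (rule Cauchy_integral_circlepath_simple) (use \<rho>pos in auto)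
    from has_contour_integral_diff[OF 1 this]
    have "((\<lambda>z. R z - \<delta> / z) has_contour_integral (I - 2 * of_real pi * \<i> * \<delta>)) (circlepath 0 \<rho>)" by simp
    then have "cmod (I - 2 * of_real pi * \<i> * \<delta>) \<le> (2 * n * K / \<rho>\<^sup>2) * (2 * pi * \<rho>)"
    proof (rule has_contour_integral_bound_circlepath)
      fix z assume z: "cmod (z - 0) = \<rho>"
      then have "\<not> eigenvalue X z" using evr by fastforce
      then show "cmod (R z - \<delta> / z) \<le> 2 * n * K / \<rho>\<^sup>2"
        using resolvent_entry_bound[OF X ij _ K_def, of z] z \<rho> K0 rc unfolding R_def \<delta>_def \<rho>0_def by simp
    qed (use \<rho>pos K0 in auto)
    also have "\<dots> = 4 * pi * n * K / \<rho>" using \<rho>pos by (simp add: field_simps power2_eq_square)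
    finally show ?thesis by simp
  qed
  have "I = 2 * pi * \<i> * \<delta>"
  proof (rule ccontr)
    assume "I \<noteq> 2 * pi * \<i> * \<delta>"
    then have e: "cmod (I - 2 * pi * \<i> * \<delta>) > 0" (is "?e > 0") by simp
    define \<rho> where "\<rho> = \<rho>0 + 4 * pi * n * K / ?e + 1"
    have "\<rho>0 > 0" using K0 rc by (simp add: \<rho>0_def)
    moreover have "4 * pi * n * K / ?e \<ge> 0" using K0 e by simp
    ultimately have "\<rho> \<ge> \<rho>0" "\<rho> > 0" "\<rho> > 4 * pi * n * K / ?e" by (auto simp: \<rho>_def)
    with bound[of \<rho>] e show False by (simp add: field_simps)
  qed
  moreover have "cfc \<gamma> (\<lambda>z. 1) X $$ (i,j) = I / (2 * pi * \<i>)"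
    by (simp add: cfc_index[OF X ij] I_def R_def[abs_def])
  ultimately show "cfc \<gamma> (\<lambda>z. 1) X $$ (i,j) = 1\<^sub>m n $$ (i,j)"
    using ij by (simp add: \<delta>_def)
qed (use X in auto)

lemma cfc_sum:
  assumes X: "X \<in> carrier_mat n n" and ij: "i < n" "j < n"
    and ev: "\<And>w. eigenvalue X w \<Longrightarrow> w \<in> ball (complex_of_real c) r"
    and g: "\<And>l. l \<in> A \<Longrightarrow> continuous_on (sphere (complex_of_real c) r) (g l)" and fin: "finite A"
  shows "cfc \<gamma> (\<lambda>z. \<Sum>l\<in>A. a l * g l z) X $$ (i,j) = (\<Sum>l\<in>A. a l * cfc \<gamma> (g l) X $$ (i,j))"
proof -
  have "((\<lambda>z. \<Sum>l\<in>A. a l * (g l z * minv n (z \<cdot>\<^sub>m 1\<^sub>m n - X) $$ (i,j))) has_contour_integral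
     (\<Sum>l\<in>A. a l * contour_integral \<gamma> (\<lambda>z. g l z * minv n (z \<cdot>\<^sub>m 1\<^sub>m n - X) $$ (i,j)))) \<gamma>"
    by (intro has_contour_integral_sum has_contour_integral_lmul has_contour_integral_integral integrable_gamma
       continuous_intros g resolvent_continuous[OF X ij ev] fin)
  from contour_integral_unique[OF this] show ?thesis
    by (simp add: cfc_index[OF X ij] sum_distrib_right sum_divide_distrib mult.assoc)
qed

text \<open>The resolvent is bounded on the compact circle, so uniform convergence survives
  multiplication by it and can be integrated.\<close>

lemma cfc_tendsto:
  assumes X: "X \<in> carrier_mat n n" and ij: "i < n" "j < n"
    and ev: "\<And>w. eigenvalue X w \<Longrightarrow> w \<in> ball (complex_of_real c) r"
    and g: "\<And>k. continuous_on (sphere (complex_of_real c) r) (g k)"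
    and lim: "uniform_limit (sphere (complex_of_real c) r) g G sequentially"
  shows "(\<lambda>k. cfc \<gamma> (g k) X $$ (i,j)) \<longlonglongrightarrow> cfc \<gamma> G X $$ (i,j)"
proof -
  note cR = resolvent_continuous[OF X ij ev]
  have cG: "continuous_on (sphere (complex_of_real c) r) G"
    by (rule uniform_limit_theorem[OF _ lim]) (use g in auto)
  have "uniform_limit (sphere (complex_of_real c) r) (\<lambda>k z. g k z * minv n (z \<cdot>\<^sub>m 1\<^sub>m n - X) $$ (i,j))
     (\<lambda>z. G z * minv n (z \<cdot>\<^sub>m 1\<^sub>m n - X) $$ (i,j)) sequentially"
    by (intro uniform_lim_mult lim uniform_limit_const compact_imp_bounded compact_continuous_image cG cR) auto
  then have "(\<lambda>k. contour_integral \<gamma> (\<lambda>z. g k z * minv n (z \<cdot>\<^sub>m 1\<^sub>m n - X) $$ (i,j)))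
     \<longlonglongrightarrow> contour_integral \<gamma> (\<lambda>z. G z * minv n (z \<cdot>\<^sub>m 1\<^sub>m n - X) $$ (i,j))"
    unfolding \<gamma>_def
    by (intro contour_integral_uniform_limit_circlepath(2))
      (use rc in \<open>auto intro!: always_eventually integrable_gamma[unfolded \<gamma>_def] continuous_intros g cR\<close>)
  then show ?thesis unfolding cfc_index[OF X ij] by (intro tendsto_intros) auto
qed

end

text \<open>The weighted harmonic mean of 1 and z, with weight t on z. In Loewner's theorem the
  normalised operator monotone functions are the averages of these over t in [0, 1].\<close>

definition hfun :: "real \<Rightarrow> complex \<Rightarrow> complex" where
  "hfun t z = z / ((1 - complex_of_real t) * z + complex_of_real t)"

text \<open>The denominator is a point of the segment from z to 1, and the slit plane is starlike
  about 1.\<close>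

lemma hfun_denom_slit:
  assumes "z \<in> slit_plane" "0 \<le> t" "t \<le> 1"
  shows "(1 - complex_of_real t) * z + complex_of_real t \<in> slit_plane"
proof (cases "t = 1")
  case False
  have "Re z > 0 \<or> Im z \<noteq> 0" using assms by (simp add: mem_slit_plane_iff)
  then show ?thesis
  proof
    assume "Re z > 0"
    then have "(1 - t) * Re z > 0" using False assms by simp
    then have "(1 - t) * Re z + t > 0" using assms(2) by linarith
    then show ?thesis by (simp add: mem_slit_plane_iff)
  qed (use False in \<open>simp add: mem_slit_plane_iff\<close>)
qed (simp add: mem_slit_plane_iff)

lemma hfun_denom_nonzero:
  assumes "z \<in> slit_plane" "0 \<le> t" "t \<le> 1"
  shows "(1 - complex_of_real t) * z + complex_of_real t \<noteq> 0"
proof -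
  have "0 \<notin> slit_plane" by (simp add: mem_slit_plane_iff)
  then show ?thesis using hfun_denom_slit[OF assms] by metis
qed

lemma holomorphic_hfun: "\<lbrakk>0 \<le> t; t \<le> 1\<rbrakk> \<Longrightarrow> hfun t holomorphic_on slit_plane"
  unfolding hfun_def[abs_def] by (intro holomorphic_intros) (auto simp: hfun_denom_nonzero)

text \<open>Write q(z) = (1 - t) z + t. Then h_t(z) (z - X)^{-1} = (z - X)^{-1} X R + (t / q(z)) R.
  The first term integrates to X R by \<open>cfc_one\<close>, and the second to 0 because 1/q is
  holomorphic on the disc.\<close>

lemma (in disc_contour) cfc_hfun:
  assumes X: "X \<in> carrier_mat n n"
    and ev: "\<And>w. eigenvalue X w \<Longrightarrow> w \<in> ball (complex_of_real c) r"
    and t: "0 \<le> t" "t \<le> 1"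
    and R: "R \<in> carrier_mat n n"
    and QR: "((1 - complex_of_real t) \<cdot>\<^sub>m X + complex_of_real t \<cdot>\<^sub>m 1\<^sub>m n) * R = 1\<^sub>m n"
  shows "cfc \<gamma> (hfun t) X = X * R"
proof -
  let ?t = "complex_of_real t" and ?C = "complex_of_real c"
  define Rz where "Rz z = minv n (z \<cdot>\<^sub>m 1\<^sub>m n - X)" for z
  have XR: "X * R \<in> carrier_mat n n" using X R by simp
  have key: "hfun t z * Rz z $$ (i,j) = (Rz z * (X * R)) $$ (i,j) + ?t * R $$ (i,j) * (1 / ((1 - ?t) * z + ?t))"
    if z: "z \<in> sphere ?C r" and ij: "i < n" "j < n" for z i j
  proof -
    have nev: "\<not> eigenvalue X z" using ev z by fastforce
    note rz = resolvent_inverse[OF X nev, folded Rz_def]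
    \<comment> \<open>The entries a and b of (z - X)^{-1} R and (z - X)^{-1} X R satisfy two linear
      relations, one from the resolvent and one from the inverse \<open>R\<close>. Eliminating a
      yields the identity.\<close>
    define a where "a = (Rz z * R) $$ (i,j)"
    define b where "b = (Rz z * (X * R)) $$ (i,j)"
    have 1: "z * a = b + R $$ (i,j)"
    proof -
      have "R = (Rz z * (z \<cdot>\<^sub>m 1\<^sub>m n - X)) * R" using rz R by simp
      also have "\<dots> = Rz z * ((z \<cdot>\<^sub>m 1\<^sub>m n - X) * R)"
        by (rule assoc_mult_mat) (use rz R resolvent_carrier[OF X] in auto)
      also have "(z \<cdot>\<^sub>m 1\<^sub>m n - X) * R = z \<cdot>\<^sub>m R - X * R"
        using X R by (subst minus_mult_distrib_mat[of _ n n _ _ n]) (auto simp: mult_smult_assoc_mat[of _ n n _ n])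
      also have "Rz z * (z \<cdot>\<^sub>m R - X * R) = z \<cdot>\<^sub>m (Rz z * R) - Rz z * (X * R)"
        using rz XR R by (subst mult_minus_distrib_mat[of _ n n _ n]) (auto simp: mult_smult_distrib[of _ n n _ n])
      finally have "R $$ (i,j) = (z \<cdot>\<^sub>m (Rz z * R) - Rz z * (X * R)) $$ (i,j)" by simp
      also have "\<dots> = z * a - b" unfolding a_def b_def using ij rz R XR by (simp del: index_mult_mat(1))
      finally show ?thesis by simp
    qed
    have 2: "Rz z $$ (i,j) = (1 - ?t) * b + ?t * a"
    proof -
      have e: "((1 - ?t) \<cdot>\<^sub>m X + ?t \<cdot>\<^sub>m 1\<^sub>m n) * R = (1 - ?t) \<cdot>\<^sub>m (X * R) + ?t \<cdot>\<^sub>m R"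
        using X R by (subst add_mult_distrib_mat[of _ n n _ _ n]) (auto simp: mult_smult_assoc_mat[of _ n n _ n])
      have "Rz z = Rz z * ((1 - ?t) \<cdot>\<^sub>m (X * R) + ?t \<cdot>\<^sub>m R)"
        unfolding e[symmetric] QR using rz by simp
      also have "\<dots> = (1 - ?t) \<cdot>\<^sub>m (Rz z * (X * R)) + ?t \<cdot>\<^sub>m (Rz z * R)"
        using rz XR R by (subst mult_add_distrib_mat[of _ n n _ n]) (auto simp: mult_smult_distrib[of _ n n _ n])
      finally have "Rz z $$ (i,j) = ((1 - ?t) \<cdot>\<^sub>m (Rz z * (X * R)) + ?t \<cdot>\<^sub>m (Rz z * R)) $$ (i,j)" by simp
      also have "\<dots> = (1 - ?t) * b + ?t * a" unfolding a_def b_def using ij rz R XR by (simp del: index_mult_mat(1))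
      finally show ?thesis .
    qed
    have q: "(1 - ?t) * z + ?t \<noteq> 0" using hfun_denom_nonzero[OF _ t] sphere_slit z by blast
    have "z * Rz z $$ (i,j) = (1 - ?t) * z * b + ?t * (z * a)" unfolding 2 by (simp add: algebra_simps)
    also have "\<dots> = ((1 - ?t) * z + ?t) * b + ?t * R $$ (i,j)" unfolding 1 by (simp add: algebra_simps)
    finally have 3: "z * Rz z $$ (i,j) = ((1 - ?t) * z + ?t) * b + ?t * R $$ (i,j)" .
    have "hfun t z * Rz z $$ (i,j) = (z * Rz z $$ (i,j)) / ((1 - ?t) * z + ?t)" by (simp add: hfun_def)
    also have "\<dots> = b + ?t * R $$ (i,j) * (1 / ((1 - ?t) * z + ?t))"
      unfolding 3 using q by (simp add: add_divide_distrib)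
    finally show ?thesis unfolding b_def .
  qed
  show ?thesis
  proof (rule eq_matI)
    fix i j assume "i < dim_row (X * R)" "j < dim_col (X * R)"
    then have ij: "i < n" "j < n" using X R by auto
    have cR: "(\<lambda>z. Rz z $$ (i,k)) contour_integrable_on \<gamma>" if "k < n" for k
      unfolding Rz_def by (intro integrable_gamma resolvent_continuous[OF X ij(1) that ev])
    have h0: "((\<lambda>z. 1 / ((1 - ?t) * z + ?t)) has_contour_integral 0) \<gamma>"
    proof (rule Cauchy_theorem_convex_simple[of _ "cball ?C r"])
      show "(\<lambda>z. 1 / ((1 - ?t) * z + ?t)) holomorphic_on cball ?C r"
        by (intro holomorphic_intros) (use hfun_denom_nonzero[OF _ t] cball_slit in blast)
    qed (use sphere_cball in auto)
    have "((\<lambda>z. (\<Sum>k<n. (X * R) $$ (k,j) * Rz z $$ (i,k)) + ?t * R $$ (i,j) * (1 / ((1 - ?t) * z + ?t)))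
      has_contour_integral ((\<Sum>k<n. (X * R) $$ (k,j) * contour_integral \<gamma> (\<lambda>z. Rz z $$ (i,k))) + ?t * R $$ (i,j) * 0)) \<gamma>"
      by (intro has_contour_integral_add has_contour_integral_sum has_contour_integral_lmul h0
         has_contour_integral_integral cR) auto
    moreover have "(\<Sum>k<n. (X * R) $$ (k,j) * Rz z $$ (i,k)) + ?t * R $$ (i,j) * (1 / ((1 - ?t) * z + ?t))
       = hfun t z * Rz z $$ (i,j)" if "z \<in> path_image \<gamma>" for z
    proof -
      have "\<not> eigenvalue X z" using ev that by fastforce
      from resolvent_inverse(1)[OF X this, folded Rz_def] show ?thesis
        unfolding key[OF that[unfolded path_image_gamma] ij]
        using XR ij by (subst mat_mult_index[of "Rz z" n n _ n]) (auto simp: mult.commute simp del: index_mult_mat(1))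
    qed
    ultimately have "((\<lambda>z. hfun t z * Rz z $$ (i,j)) has_contour_integral
       ((\<Sum>k<n. (X * R) $$ (k,j) * contour_integral \<gamma> (\<lambda>z. Rz z $$ (i,k))) + ?t * R $$ (i,j) * 0)) \<gamma>"
      by (rule has_contour_integral_eq)
    then have "cfc \<gamma> (hfun t) X $$ (i,j) = (\<Sum>k<n. (X * R) $$ (k,j) * contour_integral \<gamma> (\<lambda>z. Rz z $$ (i,k))) / (2 * complex_of_real pi * \<i>)"
      using contour_integral_unique by (fastforce simp: cfc_index[OF X ij] Rz_def)
    also have "\<dots> = (\<Sum>k<n. (X * R) $$ (k,j) * cfc \<gamma> (\<lambda>z. 1) X $$ (i,k))"
      using ij by (simp add: cfc_index[OF X] Rz_def sum_divide_distrib del: index_mult_mat(1))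
    also have "\<dots> = (\<Sum>k<n. if k = i then (X * R) $$ (k,j) else 0)"
    proof (rule sum.cong[OF refl])
      fix k assume "k \<in> {..<n}"
      moreover have "cfc \<gamma> (\<lambda>z. 1) X = 1\<^sub>m n" by (rule cfc_one[OF X ev])
      ultimately show "(X * R) $$ (k,j) * cfc \<gamma> (\<lambda>z. 1) X $$ (i,k) = (if k = i then (X * R) $$ (k,j) else 0)"
        using ij by (simp del: index_mult_mat(1))
    qed
    also have "\<dots> = (X * R) $$ (i,j)" using ij by (simp add: sum.delta del: index_mult_mat(1))
    finally show "cfc \<gamma> (hfun t) X $$ (i,j) = (X * R) $$ (i,j)" .
  qed (use X R in auto)
qed

subsection \<open>The Loewner kernel\<close>

lemma conj_mat_vec:
  fixes U :: "complex mat"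
  assumes U: "U \<in> carrier_mat n n" and D: "D \<in> carrier_mat n n" and x: "x \<in> carrier_vec n"
  shows "(U * D * mat_adjoint U) *\<^sub>v x = U *\<^sub>v (D *\<^sub>v (mat_adjoint U *\<^sub>v x))"
proof -
  have U': "mat_adjoint U \<in> carrier_mat n n" and UD: "U * D \<in> carrier_mat n n" using U D by auto
  show ?thesis
    using assoc_mult_mat_vec[OF UD U' x] assoc_mult_mat_vec[OF U D mult_mat_vec_carrier[OF U' x]] by simp
qed

lemma pos_semidef_matI:
  assumes "H \<in> carrier_mat n n" "mat_adjoint H = H" "\<And>x. x \<in> carrier_vec n \<Longrightarrow> Re (qform H x) \<ge> 0"
  shows "pos_semidef_mat H"
proof -
  have "dim_row H = n" using assms(1) by auto
  then show ?thesis using assms by (simp add: pos_semidef_mat_def hermitian_mat_def)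
qed

lemma pos_semidef_matD:
  assumes "H \<in> carrier_mat n n" "pos_semidef_mat H" "x \<in> carrier_vec n"
  shows "Re (qform H x) \<ge> 0"
  using assms by (auto simp: pos_semidef_mat_def)

lemma pos_def_of_eigenvalues:
  assumes X: "X \<in> carrier_mat n n" and hX: "mat_adjoint X = X"
    and ev: "\<And>w. eigenvalue X w \<Longrightarrow> Re w > 0"
  shows "pos_def_mat X"
proof -
  obtain U d where U: "unitary_mat n U" and Xd: "X = U * diag_of n (\<lambda>i. complex_of_real (d i)) * mat_adjoint U"
    using hermitian_spectral[OF X hX] by metis
  note u = unitary_matD[OF U]
  have dpos: "d i > 0" if "i < n" for i using ev[OF eigenvalue_unitary_diag[OF U Xd that]] by simp
  have "Re (qform X x) > 0" if x: "x \<in> carrier_vec n" "x \<noteq> 0\<^sub>v n" for x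
  proof -
    define y where "y = mat_adjoint U *\<^sub>v x"
    have y: "y \<in> carrier_vec n" unfolding y_def by (rule mult_mat_vec_carrier[OF u(2) x(1)])
    have xy: "x = U *\<^sub>v y" unfolding y_def using u x
      by (subst assoc_mult_mat_vec[symmetric, of _ n n _ n]) auto
    have "y \<noteq> 0\<^sub>v n" using x xy u by auto
    then obtain k where k: "k < n" "y $ k \<noteq> 0" using y by (metis eq_vecI carrier_vecD index_zero_vec)
    have "X *\<^sub>v x = U *\<^sub>v (diag_of n (\<lambda>i. complex_of_real (d i)) *\<^sub>v y)"
      unfolding Xd y_def by (rule conj_mat_vec[OF u(1) diag_of_carrier x(1)])
    then have "qform X x = cinner x (U *\<^sub>v (diag_of n (\<lambda>i. complex_of_real (d i)) *\<^sub>v y))" by (simp add: qform_cinner)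
    also have "\<dots> = cinner y (diag_of n (\<lambda>i. complex_of_real (d i)) *\<^sub>v y)"
      using cinner_adjoint[OF u(1) x(1), of "diag_of n (\<lambda>i. complex_of_real (d i)) *\<^sub>v y"] y
      by (simp add: y_def mult_mat_vec_carrier[of _ n n])
    also have "\<dots> = (\<Sum>i<n. cnj (y $ i) * (complex_of_real (d i) * y $ i))"
      using y by (auto simp: cinner_def diag_of_mult_vec simp del: index_mult_mat_vec)
    finally have "Re (qform X x) = (\<Sum>i<n. d i * (cmod (y $ i))\<^sup>2)"
      unfolding cmod_power2 by (simp add: power2_eq_square algebra_simps sum.distrib)
    moreover have "\<dots> \<ge> d k * (cmod (y $ k))\<^sup>2"
      using k dpos by (intro member_le_sum[of k "{..<n}" "\<lambda>i. d i * (cmod (y $ i))\<^sup>2"]) (auto simp: less_imp_le)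
    moreover have "d k * (cmod (y $ k))\<^sup>2 > 0" using k dpos[OF k(1)] by simp
    ultimately show ?thesis by linarith
  qed
  then show ?thesis using X hX by (auto simp: pos_def_mat_def hermitian_mat_def)
qed

lemma unitary_mat_one: "unitary_mat n (1\<^sub>m n)"
  by (simp add: unitary_mat_def)

lemma diag_of_unitary_form: "diag_of n d = 1\<^sub>m n * diag_of n d * mat_adjoint (1\<^sub>m n)"
  by (simp add: left_mult_one_mat[of _ n n] right_mult_one_mat[of _ n n])

lemma eigenvalue_diag_of:
  assumes "eigenvalue (diag_of n d) w"
  shows "\<exists>i<n. w = d i"
proof -
  obtain v where v: "v \<in> carrier_vec n" "v \<noteq> 0\<^sub>v n" "diag_of n d *\<^sub>v v = w \<cdot>\<^sub>v v"
    using assms by (auto simp: eigenvalue_def eigenvector_def)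
  then obtain k where k: "k < n" "v $ k \<noteq> 0" by (metis eq_vecI carrier_vecD index_zero_vec)
  have "(diag_of n d *\<^sub>v v) $ k = (w \<cdot>\<^sub>v v) $ k" using v by simp
  then have "d k * v $ k = w * v $ k" using diag_of_mult_vec[OF v(1) k(1)] k v(1) by simp
  then show ?thesis using k by auto
qed

lemma herm_fun_diag_of:
  assumes d: "\<And>i. i < n \<Longrightarrow> d i > 0"
    and F: "F holomorphic_on slit_plane"
    and fF: "\<And>x. x > 0 \<Longrightarrow> F (complex_of_real x) = complex_of_real (f x)"
  shows "herm_fun f (diag_of n (\<lambda>i. complex_of_real (d i))) = diag_of n (\<lambda>i. complex_of_real (f (d i)))"
proof -
  obtain c r where cr: "disc_contour c r" and S: "(\<lambda>i. complex_of_real (d i)) ` {..<n} \<subseteq> ball (complex_of_real c) r"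
  proof -
    have "finite ((\<lambda>i. complex_of_real (d i)) ` {..<n})" by simp
    moreover have "Re z > 0" if "z \<in> (\<lambda>i. complex_of_real (d i)) ` {..<n}" for z using that d by auto
    ultimately show ?thesis using ex_disc_contour that by blast
  qed
  interpret disc_contour c r "circlepath (complex_of_real c) r" by (rule cr) simp
  let ?X = "diag_of n (\<lambda>i. complex_of_real (d i))"
  have "herm_fun f ?X = cfc (circlepath (complex_of_real c) r) F ?X"
    by (rule herm_fun_eq_cfc[OF _ _ _ F fF]) (use S eigenvalue_diag_of in \<open>force simp: mat_adjoint_diag_of\<close>)+
  also have "\<dots> = 1\<^sub>m n * diag_of n (\<lambda>i. F (complex_of_real (d i))) * mat_adjoint (1\<^sub>m n)"
    by (rule cfc_unitary_diag[OF unitary_mat_one diag_of_unitary_form _ F]) (use S in auto)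
  also have "\<dots> = diag_of n (\<lambda>i. complex_of_real (f (d i)))"
    unfolding diag_of_unitary_form[symmetric] using d fF by (intro eq_matI) auto
  finally show ?thesis .
qed

text \<open>The resolvent of \<open>bordered\<close> is explicit; \<open>schur_den\<close> is the Schur complement of its leading block.\<close>

definition bordered :: "nat \<Rightarrow> (nat \<Rightarrow> real) \<Rightarrow> real \<Rightarrow> real \<Rightarrow> complex mat" where
  "bordered m x y s = Matrix.mat (Suc m) (Suc m) (\<lambda>(i,j).
     if i = j then (if i = m then complex_of_real y else complex_of_real (x i))
     else if i = m \<or> j = m then complex_of_real s else 0)"

definition schur_den :: "nat \<Rightarrow> (nat \<Rightarrow> real) \<Rightarrow> real \<Rightarrow> real \<Rightarrow> complex \<Rightarrow> complex" where
  "schur_den m x y s z = z - complex_of_real y - complex_of_real (s\<^sup>2) * (\<Sum>k<m. 1 / (z - complex_of_real (x k)))"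

lemma bordered_carrier[simp]: "bordered m x y s \<in> carrier_mat (Suc m) (Suc m)"
  by (simp add: bordered_def)

lemma bordered_adjoint: "mat_adjoint (bordered m x y s) = bordered m x y s"
  by (rule eq_matI) (auto simp: bordered_def)

text \<open>Inversion of a block matrix with diagonal leading block. That block of the inverse is
  the diagonal resolvent plus a rank-one term carrying s^2, and it is the coefficient of s^2 that
  becomes the kernel.\<close>

lemma bordered_resolvent:
  assumes zx: "\<And>i. i < m \<Longrightarrow> z \<noteq> complex_of_real (x i)" and q: "schur_den m x y s z \<noteq> 0"
  defines "q \<equiv> schur_den m x y s z"
  defines "R \<equiv> Matrix.mat (Suc m) (Suc m) (\<lambda>(i,j).
     if i = m then (if j = m then 1 / q else complex_of_real s / ((z - complex_of_real (x j)) * q))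
     else if j = m then complex_of_real s / ((z - complex_of_real (x i)) * q)
     else (if i = j then 1 / (z - complex_of_real (x i)) else 0) + complex_of_real (s\<^sup>2) / ((z - complex_of_real (x i)) * (z - complex_of_real (x j)) * q))"
  shows "(z \<cdot>\<^sub>m 1\<^sub>m (Suc m) - bordered m x y s) * R = 1\<^sub>m (Suc m)"
proof (rule eq_matI)
  let ?M = "z \<cdot>\<^sub>m 1\<^sub>m (Suc m) - bordered m x y s" and ?s = "complex_of_real s"
  define g where "g i = z - complex_of_real (x i)" for i
  have M: "?M \<in> carrier_mat (Suc m) (Suc m)" by (rule resolvent_carrier) simp
  have Rc: "R \<in> carrier_mat (Suc m) (Suc m)" by (simp add: R_def)
  fix i j assume "i < dim_row (1\<^sub>m (Suc m) :: complex mat)" "j < dim_col (1\<^sub>m (Suc m) :: complex mat)"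
  then have ij: "i \<le> m" "j \<le> m" by auto
  have g0: "g k \<noteq> 0" if "k < m" for k using zx[OF that] by (simp add: g_def)
  have q0: "q \<noteq> 0" using q by (simp add: q_def)
  have qe: "z - complex_of_real y = q + ?s\<^sup>2 * (\<Sum>k<m. 1 / g k)"
    by (simp add: q_def schur_den_def g_def)
  have Mij: "?M $$ (i,k) = (if i = k then (if i = m then z - complex_of_real y else g i)
     else if i = m \<or> k = m then - ?s else 0)" if "k \<le> m" for k
    using that ij by (auto simp: bordered_def g_def)
  have Rk: "R $$ (k,j) = (if k = m then (if j = m then 1 / q else ?s / (g j * q))
     else if j = m then ?s / (g k * q)
     else (if k = j then 1 / g k else 0) + ?s\<^sup>2 / (g k * g j * q))" if "k \<le> m" for k
    using that ij by (auto simp: R_def g_def)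
  have "(?M * R) $$ (i,j) = (\<Sum>k<Suc m. ?M $$ (i,k) * R $$ (k,j))"
    by (rule mat_mult_index[OF M Rc]) (use ij in auto)
  also have "\<dots> = (\<Sum>k<m. ?M $$ (i,k) * R $$ (k,j)) + ?M $$ (i,m) * R $$ (m,j)" by simp
  also have "\<dots> = (if i = j then 1 else 0)"
  proof (cases "i = m")
    case True
    have "(\<Sum>k<m. ?M $$ (i,k) * R $$ (k,j)) = (\<Sum>k<m. - ?s * R $$ (k,j))"
      by (intro sum.cong[OF refl], subst Mij) (use True in auto)
    moreover have "?M $$ (i,m) = z - complex_of_real y" by (subst Mij) (use True in auto)
    moreover have "(\<Sum>k<m. - ?s * R $$ (k,j)) + (z - complex_of_real y) * R $$ (m,j) = (if i = j then 1 else 0)"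
    proof (cases "j = m")
      case j: True
      have "(\<Sum>k<m. - ?s * R $$ (k,j)) = - (?s\<^sup>2 / q) * (\<Sum>k<m. 1 / g k)"
        unfolding sum_distrib_left by (intro sum.cong[OF refl], subst Rk) (use j in \<open>auto simp: power2_eq_square\<close>)
      then show ?thesis unfolding qe using j True q0 Rk[of m] by (simp add: add_divide_distrib)
    next
      case j: False
      then have jm: "j < m" using ij by simp
      have "(\<Sum>k<m. - ?s * R $$ (k,j)) = (\<Sum>k<m. (if k = j then - ?s / g j else 0) - (?s * ?s\<^sup>2 / (g j * q)) * (1 / g k))"
        by (intro sum.cong[OF refl], subst Rk) (use j in \<open>auto simp: algebra_simps\<close>)
      also have "\<dots> = - ?s / g j - (?s * ?s\<^sup>2 / (g j * q)) * (\<Sum>k<m. 1 / g k)"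
        using jm by (simp add: sum_subtractf sum.delta sum_distrib_left)
      finally show ?thesis unfolding qe using j True q0 g0[OF jm] by (simp add: Rk field_simps)
    qed
    ultimately show ?thesis by simp
  next
    case False
    then have im: "i < m" using ij by simp
    have "(\<Sum>k<m. ?M $$ (i,k) * R $$ (k,j)) = (\<Sum>k<m. if k = i then g i * R $$ (i,j) else 0)"
      by (intro sum.cong[OF refl], subst Mij) (use False in auto)
    also have "\<dots> = g i * R $$ (i,j)" using im by (simp add: sum.delta)
    finally have "(\<Sum>k<m. ?M $$ (i,k) * R $$ (k,j)) = g i * R $$ (i,j)" .
    moreover have "?M $$ (i,m) = - ?s" by (subst Mij) (use False in auto)
    moreover have "g i * R $$ (i,j) - ?s * R $$ (m,j) = (if i = j then 1 else 0)"
      unfolding Rk[OF ij(1)] Rk[OF order_refl] using False im ij g0[OF im] g0[of j] q0 by (cases "j = m") (auto simp: field_simps power2_eq_square)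
    ultimately show ?thesis by simp
  qed
  finally show "(?M * R) $$ (i,j) = 1\<^sub>m (Suc m) $$ (i,j)" using ij by simp
qed (auto simp: R_def bordered_def)

text \<open>Completing squares: the difference has the form sum_i |e u_i - s u_m|^2 / e, so each
  border entry is paid for by e at its diagonal place and s^2 / e in the corner. The upper bound is
  diagonal, hence its image under f is explicit.\<close>

lemma bordered_le_diag:
  assumes e: "e > 0"
  shows "pos_semidef_mat (diag_of (Suc m) (\<lambda>i. complex_of_real (if i = m then y + m * s\<^sup>2 / e else x i + e)) - bordered m x y s)"
proof -
  let ?K = "y + m * s\<^sup>2 / e"
  let ?D = "diag_of (Suc m) (\<lambda>i. complex_of_real (if i = m then ?K else x i + e)) - bordered m x y s"
  have D: "?D \<in> carrier_mat (Suc m) (Suc m)" by (rule minus_carrier_mat) simp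
  have hD: "mat_adjoint ?D = ?D" by (rule eq_matI) (auto simp: bordered_def)
  have "Re (qform ?D u) \<ge> 0" if u: "u \<in> carrier_vec (Suc m)" for u
  proof -
    let ?s = "complex_of_real s"
    have inner: "(\<Sum>j<Suc m. cnj (u $ i) * ?D $$ (i,j) * u $ j) =
        complex_of_real e * (cnj (u $ i) * u $ i) - ?s * (cnj (u $ i) * u $ m)" if "i < m" for i
    proof -
      have "(\<Sum>j<m. cnj (u $ i) * ?D $$ (i,j) * u $ j) = (\<Sum>j<m. if j = i then complex_of_real e * (cnj (u $ i) * u $ i) else 0)"
        using that by (intro sum.cong) (auto simp: bordered_def)
      then show ?thesis using that by (simp add: sum.delta bordered_def)
    qed
    have last: "(\<Sum>j<Suc m. cnj (u $ m) * ?D $$ (m,j) * u $ j) =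
        complex_of_real (m * s\<^sup>2 / e) * (cnj (u $ m) * u $ m) - (\<Sum>j<m. ?s * (cnj (u $ m) * u $ j))"
    proof -
      have "(\<Sum>j<m. cnj (u $ m) * ?D $$ (m,j) * u $ j) = - (\<Sum>j<m. ?s * (cnj (u $ m) * u $ j))"
        unfolding sum_negf[symmetric] by (intro sum.cong) (auto simp: bordered_def)
      then show ?thesis by (simp add: bordered_def)
    qed
    have "qform ?D u = (\<Sum>i<Suc m. \<Sum>j<Suc m. cnj (u $ i) * ?D $$ (i,j) * u $ j)"
      unfolding qform_cinner by (rule cinner_mat[OF D u u])
    also have "\<dots> = (\<Sum>i<m. complex_of_real e * (cnj (u $ i) * u $ i) - ?s * (cnj (u $ i) * u $ m))
      + (complex_of_real (m * s\<^sup>2 / e) * (cnj (u $ m) * u $ m) - (\<Sum>j<m. ?s * (cnj (u $ m) * u $ j)))"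
      using inner last by simp
    finally have *: "qform ?D u = (\<Sum>i<m. complex_of_real e * (cnj (u $ i) * u $ i) - ?s * (cnj (u $ i) * u $ m))
      + (complex_of_real (m * s\<^sup>2 / e) * (cnj (u $ m) * u $ m) - (\<Sum>j<m. ?s * (cnj (u $ m) * u $ j)))" .
    have re1: "Re (complex_of_real t * (cnj a * a)) = t * (cmod a)\<^sup>2" for t a
      unfolding cmod_power2 by (simp add: cmod_power2 power2_eq_square algebra_simps)
    have re2: "Re (?s * (cnj a * u $ m)) = s * Re (cnj a * u $ m)"
      "Re (?s * (cnj (u $ m) * a)) = s * Re (cnj a * u $ m)" for a
      by (simp_all add: algebra_simps)
    have "Re (qform ?D u) = (\<Sum>i<m. e * (cmod (u $ i))\<^sup>2 - s * Re (cnj (u $ i) * u $ m))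
      + ((m * s\<^sup>2 / e) * (cmod (u $ m))\<^sup>2 - (\<Sum>j<m. s * Re (cnj (u $ j) * u $ m)))"
      unfolding * by (simp only: plus_complex.sel minus_complex.sel Re_sum re1 re2)
    also have "\<dots> = (\<Sum>i<m. e * (cmod (u $ i))\<^sup>2 - 2 * (s * Re (cnj (u $ i) * u $ m)))
      + (m * s\<^sup>2 / e) * (cmod (u $ m))\<^sup>2"
      by (simp only: sum_subtractf sum_distrib_left[symmetric])
    also have "\<dots> = (\<Sum>i<m. e * (cmod (u $ i))\<^sup>2 - 2 * (s * Re (cnj (u $ i) * u $ m)) + s\<^sup>2 / e * (cmod (u $ m))\<^sup>2)"
      by (simp add: sum.distrib)
    also have "\<dots> = (\<Sum>i<m. (cmod (e * u $ i - s * u $ m))\<^sup>2 / e)"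
    proof (rule sum.cong[OF refl])
      fix i
      have "(cmod (e * u $ i - s * u $ m))\<^sup>2 = e\<^sup>2 * (cmod (u $ i))\<^sup>2 - 2 * e * (s * Re (cnj (u $ i) * u $ m)) + s\<^sup>2 * (cmod (u $ m))\<^sup>2"
        unfolding cmod_power2 by (simp add: power2_eq_square algebra_simps)
      then show "e * (cmod (u $ i))\<^sup>2 - 2 * (s * Re (cnj (u $ i) * u $ m)) + s\<^sup>2 / e * (cmod (u $ m))\<^sup>2
         = (cmod (e * u $ i - s * u $ m))\<^sup>2 / e"
        using e by (simp add: field_simps power2_eq_square)
    qed
    also have "\<dots> \<ge> 0" using e by (intro sum_nonneg) auto
    finally show ?thesis .
  qed
  then show ?thesis by (rule pos_semidef_matI[OF D hD])
qed

lemma (in disc_contour) outside_dist: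
  assumes S: "finite S" "S \<subseteq> ball (complex_of_real c) r"
  obtains \<eta> where "\<eta> > 0" "\<And>z w. z \<notin> ball (complex_of_real c) r \<Longrightarrow> w \<in> S \<Longrightarrow> \<eta> \<le> cmod (z - w)"
proof -
  define \<eta> where "\<eta> = Min (insert 1 ((\<lambda>w. r - dist (complex_of_real c) w) ` S))"
  have "\<eta> > 0" using S by (auto simp: \<eta>_def)
  moreover have "\<eta> \<le> cmod (z - w)" if "z \<notin> ball (complex_of_real c) r" "w \<in> S" for z w
  proof -
    have "\<eta> \<le> r - dist (complex_of_real c) w" using that S by (auto simp: \<eta>_def)
    also have "\<dots> \<le> dist z w" using that(1) dist_triangle[of "complex_of_real c" z w] by (simp add: dist_commute)
    finally show ?thesis by (simp add: dist_norm)
  qed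
  ultimately show ?thesis using that by blast
qed

lemma not_eigenvalue_of_inverse:
  assumes X: "(X :: complex mat) \<in> carrier_mat n n" and R: "R \<in> carrier_mat n n"
    and inv: "(z \<cdot>\<^sub>m 1\<^sub>m n - X) * R = 1\<^sub>m n"
  shows "\<not> eigenvalue X z"
proof
  assume "eigenvalue X z"
  then obtain v where v: "v \<in> carrier_vec n" "v \<noteq> 0\<^sub>v n" "X *\<^sub>v v = z \<cdot>\<^sub>v v"
    using X by (auto simp: eigenvalue_def eigenvector_def)
  let ?M = "z \<cdot>\<^sub>m 1\<^sub>m n - X"
  have M: "?M \<in> carrier_mat n n" by (rule resolvent_carrier[OF X])
  have "?M *\<^sub>v v = z \<cdot>\<^sub>v v - X *\<^sub>v v"
    using X v by (subst minus_mult_distrib_mat_vec[of _ n n]) auto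
  also have "\<dots> = 0\<^sub>v n" using v by (intro eq_vecI) auto
  finally have "R *\<^sub>v (?M *\<^sub>v v) = 0\<^sub>v n" using R by auto
  moreover have "R *\<^sub>v (?M *\<^sub>v v) = v"
    using assoc_mult_mat_vec[OF R M v(1)] mat_mult_left_right_inverse[OF M R inv] v(1) by simp
  ultimately show False using v by simp
qed

text \<open>f inherits continuity on the positive axis from F; this allows e to tend to 0 in the
  diagonal upper bound.\<close>

lemma tendsto_shift_real_holomorphic:
  assumes F: "F holomorphic_on slit_plane"
    and fF: "\<And>x. x > 0 \<Longrightarrow> F (complex_of_real x) = complex_of_real (f x)" and x: "(x::real) > 0"
  shows "(\<lambda>k. f (x + 1 / real (Suc k))) \<longlonglongrightarrow> f x"
proof -
  have "isCont F (complex_of_real x)"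
    using holomorphic_on_imp_continuous_on[OF F] x open_slit_plane
    by (subst (asm) continuous_on_eq_continuous_at) (auto simp: mem_slit_plane_iff)
  moreover have "(\<lambda>k. x + 1 / real (Suc k)) \<longlonglongrightarrow> x"
    using tendsto_add[OF tendsto_const[of x] LIMSEQ_inverse_real_of_nat] by (simp add: inverse_eq_divide)
  then have "(\<lambda>k. complex_of_real (x + 1 / real (Suc k))) \<longlonglongrightarrow> complex_of_real x"
    by (rule tendsto_of_real)
  ultimately have "(\<lambda>k. F (complex_of_real (x + 1 / real (Suc k)))) \<longlonglongrightarrow> F (complex_of_real x)"
    by (rule isCont_tendsto_compose)
  moreover have "F (complex_of_real (x + 1 / real (Suc k))) = complex_of_real (f (x + 1 / real (Suc k)))" for k
    using x by (intro fF) (simp add: add_pos_nonneg)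
  ultimately have "(\<lambda>k. complex_of_real (f (x + 1 / real (Suc k)))) \<longlonglongrightarrow> complex_of_real (f x)"
    using fF[OF x] by simp
  then show ?thesis by (simp only: tendsto_of_real_iff)
qed

lemma bordered_dims[simp]: "dim_row (bordered m x y s) = Suc m" "dim_col (bordered m x y s) = Suc m"
  by (simp_all add: bordered_def)

text \<open>Monotonicity against the diagonal upper bound, followed by e -> 0. The corner y + m s^2
  / e may blow up in this limit, but the test vector vanishes in the last coordinate and does not
  see it.\<close>

lemma (in disc_contour) bordered_form_le:
  assumes mm: "matrix_monotone_class f"
    and F: "F holomorphic_on slit_plane"
    and fF: "\<And>x. x > 0 \<Longrightarrow> F (complex_of_real x) = complex_of_real (f x)"
    and x: "\<And>i. i < m \<Longrightarrow> x i > 0" and y: "y > 0"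
    and ev: "\<And>w. eigenvalue (bordered m x y s) w \<Longrightarrow> w \<in> ball (complex_of_real c) r"
  shows "Re (\<Sum>i<m. \<Sum>j<m. complex_of_real (v i * v j) * cfc \<gamma> F (bordered m x y s) $$ (i,j))
    \<le> (\<Sum>i<m. f (x i) * (v i)\<^sup>2)"
proof -
  let ?X = "bordered m x y s"
  let ?C = "cfc \<gamma> F ?X"
  have evpos: "Re w > 0" if "eigenvalue ?X w" for w
  proof -
    have "\<bar>Re (complex_of_real c - w)\<bar> < r"
      using ev[OF that] abs_Re_le_cmod[of "complex_of_real c - w"] by (auto simp: dist_norm)
    then show ?thesis using rc by auto
  qed
  have pX: "pos_def_mat ?X" by (rule pos_def_of_eigenvalues[OF bordered_carrier bordered_adjoint evpos])
  have hX: "herm_fun f ?X = ?C" by (rule herm_fun_eq_cfc[OF bordered_carrier bordered_adjoint ev F fF])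
  define u where "u = Matrix.vec (Suc m) (\<lambda>i. if i < m then complex_of_real (v i) else 0)"
  have u: "u \<in> carrier_vec (Suc m)" by (simp add: u_def)
  have qu: "qform M u = (\<Sum>i<m. \<Sum>j<m. complex_of_real (v i * v j) * M $$ (i,j))"
    if M: "M \<in> carrier_mat (Suc m) (Suc m)" for M
    unfolding qform_cinner cinner_mat[OF M u u] by (simp add: u_def ac_simps)
  have "Re (qform ?C u) \<le> (\<Sum>i<m. f (x i + e) * (v i)\<^sup>2)" if e: "e > 0" for e
  proof -
    define d where "d i = (if i = m then y + m * s\<^sup>2 / e else x i + e)" for i
    have d: "d i > 0" if "i < Suc m" for i
      using that x[of i] y e by (auto simp: d_def less_Suc_eq intro!: add_pos_nonneg)
    let ?B = "diag_of (Suc m) (\<lambda>i. complex_of_real (d i))"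
    have pB: "pos_def_mat ?B"
      by (rule pos_def_of_eigenvalues[of _ "Suc m"]) (use d eigenvalue_diag_of in \<open>fastforce simp: mat_adjoint_diag_of\<close>)+
    have "pos_semidef_mat (?B - ?X)" using bordered_le_diag[OF e, of m y s x] unfolding d_def .
    then have "pos_semidef_mat (herm_fun f ?B - herm_fun f ?X)"
      using mm pX pB bordered_carrier diag_of_carrier unfolding matrix_monotone_class_def by blast
    then have "pos_semidef_mat (diag_of (Suc m) (\<lambda>i. complex_of_real (f (d i))) - ?C)"
      using herm_fun_diag_of[OF d F fF] hX by simp
    from pos_semidef_matD[OF _ this u] have "Re (qform (diag_of (Suc m) (\<lambda>i. complex_of_real (f (d i))) - ?C) u) \<ge> 0"
      by (simp add: minus_carrier_mat)
    moreover have "qform (diag_of (Suc m) (\<lambda>i. complex_of_real (f (d i))) - ?C) u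
      = qform (diag_of (Suc m) (\<lambda>i. complex_of_real (f (d i)))) u - qform ?C u"
      unfolding qu[OF minus_carrier_mat[OF cfc_carrier[OF bordered_carrier]]] qu[OF diag_of_carrier]
        qu[OF cfc_carrier[OF bordered_carrier]] sum_subtractf[symmetric]
      by (intro sum.cong refl) (auto simp: right_diff_distrib)
    moreover have "qform (diag_of (Suc m) (\<lambda>i. complex_of_real (f (d i)))) u
      = (\<Sum>i<m. \<Sum>j<m. if j = i then complex_of_real (f (x i + e) * (v i)\<^sup>2) else 0)"
      unfolding qu[OF diag_of_carrier]
      by (intro sum.cong refl) (auto simp: d_def power2_eq_square)
    ultimately show ?thesis by (simp add: sum.delta)
  qed
  then have "Re (qform ?C u) \<le> (\<Sum>i<m. f (x i + 1 / real (Suc k)) * (v i)\<^sup>2)" for k by simp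
  moreover have "(\<lambda>k. \<Sum>i<m. f (x i + 1 / real (Suc k)) * (v i)\<^sup>2) \<longlonglongrightarrow> (\<Sum>i<m. f (x i) * (v i)\<^sup>2)"
    by (intro tendsto_intros tendsto_shift_real_holomorphic[OF F fF] x) auto
  ultimately have "Re (qform ?C u) \<le> (\<Sum>i<m. f (x i) * (v i)\<^sup>2)"
    by (intro LIMSEQ_le_const) auto
  then show ?thesis by (simp add: qu)
qed

text \<open>For small s the Schur complement is a uniformly small perturbation of z - y. This
  confines the spectrum of the bordered matrix to the disc and permits the limit s -> 0 under the
  integral.\<close>

lemma schur_den_bound:
  assumes \<eta>: "\<eta> > 0" and zx: "\<And>i. i < m \<Longrightarrow> \<eta> \<le> cmod (z - complex_of_real (x i))"
    and zy: "\<eta> \<le> cmod (z - complex_of_real y)"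
  shows "cmod (schur_den m x y s z - (z - complex_of_real y)) \<le> s\<^sup>2 * m / \<eta>"
    and "s\<^sup>2 * m \<le> \<eta>\<^sup>2 / 2 \<Longrightarrow> \<eta> / 2 \<le> cmod (schur_den m x y s z)"
proof -
  have "cmod (\<Sum>k<m. 1 / (z - complex_of_real (x k))) \<le> (\<Sum>k<m. 1 / \<eta>)"
    using \<eta> zx by (intro sum_norm_le) (auto simp: norm_divide intro!: divide_left_mono mult_pos_pos dest: order.strict_trans2)
  then have "s\<^sup>2 * cmod (\<Sum>k<m. 1 / (z - complex_of_real (x k))) \<le> s\<^sup>2 * (\<Sum>k<m. 1 / \<eta>)"
    by (intro mult_left_mono) auto
  then show 1: "cmod (schur_den m x y s z - (z - complex_of_real y)) \<le> s\<^sup>2 * m / \<eta>"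
    by (simp add: schur_den_def norm_mult norm_power)
  assume "s\<^sup>2 * m \<le> \<eta>\<^sup>2 / 2"
  then have "s\<^sup>2 * m / \<eta> \<le> \<eta> / 2" using \<eta> by (simp add: field_simps power2_eq_square)
  moreover have "cmod (z - complex_of_real y) \<le> cmod (schur_den m x y s z) + cmod (schur_den m x y s z - (z - complex_of_real y))"
    using norm_triangle_sub[of "z - complex_of_real y" "schur_den m x y s z"] by (simp add: norm_minus_commute)
  ultimately show "\<eta> / 2 \<le> cmod (schur_den m x y s z)" using 1 zy by linarith
qed

text \<open>A second-order perturbation argument in s. The diagonal part of the resolvent integrates
  to f(x_i) and cancels exactly against the upper bound of \<open>bordered_form_le\<close>; what
  remains is s^2 times a quadratic form. After division by s^2 the limit replaces the Schur
  complement by z - y.\<close>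

lemma (in disc_contour) bordered_kernel:
  fixes x v :: "nat \<Rightarrow> real"
  assumes mm: "matrix_monotone_class f"
    and F: "F holomorphic_on slit_plane"
    and fF: "\<And>x. x > 0 \<Longrightarrow> F (complex_of_real x) = complex_of_real (f x)"
    and x: "\<And>i. i < m \<Longrightarrow> x i > 0" and y: "y > 0"
    and xb: "\<And>i. i < m \<Longrightarrow> complex_of_real (x i) \<in> ball (complex_of_real c) r"
    and yb: "complex_of_real y \<in> ball (complex_of_real c) r"
  shows "Re (\<Sum>i<m. \<Sum>j<m. complex_of_real (v i * v j) *
      contour_integral \<gamma> (\<lambda>z. F z / ((z - complex_of_real (x i)) * (z - complex_of_real (x j)) * (z - complex_of_real y)))
       / (2 * complex_of_real pi * \<i>)) \<le> 0"
proof -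
  let ?C = "complex_of_real c" and ?y = "complex_of_real y"
  define X where "X i = complex_of_real (x i)" for i
  have Xb: "X i \<in> ball ?C r" if "i < m" for i using xb[OF that] by (simp add: X_def)
  obtain \<eta> where \<eta>: "\<eta> > 0"
    and \<eta>S: "\<And>z w. z \<notin> ball ?C r \<Longrightarrow> w \<in> insert ?y (X ` {..<m}) \<Longrightarrow> \<eta> \<le> cmod (z - w)"
  proof -
    have "finite (insert ?y (X ` {..<m}))" "insert ?y (X ` {..<m}) \<subseteq> ball ?C r" using Xb yb by auto
    from outside_dist[OF this] show ?thesis using that by blast
  qed
  have \<eta>x: "\<eta> \<le> cmod (z - X i)" if "z \<notin> ball ?C r" "i < m" for z i using \<eta>S that by auto
  have \<eta>y: "\<eta> \<le> cmod (z - ?y)" if "z \<notin> ball ?C r" for z using \<eta>S that by auto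
  define q where "q s z = schur_den m x y s z" for s z
  define J where "J s i j = contour_integral \<gamma> (\<lambda>z. F z / ((z - X i) * (z - X j)) / q s z) / (2 * complex_of_real pi * \<i>)" for s i j
  define J0 where "J0 i j = contour_integral \<gamma> (\<lambda>z. F z / ((z - X i) * (z - X j)) / (z - ?y)) / (2 * complex_of_real pi * \<i>)" for i j
  have cF: "continuous_on (sphere ?C r) F"
    by (rule holomorphic_on_imp_continuous_on, rule holomorphic_on_subset[OF F sphere_slit])
  have nz: "z - X i \<noteq> 0" if "z \<in> sphere ?C r" "i < m" for z i
    using \<eta>x[of z i] that \<eta> by auto
  have cFX: "continuous_on (sphere ?C r) (\<lambda>z. F z / ((z - X i) * (z - X j)))" if "i < m" "j < m" for i j
    by (intro continuous_intros cF) (use nz that in auto)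
  have qb: "\<eta> / 2 \<le> cmod (q s z)" if "z \<notin> ball ?C r" "s\<^sup>2 * m \<le> \<eta>\<^sup>2 / 2" for s :: real and z
    unfolding q_def by (rule schur_den_bound(2)[OF \<eta> _ \<eta>y[OF that(1)] that(2)]) (use \<eta>x[OF that(1)] in \<open>simp add: X_def\<close>)
  have qnz: "q s z \<noteq> 0" if "z \<in> sphere ?C r" "s\<^sup>2 * m \<le> \<eta>\<^sup>2 / 2" for s :: real and z
    using qb[of z s] that \<eta> by auto
  have cq: "continuous_on (sphere ?C r) (q s)" for s
    unfolding q_def[abs_def] schur_den_def by (intro continuous_intros) (use nz in \<open>auto simp: X_def\<close>)
  have step: "Re (\<Sum>i<m. \<Sum>j<m. complex_of_real (v i * v j) * J s i j) \<le> 0" if s: "s > 0" "s\<^sup>2 * m \<le> \<eta>\<^sup>2 / 2" for s :: real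
  proof -
    let ?B = "bordered m x y s"
    define R where "R z = Matrix.mat (Suc m) (Suc m) (\<lambda>(i,j).
       if i = m then (if j = m then 1 / q s z else complex_of_real s / ((z - X j) * q s z))
       else if j = m then complex_of_real s / ((z - X i) * q s z)
       else (if i = j then 1 / (z - X i) else 0) + complex_of_real (s\<^sup>2) / ((z - X i) * (z - X j) * q s z))" for z
    have Rc: "R z \<in> carrier_mat (Suc m) (Suc m)" for z by (simp add: R_def)
    have inv: "(z \<cdot>\<^sub>m 1\<^sub>m (Suc m) - ?B) * R z = 1\<^sub>m (Suc m)" if z: "z \<notin> ball ?C r" for z
      unfolding R_def q_def X_def
    proof (rule bordered_resolvent)
      show "z \<noteq> complex_of_real (x i)" if "i < m" for i using xb[OF that] z by auto
      show "schur_den m x y s z \<noteq> 0" using qb[OF z s(2)] \<eta> unfolding q_def by auto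
    qed
    \<comment> \<open>The explicit inverse exists at every z outside the open disc, so no eigenvalue
      lies there.\<close>
    have ev: "w \<in> ball ?C r" if "eigenvalue ?B w" for w
      using that not_eigenvalue_of_inverse[OF bordered_carrier Rc inv] by blast
    have C: "cfc \<gamma> F ?B $$ (i,j) = (if i = j then complex_of_real (f (x i)) else 0) + complex_of_real (s\<^sup>2) * J s i j"
      if ij: "i < m" "j < m" for i j
    proof -
      have eq: "F z * minv (Suc m) (z \<cdot>\<^sub>m 1\<^sub>m (Suc m) - ?B) $$ (i,j)
        = (if i = j then 1 else 0) * (F z / (z - X i)) + complex_of_real (s\<^sup>2) * (F z / ((z - X i) * (z - X j)) / q s z)"
        if z: "z \<in> path_image \<gamma>" for z
      proof -
        have "minv (Suc m) (z \<cdot>\<^sub>m 1\<^sub>m (Suc m) - ?B) = R z"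
          by (rule minv_eqI[OF resolvent_carrier[OF bordered_carrier] Rc inv]) (use z in auto)
        then show ?thesis using ij by (auto simp: R_def algebra_simps)
      qed
      have int: "(\<lambda>z. F z / ((z - X i) * (z - X j)) / q s z) contour_integrable_on \<gamma>"
        by (intro integrable_gamma continuous_on_divide cFX ij cq) (use qnz[OF _ s(2)] in blast)
      have "((\<lambda>z. (if i = j then 1 else 0) * (F z / (z - X i)) + complex_of_real (s\<^sup>2) * (F z / ((z - X i) * (z - X j)) / q s z))
        has_contour_integral ((if i = j then 1 else 0) * (2 * complex_of_real pi * \<i> * F (X i))
          + complex_of_real (s\<^sup>2) * contour_integral \<gamma> (\<lambda>z. F z / ((z - X i) * (z - X j)) / q s z))) \<gamma>"
        by (intro has_contour_integral_add has_contour_integral_lmul has_contour_integral_integral int Cauchy_gamma F Xb ij)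
      then have e1: "contour_integral \<gamma> (\<lambda>z. F z * minv (Suc m) (z \<cdot>\<^sub>m 1\<^sub>m (Suc m) - ?B) $$ (i,j))
        = (if i = j then 1 else 0) * (2 * complex_of_real pi * \<i> * F (X i))
          + complex_of_real (s\<^sup>2) * contour_integral \<gamma> (\<lambda>z. F z / ((z - X i) * (z - X j)) / q s z)"
        by (intro contour_integral_unique) (rule has_contour_integral_eq, assumption, rule eq[symmetric])
      have "cfc \<gamma> F ?B $$ (i,j) = ((if i = j then 1 else 0) * (2 * complex_of_real pi * \<i> * F (X i))
          + complex_of_real (s\<^sup>2) * contour_integral \<gamma> (\<lambda>z. F z / ((z - X i) * (z - X j)) / q s z)) / (2 * complex_of_real pi * \<i>)"
        unfolding e1[symmetric] by (rule cfc_index[OF bordered_carrier]) (use ij in auto)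
      then show ?thesis using fF[OF x[OF ij(1)]] by (simp add: J_def add_divide_distrib X_def)
    qed
    have "(\<Sum>i<m. \<Sum>j<m. complex_of_real (v i * v j) * cfc \<gamma> F ?B $$ (i,j)) =
       (\<Sum>i<m. (\<Sum>j<m. if j = i then complex_of_real (f (x i) * (v i)\<^sup>2) else 0) + complex_of_real (s\<^sup>2) * (\<Sum>j<m. complex_of_real (v i * v j) * J s i j))"
      unfolding sum_distrib_left sum.distrib[symmetric]
      by (intro sum.cong refl) (auto simp: C algebra_simps power2_eq_square)
    also have "\<dots> = complex_of_real (\<Sum>i<m. f (x i) * (v i)\<^sup>2) + complex_of_real (s\<^sup>2) * (\<Sum>i<m. \<Sum>j<m. complex_of_real (v i * v j) * J s i j)"
      by (simp add: sum.distrib sum.delta sum_distrib_left)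
    finally have "Re (\<Sum>i<m. \<Sum>j<m. complex_of_real (v i * v j) * cfc \<gamma> F ?B $$ (i,j)) =
       (\<Sum>i<m. f (x i) * (v i)\<^sup>2) + s\<^sup>2 * Re (\<Sum>i<m. \<Sum>j<m. complex_of_real (v i * v j) * J s i j)"
      by (simp only: plus_complex.sel Re_complex_of_real times_complex.sel Im_complex_of_real)
    moreover have "Re (\<Sum>i<m. \<Sum>j<m. complex_of_real (v i * v j) * cfc \<gamma> F ?B $$ (i,j)) \<le> (\<Sum>i<m. f (x i) * (v i)\<^sup>2)"
      by (rule bordered_form_le[OF mm F fF x y ev])
    ultimately have "s\<^sup>2 * Re (\<Sum>i<m. \<Sum>j<m. complex_of_real (v i * v j) * J s i j) \<le> 0"
      by linarith
    then show ?thesis using s(1) by (simp add: mult_le_0_iff)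
  qed
  \<comment> \<open>Chosen so that s^2 m \<le> \<eta>^2 / 2 for every k, as the lower bound on the
    Schur complement demands, while s tends to 0. \<open>Suc m\<close> avoids a division by 0 when m
    = 0.\<close>
  define s where "s k = sqrt (\<eta>\<^sup>2 / (2 * real (Suc m) * real (Suc k)))" for k
  have s2: "(s k)\<^sup>2 = \<eta>\<^sup>2 / (2 * real (Suc m)) * (1 / real (Suc k))" for k
    unfolding s_def by (subst real_sqrt_pow2) (auto simp: field_simps)
  have spos: "s k > 0" for k unfolding s_def using \<eta> by simp
  have sm: "(s k)\<^sup>2 * m \<le> \<eta>\<^sup>2 / 2" for k
  proof -
    have "1 / real (Suc k) * (real m / real (Suc m)) \<le> 1 * 1" by (intro mult_mono) auto
    then have "\<eta>\<^sup>2 / 2 * (1 / real (Suc k) * (real m / real (Suc m))) \<le> \<eta>\<^sup>2 / 2 * 1"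
      by (intro mult_left_mono) auto
    then show ?thesis unfolding s2 by (simp add: field_simps)
  qed
  have slim: "(\<lambda>k. (s k)\<^sup>2 * m / \<eta>) \<longlonglongrightarrow> 0"
  proof -
    have "(\<lambda>k. \<eta>\<^sup>2 / (2 * real (Suc m)) * inverse (real (Suc k)) * m / \<eta>) \<longlonglongrightarrow> \<eta>\<^sup>2 / (2 * real (Suc m)) * 0 * m / \<eta>"
      by (intro tendsto_intros LIMSEQ_inverse_real_of_nat) (use \<eta> in auto)
    then show ?thesis by (simp only: s2 inverse_eq_divide mult_zero_right mult_zero_left div_0)
  qed
  have ulim: "uniform_limit (sphere ?C r) (\<lambda>k. q (s k)) (\<lambda>z. z - ?y) sequentially"
  proof (rule uniform_limitI)
    fix e :: real assume "e > 0"
    from order_tendstoD(2)[OF slim this]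
    show "\<forall>\<^sub>F k in sequentially. \<forall>z\<in>sphere ?C r. dist (q (s k) z) (z - ?y) < e"
    proof eventually_elim
      fix k assume k: "(s k)\<^sup>2 * m / \<eta> < e"
      show "\<forall>z\<in>sphere ?C r. dist (q (s k) z) (z - ?y) < e"
      proof
        fix z assume "z \<in> sphere ?C r"
        then have z: "z \<notin> ball ?C r" by auto
        have "cmod (q (s k) z - (z - ?y)) \<le> (s k)\<^sup>2 * m / \<eta>"
          unfolding q_def by (rule schur_den_bound(1)[OF \<eta> _ \<eta>y[OF z]]) (use \<eta>x[OF z] in \<open>simp add: X_def\<close>)
        then show "dist (q (s k) z) (z - ?y) < e" using k by (simp add: dist_norm)
      qed
    qed
  qed
  have Jlim: "(\<lambda>k. J (s k) i j) \<longlonglongrightarrow> J0 i j" if ij: "i < m" "j < m" for i j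
  proof -
    have "uniform_limit (sphere ?C r) (\<lambda>k z. F z / ((z - X i) * (z - X j)) / q (s k) z)
      (\<lambda>z. F z / ((z - X i) * (z - X j)) / (z - ?y)) sequentially"
      by (rule uniform_lim_divide[OF uniform_limit_const ulim _ _ \<eta>])
        (use \<eta>y in \<open>auto intro!: compact_imp_bounded compact_continuous_image cFX ij\<close>)
    then have "(\<lambda>k. contour_integral \<gamma> (\<lambda>z. F z / ((z - X i) * (z - X j)) / q (s k) z))
      \<longlonglongrightarrow> contour_integral \<gamma> (\<lambda>z. F z / ((z - X i) * (z - X j)) / (z - ?y))"
      unfolding \<gamma>_def
    proof (rule contour_integral_uniform_limit_circlepath(2)[rotated])
      show "\<forall>\<^sub>F k in sequentially. (\<lambda>z. F z / ((z - X i) * (z - X j)) / q (s k) z) contour_integrable_on circlepath ?C r"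
        by (intro always_eventually allI integrable_gamma[unfolded \<gamma>_def] continuous_on_divide[OF cFX[OF ij] cq])
          (use qnz[OF _ sm] in blast)
    qed (use rc in auto)
    then show ?thesis unfolding J_def J0_def by (intro tendsto_intros) auto
  qed
  have "(\<lambda>k. Re (\<Sum>i<m. \<Sum>j<m. complex_of_real (v i * v j) * J (s k) i j)) \<longlonglongrightarrow>
     Re (\<Sum>i<m. \<Sum>j<m. complex_of_real (v i * v j) * J0 i j)"
    by (intro tendsto_intros Jlim) auto
  then have "Re (\<Sum>i<m. \<Sum>j<m. complex_of_real (v i * v j) * J0 i j) \<le> 0"
    by (rule LIMSEQ_le_const2) (use step[OF spos sm] in auto)
  then show ?thesis by (simp add: J0_def X_def)
qed

text \<open>The divided difference (f(x) - f(y)) / (x - y), written as a contour integral so that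
  the diagonal needs no case distinction; there it is the derivative. The circle starts at min x y /
  2 on the real axis, hence it encloses both points and avoids the slit.\<close>

definition loewner :: "(complex \<Rightarrow> complex) \<Rightarrow> real \<Rightarrow> real \<Rightarrow> real" where
  "loewner F x y = Re (contour_integral (circlepath (complex_of_real (x + y)) (x + y - min x y / 2))
     (\<lambda>z. F z / ((z - complex_of_real x) * (z - complex_of_real y))) / (2 * complex_of_real pi * \<i>))"

lemma loewner_commute: "loewner F x y = loewner F y x"
  by (simp add: loewner_def add.commute min.commute mult.commute)

context disc_contour begin

lemma of_real_ball_iff: "complex_of_real x \<in> ball (complex_of_real c) r \<longleftrightarrow> \<bar>c - x\<bar> < r"
  unfolding mem_ball dist_norm of_real_diff[symmetric] norm_of_real ..

text \<open>The circle in \<open>loewner\<close> depends on the pair of points, whereas in a kernel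
  one circle has to serve all pairs; comparing winding numbers identifies the integrals.\<close>

lemma loewner_eq:
  assumes F: "F holomorphic_on slit_plane"
    and x: "complex_of_real x \<in> ball (complex_of_real c) r" and y: "complex_of_real y \<in> ball (complex_of_real c) r"
  shows "Re (contour_integral \<gamma> (\<lambda>z. F z / ((z - complex_of_real x) * (z - complex_of_real y)))
    / (2 * complex_of_real pi * \<i>)) = loewner F x y"
proof -
  have xy: "x > 0" "y > 0" using x y rc unfolding of_real_ball_iff by linarith+
  let ?c = "x + y" and ?r = "x + y - min x y / 2"
  interpret D: disc_contour ?c ?r "circlepath (complex_of_real ?c) ?r"
    by unfold_locales (use xy in \<open>auto simp: min_def\<close>)
  have b: "complex_of_real x \<in> ball (complex_of_real ?c) ?r" "complex_of_real y \<in> ball (complex_of_real ?c) ?r"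
    unfolding D.of_real_ball_iff using xy by (auto simp: min_def)
  have w: "winding_number \<delta> z = 0" if "valid_path \<delta>" "pathfinish \<delta> = pathstart \<delta>" "path_image \<delta> \<subseteq> slit_plane" "z \<notin> slit_plane" for \<delta> z
    using that simply_connected_imp_winding_number_zero[OF simply_connected_slit_plane]
    by (auto simp: valid_path_imp_path)
  have w1: "winding_number \<gamma> z = 0" if "z \<notin> slit_plane" for z using that w[of \<gamma> z] sphere_slit by simp
  have w2: "winding_number (circlepath (complex_of_real ?c) ?r) z = 0" if "z \<notin> slit_plane" for z
    by (rule w[OF D.gamma_path(1,2) _ that]) (use D.sphere_slit in \<open>simp only: D.path_image_gamma\<close>)
  have "contour_integral \<gamma> (\<lambda>z. F z / ((z - complex_of_real x) * (z - complex_of_real y)))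
     = contour_integral (circlepath (complex_of_real ?c) ?r) (\<lambda>z. F z / ((z - complex_of_real x) * (z - complex_of_real y)))"
  proof (rule contour_integral_eq_by_winding[OF open_slit_plane connected_slit_plane, of "{complex_of_real x, complex_of_real y}"])
    show "(\<lambda>z. F z / ((z - complex_of_real x) * (z - complex_of_real y))) holomorphic_on slit_plane - {complex_of_real x, complex_of_real y}"
      by (intro holomorphic_intros holomorphic_on_subset[OF F]) auto
    show "path_image \<gamma> \<subseteq> slit_plane - {complex_of_real x, complex_of_real y}"
      unfolding path_image_gamma using sphere_slit x y by auto
    show "path_image (circlepath (complex_of_real ?c) ?r) \<subseteq> slit_plane - {complex_of_real x, complex_of_real y}"
      unfolding D.path_image_gamma using D.sphere_slit b by auto
    show "winding_number \<gamma> p = winding_number (circlepath (complex_of_real ?c) ?r) p" if "p \<in> {complex_of_real x, complex_of_real y}" for p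
      using that winding_gamma[OF x] winding_gamma[OF y] D.winding_gamma[OF b(1)] D.winding_gamma[OF b(2)] by auto
  qed (use w1 w2 in auto)
  then show ?thesis by (simp add: loewner_def)
qed

text \<open>Partial fractions that split off only the pole y. The poles x and x' stay together, so
  they may coincide.\<close>

lemma contour_third_difference:
  assumes F: "F holomorphic_on slit_plane"
    and fF: "\<And>x. x > 0 \<Longrightarrow> F (complex_of_real x) = complex_of_real (f x)"
    and x: "complex_of_real x \<in> ball (complex_of_real c) r" and x': "complex_of_real x' \<in> ball (complex_of_real c) r"
    and y: "complex_of_real y \<in> ball (complex_of_real c) r" and ne: "x \<noteq> y" "x' \<noteq> y"
  shows "Re (contour_integral \<gamma> (\<lambda>z. F z / ((z - complex_of_real x) * (z - complex_of_real x') * (z - complex_of_real y)))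
       / (2 * complex_of_real pi * \<i>)) = loewner F x x' / (x - y) - f x' / ((x - y) * (x' - y)) + f y / ((x - y) * (x' - y))"
proof -
  let ?X = "complex_of_real x" and ?X' = "complex_of_real x'" and ?Y = "complex_of_real y"
  have pos: "x > 0" "x' > 0" "y > 0" using x x' y rc unfolding of_real_ball_iff by linarith+
  have nz: "z \<noteq> ?X" "z \<noteq> ?X'" "z \<noteq> ?Y" if "z \<in> sphere (complex_of_real c) r" for z using that x x' y by auto
  have NE: "?X - ?Y \<noteq> 0" "?X' - ?Y \<noteq> 0" using ne by (simp_all flip: of_real_diff)
  define L where "L = contour_integral \<gamma> (\<lambda>z. F z / ((z - ?X) * (z - ?X')))"
  have cF: "continuous_on (sphere (complex_of_real c) r) F"
    by (rule holomorphic_on_imp_continuous_on, rule holomorphic_on_subset[OF F sphere_slit])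
  have L: "((\<lambda>z. F z / ((z - ?X) * (z - ?X'))) has_contour_integral L) \<gamma>"
    unfolding L_def by (intro has_contour_integral_integral integrable_gamma continuous_intros cF) (use nz in auto)
  have "((\<lambda>z. 1 / (?X - ?Y) * (F z / ((z - ?X) * (z - ?X'))) - 1 / ((?X - ?Y) * (?X' - ?Y)) * (F z / (z - ?X'))
      + 1 / ((?X - ?Y) * (?X' - ?Y)) * (F z / (z - ?Y)))
    has_contour_integral (1 / (?X - ?Y) * L - 1 / ((?X - ?Y) * (?X' - ?Y)) * (2 * complex_of_real pi * \<i> * F ?X')
      + 1 / ((?X - ?Y) * (?X' - ?Y)) * (2 * complex_of_real pi * \<i> * F ?Y))) \<gamma>"
    by (intro has_contour_integral_add has_contour_integral_diff has_contour_integral_lmul L Cauchy_gamma F x' y)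
  moreover have "1 / (?X - ?Y) * (F z / ((z - ?X) * (z - ?X'))) - 1 / ((?X - ?Y) * (?X' - ?Y)) * (F z / (z - ?X'))
      + 1 / ((?X - ?Y) * (?X' - ?Y)) * (F z / (z - ?Y)) = F z / ((z - ?X) * (z - ?X') * (z - ?Y))"
    if "z \<in> path_image \<gamma>" for z
  proof -
    have gen: "1 / (a - b) * (w / ((z - a) * (z - a'))) - 1 / ((a - b) * (a' - b)) * (w / (z - a'))
      + 1 / ((a - b) * (a' - b)) * (w / (z - b)) = w / ((z - a) * (z - a') * (z - b))"
      if "z - a \<noteq> 0" "z - a' \<noteq> 0" "z - b \<noteq> 0" "a - b \<noteq> 0" "a' - b \<noteq> 0" for a a' b w :: complex
    proof -
      define p q s k k' where "p = 1 / (z - a)" "q = 1 / (z - a')" "s = 1 / (z - b)"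
        "k = 1 / (a - b)" "k' = 1 / (a' - b)"
      note defs = this
      have ps: "p * s = k * (p - s)" and qs: "q * s = k' * (q - s)"
        unfolding defs using that by (simp_all add: diff_frac_eq)
      have "w * (p * q * s) = w * q * (p * s)" by simp
      also have "\<dots> = k * (w * (p * q)) - k * w * (q * s)" unfolding ps by (simp add: algebra_simps)
      also have "\<dots> = k * (w * (p * q)) - k * k' * (w * q) + k * k' * (w * s)"
        unfolding qs by (simp add: algebra_simps)
      finally show ?thesis unfolding defs by simp
    qed
    show ?thesis by (rule gen) (use nz that NE in auto)
  qed
  ultimately have "((\<lambda>z. F z / ((z - ?X) * (z - ?X') * (z - ?Y))) has_contour_integral
      (1 / (?X - ?Y) * L - 1 / ((?X - ?Y) * (?X' - ?Y)) * (2 * complex_of_real pi * \<i> * F ?X')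
      + 1 / ((?X - ?Y) * (?X' - ?Y)) * (2 * complex_of_real pi * \<i> * F ?Y))) \<gamma>"
    by (rule has_contour_integral_eq)
  from contour_integral_unique[OF this]
  have "contour_integral \<gamma> (\<lambda>z. F z / ((z - ?X) * (z - ?X') * (z - ?Y))) / (2 * complex_of_real pi * \<i>)
    = complex_of_real (1 / (x - y)) * (L / (2 * complex_of_real pi * \<i>)) - complex_of_real (f x' / ((x - y) * (x' - y))) + complex_of_real (f y / ((x - y) * (x' - y)))"
    using fF[OF pos(2)] fF[OF pos(3)] by (simp add: add_divide_distrib diff_divide_distrib)
  moreover have "Re (L / (2 * complex_of_real pi * \<i>)) = loewner F x x'"
    unfolding L_def by (rule loewner_eq[OF F x x'])
  ultimately show ?thesis
    by (simp only: plus_complex.sel minus_complex.sel Re_complex_of_real times_complex.sel Im_complex_of_real) simp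
qed

end

lemma loewner_diff:
  assumes F: "F holomorphic_on slit_plane"
    and fF: "\<And>x. x > 0 \<Longrightarrow> F (complex_of_real x) = complex_of_real (f x)"
    and pos: "x > 0" "y > 0"
  shows "loewner F x y * (x - y) = f x - f y"
proof -
  let ?X = "complex_of_real x" and ?Y = "complex_of_real y"
  let ?c = "x + y" and ?r = "x + y - min x y / 2"
  interpret D: disc_contour ?c ?r "circlepath (complex_of_real ?c) ?r"
    by unfold_locales (use pos in \<open>auto simp: min_def\<close>)
  have b: "?X \<in> ball (complex_of_real ?c) ?r" "?Y \<in> ball (complex_of_real ?c) ?r"
    unfolding D.of_real_ball_iff using pos by (auto simp: min_def)
  let ?\<gamma> = "circlepath (complex_of_real ?c) ?r"
  have "((\<lambda>z. F z / (z - ?X) - F z / (z - ?Y)) has_contour_integral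
     (2 * complex_of_real pi * \<i> * F ?X - 2 * complex_of_real pi * \<i> * F ?Y)) ?\<gamma>"
    by (intro has_contour_integral_diff D.Cauchy_gamma F b)
  moreover have "F z / (z - ?X) - F z / (z - ?Y) = F z / ((z - ?X) * (z - ?Y)) * (?X - ?Y)" if "z \<in> path_image ?\<gamma>" for z
  proof -
    have "z - ?X \<noteq> 0" "z - ?Y \<noteq> 0" using that b by (auto simp only: D.path_image_gamma mem_ball mem_sphere right_minus_eq)
    then show ?thesis by (simp add: field_simps)
  qed
  ultimately have "((\<lambda>z. F z / ((z - ?X) * (z - ?Y)) * (?X - ?Y)) has_contour_integral
     (2 * complex_of_real pi * \<i> * F ?X - 2 * complex_of_real pi * \<i> * F ?Y)) ?\<gamma>"
    by (rule has_contour_integral_eq)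
  note this' = contour_integral_unique[OF this]
  have cF: "continuous_on (sphere (complex_of_real ?c) ?r) F"
    by (rule holomorphic_on_imp_continuous_on, rule holomorphic_on_subset[OF F D.sphere_slit])
  have "(\<lambda>z. F z / ((z - ?X) * (z - ?Y))) contour_integrable_on ?\<gamma>"
    by (intro D.integrable_gamma continuous_intros cF) (use b in auto)
  from has_contour_integral_rmul[OF has_contour_integral_integral[OF this], of "?X - ?Y"]
  have "contour_integral ?\<gamma> (\<lambda>z. F z / ((z - ?X) * (z - ?Y))) * (?X - ?Y) =
     2 * complex_of_real pi * \<i> * F ?X - 2 * complex_of_real pi * \<i> * F ?Y"
    unfolding this'[symmetric] by (rule contour_integral_unique[symmetric])
  then have "contour_integral ?\<gamma> (\<lambda>z. F z / ((z - ?X) * (z - ?Y))) / (2 * complex_of_real pi * \<i>) * complex_of_real (x - y) = complex_of_real (f x - f y)"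
    using fF pos by (simp add: field_simps)
  from arg_cong[OF this, of Re] show ?thesis
    unfolding loewner_def by (simp only: times_complex.sel Re_complex_of_real Im_complex_of_real)
qed

text \<open>In the negative semidefinite kernel, the term f(y) / ((x_i - y) (x_j - y)) contributes
  f(y) times a square. Positivity of f allows it to be moved to the other side.\<close>

lemma loewner_shifted_psd:
  fixes x v :: "nat \<Rightarrow> real"
  assumes mm: "matrix_monotone_class f"
    and F: "F holomorphic_on slit_plane"
    and fF: "\<And>x. x > 0 \<Longrightarrow> F (complex_of_real x) = complex_of_real (f x)"
    and x: "\<And>i. i < m \<Longrightarrow> x i > 0" and y: "y > 0" and ne: "\<And>i. i < m \<Longrightarrow> x i \<noteq> y"
  shows "(\<Sum>i<m. \<Sum>j<m. v i * v j * (f (x j) / ((x i - y) * (x j - y)) - loewner F (x i) (x j) / (x i - y))) \<ge> 0"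
proof -
  let ?S = "insert (complex_of_real y) ((\<lambda>i. complex_of_real (x i)) ` {..<m})"
  obtain c r where cr: "disc_contour c r" and S: "?S \<subseteq> ball (complex_of_real c) r"
  proof -
    have "finite ?S" by simp
    moreover have "Re z > 0" if "z \<in> ?S" for z using that x y by auto
    ultimately show ?thesis using ex_disc_contour that by blast
  qed
  interpret disc_contour c r "circlepath (complex_of_real c) r" by (rule cr) simp
  let ?\<gamma> = "circlepath (complex_of_real c) r"
  have xb: "complex_of_real (x i) \<in> ball (complex_of_real c) r" if "i < m" for i using S that by auto
  have yb: "complex_of_real y \<in> ball (complex_of_real c) r" using S by auto
  define I where "I i j = contour_integral ?\<gamma> (\<lambda>z. F z / ((z - complex_of_real (x i)) * (z - complex_of_real (x j)) * (z - complex_of_real y)))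
       / (2 * complex_of_real pi * \<i>)" for i j
  have I: "Re (I i j) = loewner F (x i) (x j) / (x i - y) - f (x j) / ((x i - y) * (x j - y)) + f y / ((x i - y) * (x j - y))"
    if "i < m" "j < m" for i j
    unfolding I_def by (rule contour_third_difference[OF F fF]) (use that xb yb ne in auto)
  have "Re (\<Sum>i<m. \<Sum>j<m. complex_of_real (v i * v j) * I i j) \<le> 0"
    using bordered_kernel[OF mm F fF x y xb yb, where v = v] unfolding I_def by (simp only: times_divide_eq_right)
  then have "(\<Sum>i<m. \<Sum>j<m. v i * v j * Re (I i j)) \<le> 0" by simp
  moreover have "(\<Sum>i<m. \<Sum>j<m. v i * v j * (f (x j) / ((x i - y) * (x j - y)) - loewner F (x i) (x j) / (x i - y)))
     = (\<Sum>i<m. \<Sum>j<m. f y * ((v i / (x i - y)) * (v j / (x j - y)))) - (\<Sum>i<m. \<Sum>j<m. v i * v j * Re (I i j))"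
    unfolding sum_subtractf[symmetric] by (intro sum.cong refl) (auto simp: I algebra_simps)
  moreover have "(\<Sum>i<m. \<Sum>j<m. f y * ((v i / (x i - y)) * (v j / (x j - y)))) = f y * (\<Sum>i<m. v i / (x i - y))\<^sup>2"
    unfolding power2_eq_square sum_product by (simp only: sum_distrib_left)
  moreover have "f y * (\<Sum>i<m. v i / (x i - y))\<^sup>2 \<ge> 0"
    using mm y by (auto simp: matrix_monotone_class_def less_imp_le)
  ultimately show ?thesis by linarith
qed

text \<open>Both kernels are limits of the shifted one: y times it as y -> oo, and the kernel itself
  as y -> 0. The second is the divided-difference kernel of -f(x)/x, the infinitesimal form of the
  fact that f(x)/x is operator decreasing.\<close>

lemma
  fixes x v :: "nat \<Rightarrow> real"
  assumes mm: "matrix_monotone_class f"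
    and F: "F holomorphic_on slit_plane"
    and fF: "\<And>x. x > 0 \<Longrightarrow> F (complex_of_real x) = complex_of_real (f x)"
    and x: "\<And>i. i < m \<Longrightarrow> x i > 0"
  shows loewner_psd: "(\<Sum>i<m. \<Sum>j<m. v i * v j * loewner F (x i) (x j)) \<ge> 0"
    and loewner_quotient_psd:
      "(\<Sum>i<m. \<Sum>j<m. v i * v j * ((f (x j) / x j - loewner F (x i) (x j)) / x i)) \<ge> 0"
proof -
  note psd = loewner_shifted_psd[OF mm F fF x, where v = v]
  have gen: "(\<lambda>k. y k * (\<Sum>i<m. \<Sum>j<m. v i * v j * (f (x j) / ((x i - y k) * (x j - y k)) - loewner F (x i) (x j) / (x i - y k))))
      \<longlonglongrightarrow> (\<Sum>i<m. \<Sum>j<m. v i * v j * loewner F (x i) (x j))"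
    if y: "filterlim y at_top sequentially" for y :: "nat \<Rightarrow> real"
  proof -
    have t: "(\<lambda>k. y k * (f b / ((a - y k) * (b - y k)) - L / (a - y k))) \<longlonglongrightarrow> L" for a b L :: real
      by (rule filterlim_compose[OF _ y]) real_asymp
    have "(\<lambda>k. \<Sum>i<m. \<Sum>j<m. v i * v j * (y k * (f (x j) / ((x i - y k) * (x j - y k)) - loewner F (x i) (x j) / (x i - y k))))
      \<longlonglongrightarrow> (\<Sum>i<m. \<Sum>j<m. v i * v j * loewner F (x i) (x j))"
      by (intro tendsto_intros t)
    then show ?thesis by (simp add: sum_distrib_left ac_simps)
  qed
  note lim = gen[OF filterlim_compose[OF filterlim_real_sequentially filterlim_Suc]]
  have "\<forall>\<^sub>F k in sequentially. \<forall>i\<in>{..<m}. real (Suc k) > x i"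
    by (intro eventually_ball_finite ballI eventually_compose_filterlim[OF eventually_gt_at_top
      filterlim_compose[OF filterlim_real_sequentially filterlim_Suc]]) auto
  then have "\<forall>\<^sub>F k in sequentially. 0 \<le> real (Suc k) * (\<Sum>i<m. \<Sum>j<m. v i * v j * (f (x j) / ((x i - real (Suc k)) * (x j - real (Suc k))) - loewner F (x i) (x j) / (x i - real (Suc k))))"
  proof eventually_elim
    fix k assume *: "\<forall>i\<in>{..<m}. real (Suc k) > x i"
    have "x i \<noteq> real (Suc k)" if "i < m" for i using * that by (metis lessThan_iff less_irrefl)
    then show "0 \<le> real (Suc k) * (\<Sum>i<m. \<Sum>j<m. v i * v j * (f (x j) / ((x i - real (Suc k)) * (x j - real (Suc k))) - loewner F (x i) (x j) / (x i - real (Suc k))))"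
      by (intro mult_nonneg_nonneg psd) auto
  qed
  from tendsto_lowerbound[OF lim this] show "(\<Sum>i<m. \<Sum>j<m. v i * v j * loewner F (x i) (x j)) \<ge> 0" by simp
  define y where "y k = 1 / real (Suc k)" for k
  have y0: "y \<longlonglongrightarrow> 0" unfolding y_def using LIMSEQ_inverse_real_of_nat by (simp add: inverse_eq_divide)
  have "(\<lambda>k. \<Sum>i<m. \<Sum>j<m. v i * v j * (f (x j) / ((x i - y k) * (x j - y k)) - loewner F (x i) (x j) / (x i - y k)))
     \<longlonglongrightarrow> (\<Sum>i<m. \<Sum>j<m. v i * v j * (f (x j) / ((x i - 0) * (x j - 0)) - loewner F (x i) (x j) / (x i - 0)))"
    by (intro tendsto_intros y0) (use x in fastforce)+
  then have lim: "(\<lambda>k. \<Sum>i<m. \<Sum>j<m. v i * v j * (f (x j) / ((x i - y k) * (x j - y k)) - loewner F (x i) (x j) / (x i - y k)))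
     \<longlonglongrightarrow> (\<Sum>i<m. \<Sum>j<m. v i * v j * ((f (x j) / x j - loewner F (x i) (x j)) / x i))"
    by (simp add: diff_divide_distrib mult.commute)
  have "\<forall>\<^sub>F k in sequentially. \<forall>i\<in>{..<m}. y k < x i"
    by (intro eventually_ball_finite ballI order_tendstoD(2)[OF y0]) (use x in auto)
  then have "\<forall>\<^sub>F k in sequentially. 0 \<le> (\<Sum>i<m. \<Sum>j<m. v i * v j * (f (x j) / ((x i - y k) * (x j - y k)) - loewner F (x i) (x j) / (x i - y k)))"
  proof eventually_elim
    fix k assume *: "\<forall>i\<in>{..<m}. y k < x i"
    have "x i \<noteq> y k" if "i < m" for i using * that by (metis lessThan_iff less_irrefl)
    moreover have "y k > 0" by (simp add: y_def)
    ultimately show "0 \<le> (\<Sum>i<m. \<Sum>j<m. v i * v j * (f (x j) / ((x i - y k) * (x j - y k)) - loewner F (x i) (x j) / (x i - y k)))"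
      by (intro psd) auto
  qed
  from tendsto_lowerbound[OF lim this]
  show "(\<Sum>i<m. \<Sum>j<m. v i * v j * ((f (x j) / x j - loewner F (x i) (x j)) / x i)) \<ge> 0" by simp
qed

subsection \<open>Interpolation by convex combinations\<close>

lemma real_psd_complex:
  fixes T :: "nat \<Rightarrow> nat \<Rightarrow> real"
  assumes sym: "\<And>i j. i < n \<Longrightarrow> j < n \<Longrightarrow> T i j = T j i"
    and psd: "\<And>v. (\<Sum>i<n. \<Sum>j<n. v i * v j * T i j) \<ge> 0"
    and u: "u \<in> carrier_vec n"
  shows "Re (cinner u (Matrix.mat n n (\<lambda>(i,j). complex_of_real (T i j)) *\<^sub>v u)) \<ge> 0"
proof -
  let ?M = "Matrix.mat n n (\<lambda>(i,j). complex_of_real (T i j))"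
  have M: "?M \<in> carrier_mat n n" by simp
  have "cinner u (?M *\<^sub>v u) = (\<Sum>i<n. \<Sum>j<n. cnj (u $ i) * complex_of_real (T i j) * u $ j)"
    unfolding cinner_mat[OF M u u] by simp
  then have "Re (cinner u (?M *\<^sub>v u)) = (\<Sum>i<n. \<Sum>j<n. Re (u $ i) * Re (u $ j) * T i j) + (\<Sum>i<n. \<Sum>j<n. Im (u $ i) * Im (u $ j) * T i j)"
    unfolding sum.distrib[symmetric] by (simp add: algebra_simps)
  then show ?thesis using psd[of "\<lambda>i. Re (u $ i)"] psd[of "\<lambda>i. Im (u $ i)"] by simp
qed

lemma spectral_form:
  assumes U: "U \<in> carrier_mat n n" and x: "x \<in> carrier_vec n" "y \<in> carrier_vec n"
  shows "cinner x ((U * diag_of n d * mat_adjoint U) *\<^sub>v y) =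
    (\<Sum>k<n. d k * (cnj ((mat_adjoint U *\<^sub>v x) $ k) * (mat_adjoint U *\<^sub>v y) $ k))"
proof -
  have c: "mat_adjoint U *\<^sub>v x \<in> carrier_vec n" "mat_adjoint U *\<^sub>v y \<in> carrier_vec n"
    using mult_mat_vec_carrier[OF mat_adjoint_carrier[OF U]] x by auto
  have "cinner x ((U * diag_of n d * mat_adjoint U) *\<^sub>v y) = cinner (mat_adjoint U *\<^sub>v x) (diag_of n d *\<^sub>v (mat_adjoint U *\<^sub>v y))"
    unfolding conj_mat_vec[OF U diag_of_carrier x(2)]
    by (rule cinner_adjoint[OF U x(1), symmetric]) (rule mult_mat_vec_carrier[OF diag_of_carrier c(2)])
  also have "\<dots> = (\<Sum>k<n. d k * (cnj ((mat_adjoint U *\<^sub>v x) $ k) * (mat_adjoint U *\<^sub>v y) $ k))"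
    unfolding cinner_def using c U by (intro sum.cong) (auto simp: diag_of_mult_vec simp del: index_mult_mat_vec)
  finally show ?thesis .
qed

lemma unitary_col:
  assumes U: "unitary_mat n U" and i: "i < n"
  shows "Matrix.col U i \<in> carrier_vec n" "mat_adjoint U *\<^sub>v Matrix.col U i = unit_vec n i"
proof -
  note u = unitary_matD[OF U]
  show "Matrix.col U i \<in> carrier_vec n" using u(1) by auto
  have "mat_adjoint U *\<^sub>v Matrix.col U i = Matrix.col (mat_adjoint U * U) i"
    using u(1,2) i by (intro eq_vecI) auto
  then show "mat_adjoint U *\<^sub>v Matrix.col U i = unit_vec n i" using u(3) i by simp
qed

lemma spectral_form_col:
  assumes U: "unitary_mat n U" and i: "i < n"
  shows "cinner (Matrix.col U i) ((U * diag_of n d * mat_adjoint U) *\<^sub>v Matrix.col U i) = d i"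
proof -
  have "cinner (Matrix.col U i) ((U * diag_of n d * mat_adjoint U) *\<^sub>v Matrix.col U i) =
     (\<Sum>k<n. if k = i then d k else 0)"
    unfolding spectral_form[OF unitary_matD(1)[OF U] unitary_col(1)[OF U i] unitary_col(1)[OF U i]] unitary_col(2)[OF U i]
    using i by (intro sum.cong) (auto simp: unit_vec_def)
  then show ?thesis using i by (simp add: sum.delta)
qed

text \<open>In an eigenbasis the value of the form is a sum of nonnegative terms, so each of them
  vanishes.\<close>

lemma psd_form_zero:
  assumes T: "T \<in> carrier_mat n n" "mat_adjoint T = T"
    and psd: "\<And>u. u \<in> carrier_vec n \<Longrightarrow> Re (cinner u (T *\<^sub>v u)) \<ge> 0"
    and u: "u \<in> carrier_vec n" and z: "Re (cinner u (T *\<^sub>v u)) \<le> 0"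
  shows "T *\<^sub>v u = 0\<^sub>v n"
proof -
  obtain V d where V: "unitary_mat n V" and Td: "T = V * diag_of n (\<lambda>i. complex_of_real (d i)) * mat_adjoint V"
    using hermitian_spectral[OF T] by metis
  note v = unitary_matD[OF V]
  have d: "d i \<ge> 0" if "i < n" for i
    using psd[OF unitary_col(1)[OF V that]] spectral_form_col[OF V that, of "\<lambda>i. complex_of_real (d i)"] unfolding Td by simp
  let ?w = "mat_adjoint V *\<^sub>v u"
  have w: "?w \<in> carrier_vec n" by (rule mult_mat_vec_carrier[OF v(2) u])
  have "cinner u (T *\<^sub>v u) = (\<Sum>k<n. complex_of_real (d k) * (cnj (?w $ k) * ?w $ k))"
    unfolding Td by (rule spectral_form[OF v(1) u u])
  then have "Re (cinner u (T *\<^sub>v u)) = (\<Sum>k<n. d k * (cmod (?w $ k))\<^sup>2)"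
    unfolding cmod_power2 by (simp add: power2_eq_square algebra_simps sum.distrib del: index_mult_mat_vec)
  then have "(\<Sum>k<n. d k * (cmod (?w $ k))\<^sup>2) = 0" using z psd[OF u] by linarith
  then have 0: "d k * (cmod (?w $ k))\<^sup>2 = 0" if "k < n" for k
    using that d by (subst (asm) sum_nonneg_eq_0_iff) auto
  have "diag_of n (\<lambda>i. complex_of_real (d i)) *\<^sub>v ?w = 0\<^sub>v n"
  proof (rule eq_vecI)
    fix k assume "k < dim_vec (0\<^sub>v n :: complex Matrix.vec)"
    then have k: "k < n" by simp
    show "(diag_of n (\<lambda>i. complex_of_real (d i)) *\<^sub>v ?w) $ k = 0\<^sub>v n $ k"
      unfolding diag_of_mult_vec[OF w k] using 0[OF k] k by auto
  qed simp
  then show ?thesis unfolding Td conj_mat_vec[OF v(1) diag_of_carrier u] using v(1) by auto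
qed

text \<open>With \<open>G = T + M = E\<^sup>* E\<close> and \<open>T = E\<^sup>* H E\<close> for a Hermitian \<open>0 \<le> H \<le> 1\<close>, the assumption on \<open>x\<close> says that the
  columns of \<open>E\<close> satisfy \<open>((1 - H) x\<^sub>i + H) e\<^sub>i = e\<^sub>0\<close>; the weights are the spectral measure of \<open>H\<close> at \<open>e\<^sub>0\<close>.\<close>

lemma two_forms_representation:
  fixes T M :: "nat \<Rightarrow> nat \<Rightarrow> real" and x b :: "nat \<Rightarrow> real"
  assumes n: "0 < n" and symT: "\<And>i j. i < n \<Longrightarrow> j < n \<Longrightarrow> T i j = T j i"
    and symM: "\<And>i j. i < n \<Longrightarrow> j < n \<Longrightarrow> M i j = M j i"
    and psdT: "\<And>v. (\<Sum>i<n. \<Sum>j<n. v i * v j * T i j) \<ge> 0"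
    and psdM: "\<And>v. (\<Sum>i<n. \<Sum>j<n. v i * v j * M i j) \<ge> 0"
    and rel: "\<And>i j. i < n \<Longrightarrow> j < n \<Longrightarrow> x i * M i j + T i j = b j"
    and x0: "x 0 = 1" and x: "\<And>i. i < n \<Longrightarrow> x i > 0"
  obtains w t where "\<And>l. l < n \<Longrightarrow> w l \<ge> 0 \<and> 0 \<le> t l \<and> t l \<le> (1::real)"
    "\<And>i. i < n \<Longrightarrow> b i = (\<Sum>l<n. w l / ((1 - t l) * x i + t l))"
proof -
  define Tm where "Tm = Matrix.mat n n (\<lambda>(i,j). complex_of_real (T i j))"
  define Mm where "Mm = Matrix.mat n n (\<lambda>(i,j). complex_of_real (M i j))"
  define G where "G = Tm + Mm"
  have Tm: "Tm \<in> carrier_mat n n" and Mm: "Mm \<in> carrier_mat n n" and G: "G \<in> carrier_mat n n"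
    by (auto simp: Tm_def Mm_def G_def)
  have hT: "mat_adjoint Tm = Tm" by (rule eq_matI) (auto simp: Tm_def symT)
  have hM: "mat_adjoint Mm = Mm" by (rule eq_matI) (auto simp: Mm_def symM)
  have hG: "mat_adjoint G = G" unfolding G_def by (simp add: mat_adjoint_add[OF Tm Mm] hT hM)
  have pT: "Re (cinner u (Tm *\<^sub>v u)) \<ge> 0" if "u \<in> carrier_vec n" for u
    unfolding Tm_def by (rule real_psd_complex[OF symT psdT that])
  have pM: "Re (cinner u (Mm *\<^sub>v u)) \<ge> 0" if "u \<in> carrier_vec n" for u
    unfolding Mm_def by (rule real_psd_complex[OF symM psdM that])
  have Gsplit: "cinner u (G *\<^sub>v u) = cinner u (Tm *\<^sub>v u) + cinner u (Mm *\<^sub>v u)" if "u \<in> carrier_vec n" for u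
    unfolding G_def using that Tm Mm
    by (simp add: add_mult_distrib_mat_vec[of _ n n] cinner_add_right[of _ n] mult_mat_vec_carrier[of _ n n])
  have pG: "Re (cinner u (G *\<^sub>v u)) \<ge> Re (cinner u (Tm *\<^sub>v u))" if "u \<in> carrier_vec n" for u
    using Gsplit[OF that] pM[OF that] by simp
  obtain U g where U: "unitary_mat n U" and Gd: "G = U * diag_of n (\<lambda>i. complex_of_real (g i)) * mat_adjoint U"
    using hermitian_spectral[OF G hG] by metis
  note u = unitary_matD[OF U]
  have g: "g i \<ge> 0" if "i < n" for i
    using pG[OF unitary_col(1)[OF U that]] pT[OF unitary_col(1)[OF U that]]
      spectral_form_col[OF U that, of "\<lambda>i. complex_of_real (g i)"] unfolding Gd by simp
  define sq where "sq = diag_of n (\<lambda>i. complex_of_real (sqrt (g i)))"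
  \<comment> \<open>G may be singular. In the eigenbasis of G, \<open>S\<close> is the
    pseudo-inverse of the square root \<open>sq\<close>, and \<open>Pi\<close> is the projection
    onto its range.\<close>
  define S where "S = diag_of n (\<lambda>i. complex_of_real (if g i = 0 then 0 else 1 / sqrt (g i)))"
  define Pi where "Pi = diag_of n (\<lambda>i. if g i = 0 then 0 else 1 :: complex)"
  have sqc: "sq \<in> carrier_mat n n" and Sc: "S \<in> carrier_mat n n" and Pc: "Pi \<in> carrier_mat n n"
    by (auto simp: sq_def S_def Pi_def)
  have hsq: "mat_adjoint sq = sq" and hS: "mat_adjoint S = S" and hP: "mat_adjoint Pi = Pi"
    by (auto simp: sq_def S_def Pi_def mat_adjoint_diag_of intro!: eq_matI)
  have Ssq: "S * sq = Pi" and sqS: "sq * S = Pi" and PS: "Pi * S = S" and Psq: "Pi * sq = sq"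
    unfolding S_def sq_def Pi_def diag_of_mult using g by (auto intro!: eq_matI simp flip: of_real_mult)
  have sq2: "sq * sq = diag_of n (\<lambda>i. complex_of_real (g i))"
    unfolding sq_def diag_of_mult using g by (auto intro!: eq_matI simp flip: of_real_mult)
  define E where "E = sq * mat_adjoint U"
  have E: "E \<in> carrier_mat n n" unfolding E_def using sqc u by simp
  have aE: "mat_adjoint E = U * sq"
    unfolding E_def using sqc u hsq by (simp add: mat_adjoint_mult[of _ n n _ n])
  have GE: "G = mat_adjoint E * E"
  proof -
    have "mat_adjoint E * E = U * (sq * sq) * mat_adjoint U"
      unfolding aE unfolding E_def by (simp only: sq_mat_simps[where n = n] u(1) sqc)
    then show ?thesis unfolding sq2 Gd by simp
  qed
  define H where "H = S * mat_adjoint U * Tm * U * S"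
  have H: "H \<in> carrier_mat n n" unfolding H_def by (simp only: sq_mat_simps[where n = n] u(1) Sc Tm)
  have hH: "mat_adjoint H = H"
    unfolding H_def by (simp only: mat_adjoint_adjoint sq_mat_simps[where n = n] u(1) Sc Tm hS hT)
  have PH: "Pi * H = H"
  proof -
    have "Pi * H = (Pi * S) * mat_adjoint U * Tm * U * S"
      unfolding H_def by (simp only: sq_mat_simps[where n = n] u(1) Sc Tm Pc)
    then show ?thesis unfolding PS H_def .
  qed
  have PE: "Pi * E = E"
  proof -
    have "Pi * E = (Pi * sq) * mat_adjoint U"
      unfolding E_def by (simp only: sq_mat_simps[where n = n] u(1) sqc Pc)
    then show ?thesis unfolding Psq E_def .
  qed
  \<comment> \<open>Since 0 \<le> T \<le> G as forms, T annihilates every eigenvector of G with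
    eigenvalue 0, so \<open>Pi\<close> may be inserted next to T.\<close>
  have TUP: "Tm * U * Pi = Tm * U"
  proof (rule eq_matI)
    fix i j assume "i < dim_row (Tm * U)" "j < dim_col (Tm * U)"
    then have ij: "i < n" "j < n" using Tm u by auto
    have TU: "Tm * U \<in> carrier_mat n n" using Tm u by simp
    have zero: "(Tm * U) $$ (i,j) = 0" if "g j = 0"
    proof -
      let ?c = "Matrix.col U j"
      note c = unitary_col(1)[OF U ij(2)]
      have "Re (cinner ?c (Tm *\<^sub>v ?c)) \<le> 0"
        using pG[OF c(1)] spectral_form_col[OF U ij(2), of "\<lambda>i. complex_of_real (g i)"] that unfolding Gd by simp
      then have "Tm *\<^sub>v ?c = 0\<^sub>v n" using psd_form_zero[OF Tm hT pT c(1)] by blast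
      then have "(Tm *\<^sub>v ?c) $ i = 0" using ij by simp
      then show ?thesis using Tm u(1) ij by simp
    qed
    show "(Tm * U * Pi) $$ (i,j) = (Tm * U) $$ (i,j)"
      unfolding Pi_def mult_diag_of_right[OF TU] using zero ij by (simp del: index_mult_mat(1))
  qed (use Tm u Pc in auto)
  have PUT: "Pi * mat_adjoint U * Tm = mat_adjoint U * Tm"
  proof -
    have "mat_adjoint (Tm * U * Pi) = mat_adjoint (Tm * U)" unfolding TUP ..
    then show ?thesis
      by (simp only: mat_adjoint_adjoint sq_mat_simps[where n = n] u(1) Tm Pc hT hP)
  qed
  have ETE: "mat_adjoint E * H * E = Tm"
  proof -
    have "mat_adjoint E * H * E = U * ((sq * S) * mat_adjoint U * Tm) * (U * (S * sq)) * mat_adjoint U"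
      unfolding aE unfolding E_def H_def by (simp only: sq_mat_simps[where n = n] u(1) sqc Sc Tm)
    also have "\<dots> = U * mat_adjoint U * (Tm * U * Pi) * mat_adjoint U"
      unfolding sqS Ssq PUT by (simp only: sq_mat_simps[where n = n] u(1) sqc Sc Tm Pc)
    also have "\<dots> = (U * mat_adjoint U) * Tm * (U * mat_adjoint U)"
      unfolding TUP by (simp only: sq_mat_simps[where n = n] u(1) Tm)
    finally show ?thesis using u Tm by simp
  qed
  obtain V t where V: "unitary_mat n V" and Hd: "H = V * diag_of n (\<lambda>i. complex_of_real (t i)) * mat_adjoint V"
    using hermitian_spectral[OF H hH] by metis
  note v = unitary_matD[OF V]
  \<comment> \<open>An eigenvalue of H is the value of the form T at z = U S c for a unit
    eigenvector c. It lies between 0 and the value of G at z, which is at most |c|^2 = 1.\<close>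
  have t: "0 \<le> t l \<and> t l \<le> 1" if l: "l < n" for l
  proof -
    let ?c = "Matrix.col V l"
    note c = unitary_col(1)[OF V l]
    let ?y = "S *\<^sub>v ?c"
    have y: "?y \<in> carrier_vec n" by (rule mult_mat_vec_carrier[OF Sc c])
    let ?z = "U *\<^sub>v ?y"
    have z: "?z \<in> carrier_vec n" by (rule mult_mat_vec_carrier[OF u(1) y])
    have "H = mat_adjoint (U * S) * Tm * (U * S)"
      unfolding H_def by (simp only: mat_adjoint_adjoint sq_mat_simps[where n = n] u(1) Sc Tm hS)
    moreover have "U * S *\<^sub>v ?c = ?z" by (rule assoc_mult_mat_vec[OF u(1) Sc c])
    moreover have US: "U * S \<in> carrier_mat n n" using u Sc by simp
    ultimately have "cinner ?c (H *\<^sub>v ?c) = cinner ?c (mat_adjoint (U * S) *\<^sub>v (Tm *\<^sub>v ?z))"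
      using conj_mat_vec[OF mat_adjoint_carrier[OF US] Tm c] by simp
    also have "\<dots> = cinner ?z (Tm *\<^sub>v ?z)"
      using cinner_adjoint[OF mat_adjoint_carrier[OF US] c mult_mat_vec_carrier[OF Tm z]] \<open>U * S *\<^sub>v ?c = ?z\<close> by simp
    finally have 1: "complex_of_real (t l) = cinner ?z (Tm *\<^sub>v ?z)"
      using spectral_form_col[OF V l, of "\<lambda>i. complex_of_real (t i)"] unfolding Hd by simp
    have yz: "mat_adjoint U *\<^sub>v ?z = ?y"
      using assoc_mult_mat_vec[OF u(2) u(1) y] u(3) y by simp
    have "cinner ?z (G *\<^sub>v ?z) = (\<Sum>k<n. complex_of_real (g k) * (cnj (?y $ k) * ?y $ k))"
      unfolding Gd using spectral_form[OF u(1) z z, of "\<lambda>i. complex_of_real (g i)"] unfolding yz .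
    then have "Re (cinner ?z (G *\<^sub>v ?z)) = (\<Sum>k<n. g k * (cmod (?y $ k))\<^sup>2)"
      unfolding cmod_power2 by (simp add: power2_eq_square algebra_simps sum.distrib del: index_mult_mat_vec)
    also have "\<dots> \<le> (\<Sum>k<n. (cmod (?c $ k))\<^sup>2)"
    proof (rule sum_mono)
      fix k assume "k \<in> {..<n}"
      then have k: "k < n" by simp
      show "g k * (cmod (?y $ k))\<^sup>2 \<le> (cmod (?c $ k))\<^sup>2"
        unfolding S_def diag_of_mult_vec[OF c k] using g[OF k]
        by (auto simp: norm_mult norm_divide power_mult_distrib power_divide)
    qed
    also have "\<dots> = 1"
    proof -
      have "complex_of_real (\<Sum>k<n. (cmod (?c $ k))\<^sup>2) = cinner ?c ?c" using c v(1) by (simp add: cinner_self)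
      also have "\<dots> = cinner (mat_adjoint V *\<^sub>v ?c) (mat_adjoint V *\<^sub>v ?c)"
        using cinner_adjoint[OF v(1) c, of "mat_adjoint V *\<^sub>v ?c"] assoc_mult_mat_vec[OF v(1) v(2) c] v(4) c v(2)
        by (simp add: mult_mat_vec_carrier[of _ n n])
      also have "\<dots> = (\<Sum>k<n. if k = l then 1 else 0)"
        unfolding unitary_col(2)[OF V l] cinner_def using l by (intro sum.cong) (auto simp: unit_vec_def)
      also have "\<dots> = 1" using l by (simp add: sum.delta)
      finally show ?thesis using of_real_eq_1_iff by blast
    qed
    finally have "Re (cinner ?z (G *\<^sub>v ?z)) \<le> 1" .
    then show ?thesis using 1 pT[OF z] pG[OF z] by (metis Re_complex_of_real order_trans)
  qed
  define Xd where "Xd = diag_of n (\<lambda>i. complex_of_real (x i))"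
  define J where "J = Matrix.mat n n (\<lambda>(k,i). if k = 0 then 1 else 0 :: complex)"
  have Xc: "Xd \<in> carrier_mat n n" and Jc: "J \<in> carrier_mat n n" by (auto simp: Xd_def J_def)
  have mulJ: "(A * J) $$ (k,i) = A $$ (k,0)" if A: "A \<in> carrier_mat n n" and ki: "k < n" "i < n" for A :: "complex mat" and k i
  proof -
    have "(A * J) $$ (k,i) = (\<Sum>l<n. if l = 0 then A $$ (k,0) else 0)"
      unfolding mat_mult_index[OF A Jc ki] using ki by (intro sum.cong) (auto simp: J_def)
    then show ?thesis using n by (simp add: sum.delta)
  qed
  define R where "R = (E - H * E) * Xd + H * E - E * J"
  have HE: "H * E \<in> carrier_mat n n" and EJ: "E * J \<in> carrier_mat n n" using H E Jc by auto
  have EHE: "E - H * E \<in> carrier_mat n n" by (rule minus_carrier_mat[OF HE])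
  have R: "R \<in> carrier_mat n n" unfolding R_def by (rule minus_carrier_mat[OF EJ])
  \<comment> \<open>Entry (j, i) is x_i M_ji + T_ji - G_j0. Both parts equal b_j: the first by
    \<open>rel\<close>, the second by \<open>rel\<close> at the index 0, where x_0 = 1.\<close>
  have ER: "mat_adjoint E * R = 0\<^sub>m n n"
  proof -
    note aEc = mat_adjoint_carrier[OF E]
    have s1: "mat_adjoint E * (H * E) = Tm" using assoc_mult_mat[OF aEc H E] ETE by simp
    have s2: "mat_adjoint E * (E * J) = G * J" using assoc_mult_mat[OF aEc E Jc] GE by simp
    have s3: "mat_adjoint E * ((E - H * E) * Xd) = (G - Tm) * Xd"
      using assoc_mult_mat[OF aEc EHE Xc] mult_minus_distrib_mat[OF aEc E HE] s1 GE by simp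
    have "mat_adjoint E * R = (G - Tm) * Xd + Tm - G * J"
      unfolding R_def
      using mult_minus_distrib_mat[OF aEc _ EJ, of "(E - H * E) * Xd + H * E"]
        mult_add_distrib_mat[OF aEc _ HE, of "(E - H * E) * Xd"] s1 s2 s3 EHE HE Xc by simp
    also have "\<dots> = 0\<^sub>m n n"
    proof (rule eq_matI)
      fix j i assume "j < dim_row (0\<^sub>m n n :: complex mat)" "i < dim_col (0\<^sub>m n n :: complex mat)"
      then have ji: "j < n" "i < n" by auto
      have c: "G - Tm \<in> carrier_mat n n" by (rule minus_carrier_mat[OF Tm])
      have d: "dim_row G = n" "dim_col G = n" "dim_row Tm = n" "dim_col Tm = n" "dim_row Xd = n" "dim_col Xd = n" "dim_row J = n" "dim_col J = n"
        using G Tm Xc Jc by auto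
      have "((G - Tm) * Xd + Tm - G * J) $$ (j,i) = ((G - Tm) * Xd) $$ (j,i) + Tm $$ (j,i) - (G * J) $$ (j,i)"
        using ji d by (simp del: index_mult_mat(1))
      also have "((G - Tm) * Xd) $$ (j,i) = complex_of_real (M j i * x i)"
        unfolding Xd_def mult_diag_of_right[OF c] using ji d by (simp add: G_def Tm_def Mm_def)
      also have "(G * J) $$ (j,i) = complex_of_real (T j 0 + M j 0)"
        unfolding mulJ[OF G ji] using ji n by (simp add: G_def Tm_def Mm_def)
      also have "Tm $$ (j,i) = complex_of_real (T j i)" using ji by (simp add: Tm_def)
      also have "complex_of_real (M j i * x i) + complex_of_real (T j i) - complex_of_real (T j 0 + M j 0) = complex_of_real 0"
        unfolding of_real_add[symmetric] of_real_diff[symmetric]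
        using rel[OF ji(2) ji(1)] rel[OF n ji(1)] symM[OF ji] symT[OF ji] symM[OF ji(1) n] symT[OF ji(1) n] x0
        by (intro arg_cong[of _ _ complex_of_real]) (simp add: mult.commute)
      finally show "((G - Tm) * Xd + Tm - G * J) $$ (j,i) = 0\<^sub>m n n $$ (j,i)" using ji by simp
    qed (use Tm G Xc Jc in auto)
    finally show ?thesis .
  qed
  have PR: "Pi * R = R"
  proof -
    have "Pi * (H * E) = H * E" using assoc_mult_mat[OF Pc H E] PH by simp
    moreover have "Pi * (E * J) = E * J" using assoc_mult_mat[OF Pc E Jc] PE by simp
    moreover have "Pi * ((E - H * E) * Xd) = (E - H * E) * Xd"
      using assoc_mult_mat[OF Pc EHE Xc] mult_minus_distrib_mat[OF Pc E HE] PE \<open>Pi * (H * E) = H * E\<close> by simp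
    ultimately show ?thesis unfolding R_def
      using mult_minus_distrib_mat[OF Pc _ EJ, of "(E - H * E) * Xd + H * E"]
        mult_add_distrib_mat[OF Pc _ HE, of "(E - H * E) * Xd"] EHE HE Xc by simp
  qed
  \<comment> \<open>R lies in the range of \<open>Pi\<close>, on which E^* is injective.\<close>
  have R0: "R = 0\<^sub>m n n"
  proof -
    have "R = S * (mat_adjoint U * U) * sq * R"
    proof -
      have "S * (mat_adjoint U * U) * sq * R = (S * sq) * R" using u Sc sqc R by simp
      then show ?thesis unfolding Ssq PR by simp
    qed
    also have "\<dots> = S * mat_adjoint U * (mat_adjoint E * R)"
      unfolding aE by (simp only: sq_mat_simps[where n = n] u(1) sqc Sc R)
    finally show ?thesis unfolding ER using Sc u by simp
  qed
  define Y where "Y = mat_adjoint V * E"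
  have Y: "Y \<in> carrier_mat n n" unfolding Y_def by (rule mult_carrier_mat[OF v(2) E])
  have VHE: "mat_adjoint V * (H * E) = diag_of n (\<lambda>i. complex_of_real (t i)) * Y"
  proof -
    have "mat_adjoint V * (H * E) = (mat_adjoint V * V) * (diag_of n (\<lambda>i. complex_of_real (t i)) * (mat_adjoint V * E))"
      unfolding Hd by (simp only: sq_mat_simps[where n = n] v(1) E)
    then show ?thesis unfolding v(3) Y_def
      using left_mult_one_mat[OF mult_carrier_mat[OF diag_of_carrier mult_carrier_mat[OF v(2) E]]] by simp
  qed
  have rec: "(complex_of_real (1 - t l) * complex_of_real (x i) + complex_of_real (t l)) * Y $$ (l,i) = Y $$ (l,0)"
    if li: "l < n" "i < n" for l i
  proof -
    let ?D = "diag_of n (\<lambda>i. complex_of_real (t i))"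
    have DY: "?D * Y \<in> carrier_mat n n" by (rule mult_carrier_mat[OF diag_of_carrier Y])
    have YD: "Y - ?D * Y \<in> carrier_mat n n" by (rule minus_carrier_mat[OF DY])
    have s2: "mat_adjoint V * (E * J) = Y * J" using assoc_mult_mat[OF v(2) E Jc] Y_def by simp
    have s3: "mat_adjoint V * ((E - H * E) * Xd) = (Y - ?D * Y) * Xd"
      using assoc_mult_mat[OF v(2) EHE Xc] mult_minus_distrib_mat[OF v(2) E HE] VHE Y_def by simp
    have VR: "mat_adjoint V * R = (Y - ?D * Y) * Xd + ?D * Y - Y * J"
      unfolding R_def
      using mult_minus_distrib_mat[OF v(2) _ EJ, of "(E - H * E) * Xd + H * E"]
        mult_add_distrib_mat[OF v(2) _ HE, of "(E - H * E) * Xd"] VHE s2 s3 EHE HE Xc by simp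
    have "((Y - ?D * Y) * Xd + ?D * Y - Y * J) $$ (l,i) = 0"
      unfolding VR[symmetric] R0 using v li by simp
    moreover have d: "dim_row Y = n" "dim_col Y = n" "dim_row Xd = n" "dim_col Xd = n" "dim_row J = n" "dim_col J = n"
      using Y Xc Jc by auto
    have "((Y - ?D * Y) * Xd + ?D * Y - Y * J) $$ (l,i) = ((Y - ?D * Y) * Xd) $$ (l,i) + (?D * Y) $$ (l,i) - (Y * J) $$ (l,i)"
      using li d by (simp del: index_mult_mat(1))
    also have "\<dots> = (Y $$ (l,i) - complex_of_real (t l) * Y $$ (l,i)) * complex_of_real (x i) + complex_of_real (t l) * Y $$ (l,i) - Y $$ (l,0)"
      unfolding mulJ[OF Y li] unfolding Xd_def mult_diag_of_right[OF YD] unfolding mult_diag_of_left[OF Y] using li d by simp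
    ultimately show ?thesis by (simp add: algebra_simps)
  qed
  have pos: "(1 - t l) * x i + t l > 0" if "l < n" "i < n" for l i
  proof (cases "t l = 0")
    case False
    then have "t l > 0" using t[OF that(1)] by simp
    moreover have "(1 - t l) * x i \<ge> 0" using t[OF that(1)] x[OF that(2)] by (intro mult_nonneg_nonneg) auto
    ultimately show ?thesis by linarith
  qed (use x that in auto)
  \<comment> \<open>Y holds the columns of E in the eigenbasis of H. By \<open>rec\<close> its
    entries in column i are those of column 0 divided by (1 - t_l) x_i + t_l, so b_i = G_0i, the
    product of columns 0 and i of E, is a sum with weights |Y_l0|^2.\<close>
  define w where "w l = (cmod (Y $$ (l,0)))\<^sup>2" for l
  have "b i = (\<Sum>l<n. w l / ((1 - t l) * x i + t l))" if i: "i < n" for i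
  proof -
    have "G = mat_adjoint E * (V * mat_adjoint V) * E" unfolding v(4) GE using E by simp
    also have "\<dots> = mat_adjoint Y * Y"
      unfolding Y_def by (simp only: mat_adjoint_adjoint sq_mat_simps[where n = n] v(1) E)
    finally have "G $$ (0,i) = (\<Sum>l<n. mat_adjoint Y $$ (0,l) * Y $$ (l,i))"
      using mat_mult_index[OF mat_adjoint_carrier[OF Y] Y n i] by simp
    also have "\<dots> = (\<Sum>l<n. complex_of_real (w l / ((1 - t l) * x i + t l)))"
    proof (rule sum.cong[OF refl])
      fix l assume "l \<in> {..<n}"
      then have l: "l < n" by simp
      let ?q = "complex_of_real (1 - t l) * complex_of_real (x i) + complex_of_real (t l)"
      have q: "?q = complex_of_real ((1 - t l) * x i + t l)" by simp
      have q0: "?q \<noteq> 0" unfolding q using pos[OF l i] by (metis of_real_eq_0_iff less_irrefl)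
      have "Y $$ (l,i) = Y $$ (l,0) / ?q" using rec[OF l i] q0 by (simp add: field_simps)
      moreover have "mat_adjoint Y $$ (0,l) = cnj (Y $$ (l,0))" using Y l n by (intro mat_adjoint_index) auto
      ultimately have "mat_adjoint Y $$ (0,l) * Y $$ (l,i) = (Y $$ (l,0) * cnj (Y $$ (l,0))) / ?q" by simp
      also have "Y $$ (l,0) * cnj (Y $$ (l,0)) = complex_of_real (w l)"
        unfolding w_def by (rule complex_norm_square[symmetric, unfolded of_real_power[symmetric]])
      finally show "mat_adjoint Y $$ (0,l) * Y $$ (l,i) = complex_of_real (w l / ((1 - t l) * x i + t l))"
        unfolding q by simp
    qed
    also have "G $$ (0,i) = complex_of_real (T 0 i + M 0 i)" using i n by (simp add: G_def Tm_def Mm_def)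
    finally have "complex_of_real (T 0 i + M 0 i) = complex_of_real (\<Sum>l<n. w l / ((1 - t l) * x i + t l))" by simp
    then have "T 0 i + M 0 i = (\<Sum>l<n. w l / ((1 - t l) * x i + t l))" unfolding of_real_eq_iff .
    then show ?thesis using rel[OF n i] x0 by simp
  qed
  moreover have "w l \<ge> 0 \<and> 0 \<le> t l \<and> t l \<le> 1" if "l < n" for l using t[OF that] by (simp add: w_def)
  ultimately show ?thesis using that by blast
qed

subsection \<open>Approximation of the function\<close>

definition hcomb :: "nat \<Rightarrow> (nat \<Rightarrow> real) \<Rightarrow> (nat \<Rightarrow> real) \<Rightarrow> complex \<Rightarrow> complex" where
  "hcomb n w t z = (\<Sum>l<n. complex_of_real (w l) * hfun (t l) z)"

definition weights :: "nat \<Rightarrow> (nat \<Rightarrow> real) \<Rightarrow> (nat \<Rightarrow> real) \<Rightarrow> bool" where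
  "weights n w t \<longleftrightarrow> (\<forall>l<n. 0 \<le> w l \<and> 0 \<le> t l \<and> t l \<le> 1) \<and> (\<Sum>l<n. w l) = 1"

lemma hfun_of_real: "hfun t (complex_of_real x) = complex_of_real (x / ((1 - t) * x + t))"
  by (simp add: hfun_def)

text \<open>The two kernels fit together because x_i M_ij + T_ij = f(x_j) / x_j does not depend on
  i. At the node x_0 = 1 the resulting representation says that the weights sum to f(1) = 1.\<close>

lemma finite_interpolation:
  fixes x :: "nat \<Rightarrow> real"
  assumes mm: "matrix_monotone_class f"
    and F: "F holomorphic_on slit_plane"
    and fF: "\<And>x. x > 0 \<Longrightarrow> F (complex_of_real x) = complex_of_real (f x)"
    and n: "0 < n" and x: "\<And>i. i < n \<Longrightarrow> x i > 0" and x0: "x 0 = 1"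
  obtains w t where "weights n w t" "\<And>i. i < n \<Longrightarrow> hcomb n w t (complex_of_real (x i)) = F (complex_of_real (x i))"
proof -
  define T where "T i j = loewner F (x i) (x j)" for i j
  define M where "M i j = (f (x j) / x j - T i j) / x i" for i j
  have symM: "M i j = M j i" if ij: "i < n" "j < n" for i j
  proof -
    have d: "T i j * (x i - x j) = f (x i) - f (x j)" unfolding T_def by (rule loewner_diff[OF F fF]) (use x ij in auto)
    have s: "T j i = T i j" unfolding T_def by (rule loewner_commute)
    have "M i j * (x i * x j) = f (x j) - T i j * x j" "f (x i) - T i j * x i = M j i * (x i * x j)"
      unfolding M_def s using x[OF ij(1)] x[OF ij(2)] by (simp_all add: field_simps)
    moreover have "f (x j) - T i j * x j = f (x i) - T i j * x i" using d by (simp add: right_diff_distrib)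
    ultimately have "M i j * (x i * x j) = M j i * (x i * x j)" by (simp only:)
    then show ?thesis using x[OF ij(1)] x[OF ij(2)] by simp
  qed
  obtain w t where wt: "\<And>l. l < n \<Longrightarrow> w l \<ge> 0 \<and> 0 \<le> t l \<and> t l \<le> (1::real)"
    and b: "\<And>i. i < n \<Longrightarrow> f (x i) / x i = (\<Sum>l<n. w l / ((1 - t l) * x i + t l))"
  proof (rule two_forms_representation[of n T M x "\<lambda>i. f (x i) / x i", OF n _ symM])
    show "T i j = T j i" for i j unfolding T_def by (rule loewner_commute)
    show "0 \<le> (\<Sum>i<n. \<Sum>j<n. v i * v j * T i j)" for v unfolding T_def by (rule loewner_psd[OF mm F fF x])
    show "0 \<le> (\<Sum>i<n. \<Sum>j<n. v i * v j * M i j)" for v unfolding M_def T_def by (rule loewner_quotient_psd[OF mm F fF x])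
    show "x i * M i j + T i j = f (x j) / x j" if "i < n" "j < n" for i j
      unfolding M_def using x[OF that(1)] by simp
  qed (use x x0 in auto)
  have "weights n w t" unfolding weights_def
    using wt b[OF n] mm x0 by (auto simp: matrix_monotone_class_def)
  moreover have "hcomb n w t (complex_of_real (x i)) = F (complex_of_real (x i))" if i: "i < n" for i
  proof -
    have "f (x i) = x i * (\<Sum>l<n. w l / ((1 - t l) * x i + t l))" using b[OF i] x[OF i] by (simp add: field_simps)
    then have "f (x i) = (\<Sum>l<n. w l * (x i / ((1 - t l) * x i + t l)))" by (simp add: sum_distrib_left ac_simps)
    then have "complex_of_real (f (x i)) = hcomb n w t (complex_of_real (x i))"
      unfolding hcomb_def hfun_of_real by simp
    then show ?thesis using fF[OF x[OF i]] by simp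
  qed
  ultimately show ?thesis using that by blast
qed

lemma holomorphic_hcomb: "weights n w t \<Longrightarrow> hcomb n w t holomorphic_on slit_plane"
  unfolding hcomb_def[abs_def] weights_def by (intro holomorphic_intros holomorphic_hfun) auto

text \<open>The denominators for t in [0, 1] and z in K form a compact set without 0. This bounds
  all h_t on K at once, and a convex combination obeys the same bound. It is the local boundedness
  that Montel's theorem asks for.\<close>

lemma hcomb_bounded:
  assumes K: "compact K" "K \<subseteq> slit_plane"
  obtains B where "\<And>n w t z. weights n w t \<Longrightarrow> z \<in> K \<Longrightarrow> cmod (hcomb n w t z) \<le> B"
proof -
  let ?S = "(\<lambda>(t,z). (1 - complex_of_real t) * z + complex_of_real t) ` ({0..1} \<times> K)"
  have cS: "compact ?S"
    by (intro compact_continuous_image compact_Times K) (auto intro!: continuous_intros simp: case_prod_beta)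
  have nS: "0 \<notin> ?S"
  proof
    assume "0 \<in> ?S"
    then obtain t z where "0 \<le> t" "t \<le> 1" "z \<in> K" "(1 - complex_of_real t) * z + complex_of_real t = 0"
      by (auto simp: image_iff)
    then show False using hfun_denom_nonzero[of z t] K(2) by blast
  qed
  obtain d where d: "d > 0" "\<And>s. s \<in> ?S \<Longrightarrow> d \<le> dist 0 s"
    using separate_point_closed[OF compact_imp_closed[OF cS] nS] by blast
  obtain C where C: "\<And>z. z \<in> K \<Longrightarrow> cmod z \<le> C" using compact_imp_bounded[OF K(1)] bounded_iff by blast
  have h: "cmod (hfun t z) \<le> \<bar>C\<bar> / d" if "z \<in> K" "0 \<le> t" "t \<le> 1" for t z
  proof -
    have "d \<le> dist 0 ((1 - complex_of_real t) * z + complex_of_real t)"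
      using that by (intro d(2) image_eqI[of _ _ "(t, z)"]) auto
    then have "d \<le> cmod ((1 - complex_of_real t) * z + complex_of_real t)" by simp
    moreover have "cmod z \<le> \<bar>C\<bar>" using C[OF that(1)] by linarith
    ultimately show ?thesis unfolding hfun_def norm_divide using d(1) by (intro frac_le) auto
  qed
  have "cmod (hcomb n w t z) \<le> \<bar>C\<bar> / d" if wt: "weights n w t" and z: "z \<in> K" for n w t z
  proof -
    have "cmod (hcomb n w t z) \<le> (\<Sum>l<n. w l * (\<bar>C\<bar> / d))"
      unfolding hcomb_def
    proof (rule sum_norm_le)
      fix l assume "l \<in> {..<n}"
      then have l: "0 \<le> w l" "0 \<le> t l" "t l \<le> 1" using wt by (auto simp: weights_def)
      show "cmod (complex_of_real (w l) * hfun (t l) z) \<le> w l * (\<bar>C\<bar> / d)"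
        using l h[OF z l(2,3)] by (simp add: norm_mult mult_left_mono del: times_divide_eq_right)
    qed
    also have "\<dots> = \<bar>C\<bar> / d" using wt unfolding sum_distrib_right[symmetric] weights_def by simp
    finally show ?thesis .
  qed
  then show ?thesis using that by blast
qed

lemma hcomb_approximation:
  assumes mm: "matrix_monotone_class f"
    and F: "F holomorphic_on slit_plane"
    and fF: "\<And>x. x > 0 \<Longrightarrow> F (complex_of_real x) = complex_of_real (f x)"
  obtains n w t where "\<And>k. weights (n k) (w k) (t k)"
    "\<And>K. \<lbrakk>compact K; K \<subseteq> slit_plane\<rbrakk> \<Longrightarrow> uniform_limit K (\<lambda>k. hcomb (n k) (w k) (t k)) F sequentially"
proof -
  \<comment> \<open>\<open>x 0 = 1\<close> because \<open>1 / 0 = 0\<close>\<close>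
  define x where "x i = 1 + 1 / real i" for i
  have xpos: "x i > 0" for i by (simp add: x_def add_pos_nonneg)
  have "\<exists>w t. weights (Suc k) w t \<and> (\<forall>i<Suc k. hcomb (Suc k) w t (complex_of_real (x i)) = F (complex_of_real (x i)))" for k
  proof -
    obtain w t where "weights (Suc k) w t" "\<And>i. i < Suc k \<Longrightarrow> hcomb (Suc k) w t (complex_of_real (x i)) = F (complex_of_real (x i))"
      by (rule finite_interpolation[OF mm F fF, of "Suc k" x]) (use xpos in \<open>auto simp: x_def\<close>)
    then show ?thesis by blast
  qed
  then obtain w t where wt: "\<And>k. weights (Suc k) (w k) (t k)"
    and int: "\<And>k i. i < Suc k \<Longrightarrow> hcomb (Suc k) (w k) (t k) (complex_of_real (x i)) = F (complex_of_real (x i))"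
    by metis
  define \<F> where "\<F> k = hcomb (Suc k) (w k) (t k)" for k
  obtain g r where g: "g holomorphic_on slit_plane" and r: "strict_mono (r :: nat \<Rightarrow> nat)"
    and lim: "\<And>z. z \<in> slit_plane \<Longrightarrow> (\<lambda>k. \<F> (r k) z) \<longlonglongrightarrow> g z"
    and ulim: "\<And>K. \<lbrakk>compact K; K \<subseteq> slit_plane\<rbrakk> \<Longrightarrow> uniform_limit K (\<F> \<circ> r) g sequentially"
  proof (rule Montel[OF open_slit_plane, of "range \<F>" \<F>])
    show "h holomorphic_on slit_plane" if "h \<in> range \<F>" for h
      using that holomorphic_hcomb[OF wt] by (auto simp: \<F>_def)
    show "\<exists>B. \<forall>h\<in>range \<F>. \<forall>z\<in>K. cmod (h z) \<le> B" if K: "compact K" "K \<subseteq> slit_plane" for K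
    proof -
      obtain B where "\<And>n w t z. weights n w t \<Longrightarrow> z \<in> K \<Longrightarrow> cmod (hcomb n w t z) \<le> B"
        using hcomb_bounded[OF K] by blast
      then have "\<forall>h\<in>range \<F>. \<forall>z\<in>K. cmod (h z) \<le> B" using wt by (auto simp: \<F>_def)
      then show ?thesis by blast
    qed
  qed auto
  have slit: "complex_of_real (x i) \<in> slit_plane" for i using xpos by (simp add: mem_slit_plane_iff)
  \<comment> \<open>The member with index k interpolates at the nodes 0, ..., k, so each node is met
    by all but finitely many members of the subsequence.\<close>
  have eq: "g (complex_of_real (x i)) = F (complex_of_real (x i))" for i
  proof -
    have "\<forall>\<^sub>F k in sequentially. \<F> (r k) (complex_of_real (x i)) = F (complex_of_real (x i))"
      using eventually_ge_at_top[of i]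
    proof eventually_elim
      fix k assume "i \<le> k"
      then have "i < Suc (r k)" using seq_suble[OF r, of k] by simp
      then show "\<F> (r k) (complex_of_real (x i)) = F (complex_of_real (x i))" unfolding \<F>_def by (rule int)
    qed
    then have "(\<lambda>k. \<F> (r k) (complex_of_real (x i))) \<longlonglongrightarrow> F (complex_of_real (x i))" by (rule tendsto_eventually)
    then show ?thesis using lim[OF slit] LIMSEQ_unique by blast
  qed
  have gF: "g z = F z" if z: "z \<in> slit_plane" for z
  proof -
    \<comment> \<open>The nodes accumulate at 1, an interior point of the slit plane. The index is
      shifted because node 0 is the limit point itself.\<close>
    have "(\<lambda>z. g z - F z) z = 0"
    proof (rule analytic_continuation[of "\<lambda>z. g z - F z" slit_plane "range (\<lambda>k. complex_of_real (x (Suc k)))" 1])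
      show "1 islimpt range (\<lambda>k. complex_of_real (x (Suc k)))"
        unfolding islimpt_sequential
      proof (intro exI conjI allI)
        have "complex_of_real (x (Suc k)) \<noteq> 1" for k
        proof -
          have "x (Suc k) \<noteq> 1" by (simp add: x_def)
          then show ?thesis by (metis of_real_eq_1_iff)
        qed
        then show "complex_of_real (x (Suc k)) \<in> range (\<lambda>k. complex_of_real (x (Suc k))) - {1}" for k by auto
        have "(\<lambda>k. x (Suc k)) \<longlonglongrightarrow> 1 + 0"
          unfolding x_def using LIMSEQ_inverse_real_of_nat by (intro tendsto_intros) (simp add: inverse_eq_divide)
        then have "(\<lambda>k. complex_of_real (x (Suc k))) \<longlonglongrightarrow> complex_of_real (1 + 0)" by (rule tendsto_of_real)
        then show "(\<lambda>k. complex_of_real (x (Suc k))) \<longlonglongrightarrow> 1" by simp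
      qed
    qed (use g F z slit eq open_slit_plane connected_slit_plane in \<open>auto intro!: holomorphic_intros simp: mem_slit_plane_iff\<close>)
    then show ?thesis by simp
  qed
  have "uniform_limit K (\<lambda>k. hcomb (Suc (r k)) (w (r k)) (t (r k))) F sequentially" if K: "compact K" "K \<subseteq> slit_plane" for K
  proof -
    have "uniform_limit K (\<F> \<circ> r) F sequentially"
      using uniform_limit_cong'[of K "\<F> \<circ> r" "\<F> \<circ> r" g F sequentially] gF K(2) ulim[OF K] by blast
    then show ?thesis by (simp add: \<F>_def o_def)
  qed
  with wt show ?thesis using that[of "\<lambda>k. Suc (r k)" "\<lambda>k. w (r k)" "\<lambda>k. t (r k)"] by blast
qed

subsection \<open>Sectorial matrices\<close>

definition re_part :: "complex mat \<Rightarrow> complex mat" where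
  "re_part A = (1/2 :: complex) \<cdot>\<^sub>m (A + mat_adjoint A)"

text \<open>Used with T = tan \<alpha>. The weak inequalities, required for all vectors instead of
  unit vectors, make this a convex cone, so it is stable under sums and under averaging over
  t.\<close>

definition sectorial :: "nat \<Rightarrow> real \<Rightarrow> complex mat \<Rightarrow> bool" where
  "sectorial n T A \<longleftrightarrow> A \<in> carrier_mat n n \<and>
    (\<forall>x\<in>carrier_vec n. 0 \<le> Re (cinner x (A *\<^sub>v x)) \<and>
      \<bar>Im (cinner x (A *\<^sub>v x))\<bar> \<le> T * Re (cinner x (A *\<^sub>v x)))"

lemma re_part_carrier[simp]: "A \<in> carrier_mat n n \<Longrightarrow> re_part A \<in> carrier_mat n n"
  by (auto simp: re_part_def)

lemma re_part_adjoint: "A \<in> carrier_mat n n \<Longrightarrow> mat_adjoint (re_part A) = re_part A"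
  unfolding re_part_def by (rule eq_matI) (auto simp: add.commute)

lemma cinner_cnj:
  "\<lbrakk>x \<in> carrier_vec n; y \<in> carrier_vec n\<rbrakk> \<Longrightarrow> cinner y x = cnj (cinner x y)"
  by (rule cinner_commute) (simp only: carrier_vecD)

lemma cinner_lincomb_right:
  assumes "x \<in> carrier_vec n" "y \<in> carrier_vec n" "z \<in> carrier_vec n"
  shows "cinner x (a \<cdot>\<^sub>v y + b \<cdot>\<^sub>v z) = a * cinner x y + b * cinner x z"
  using assms by (simp add: cinner_add_right[of _ n] cinner_smult_right[of _ n])

lemma cinner_lincomb_left:
  assumes "x \<in> carrier_vec n" "y \<in> carrier_vec n" "z \<in> carrier_vec n"
  shows "cinner (a \<cdot>\<^sub>v y + b \<cdot>\<^sub>v z) x = cnj a * cinner y x + cnj b * cinner z x"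
  using assms by (simp add: cinner_add_left[of _ n] cinner_smult_left[of _ n])

lemma mat_vec_lincomb:
  assumes "(A :: complex mat) \<in> carrier_mat n n" "y \<in> carrier_vec n" "z \<in> carrier_vec n"
  shows "A *\<^sub>v (a \<cdot>\<^sub>v y + b \<cdot>\<^sub>v z) = a \<cdot>\<^sub>v (A *\<^sub>v y) + b \<cdot>\<^sub>v (A *\<^sub>v z)"
  using assms by (simp add: mult_add_distrib_mat_vec[of _ n n] mult_mat_vec[of _ n n])

lemma smult_mat_vec:
  assumes "(A :: complex mat) \<in> carrier_mat n m" "y \<in> carrier_vec m"
  shows "(a \<cdot>\<^sub>m A) *\<^sub>v y = a \<cdot>\<^sub>v (A *\<^sub>v y)"
  using assms by (intro eq_vecI) (auto simp: scalar_prod_def sum_distrib_left ac_simps)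

lemma mat_lincomb_vec:
  assumes "(A :: complex mat) \<in> carrier_mat n n" "B \<in> carrier_mat n n" "y \<in> carrier_vec n"
  shows "(a \<cdot>\<^sub>m A + b \<cdot>\<^sub>m B) *\<^sub>v y = a \<cdot>\<^sub>v (A *\<^sub>v y) + b \<cdot>\<^sub>v (B *\<^sub>v y)"
  using assms by (simp add: add_mult_distrib_mat_vec[of _ n n] smult_mat_vec[of _ n n])

text \<open>Polarisation. The coefficient 1 in front of q gives the vector the shape required by the
  lemmas on linear combinations.\<close>

lemma form_expand:
  assumes A: "A \<in> carrier_mat n n" and q: "q \<in> carrier_vec n" and p: "p \<in> carrier_vec n"
  shows "cinner (1 \<cdot>\<^sub>v q + c \<cdot>\<^sub>v p) (A *\<^sub>v (1 \<cdot>\<^sub>v q + c \<cdot>\<^sub>v p)) =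
    cinner q (A *\<^sub>v q) + c * cinner q (A *\<^sub>v p) + cnj c * cinner p (A *\<^sub>v q) + (cmod c)\<^sup>2 * cinner p (A *\<^sub>v p)"
proof -
  note [simp] = mult_mat_vec_carrier[OF A q] mult_mat_vec_carrier[OF A p]
  have cc: "complex_of_real ((cmod c)\<^sup>2) = c * cnj c" using complex_norm_square[of c] by simp
  have c: "1 \<cdot>\<^sub>v (A *\<^sub>v q) + c \<cdot>\<^sub>v (A *\<^sub>v p) \<in> carrier_vec n" by simp
  show ?thesis
    unfolding mat_vec_lincomb[OF A q p] cinner_lincomb_left[OF c q p]
      cinner_lincomb_right[OF q mult_mat_vec_carrier[OF A q] mult_mat_vec_carrier[OF A p]]
      cinner_lincomb_right[OF p mult_mat_vec_carrier[OF A q] mult_mat_vec_carrier[OF A p]]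
    unfolding cc by (simp add: algebra_simps)
qed

lemma cinner_hermitian:
  assumes A: "A \<in> carrier_mat n n" "mat_adjoint A = A" and x: "x \<in> carrier_vec n" "y \<in> carrier_vec n"
  shows "cinner (A *\<^sub>v x) y = cinner x (A *\<^sub>v y)"
  using cinner_adjoint[OF A(1) x] A(2) by simp

lemma cinner_hermitian_cnj:
  assumes A: "A \<in> carrier_mat n n" "mat_adjoint A = A" and x: "x \<in> carrier_vec n" "y \<in> carrier_vec n"
  shows "cinner y (A *\<^sub>v x) = cnj (cinner x (A *\<^sub>v y))"
proof -
  have "cinner y (A *\<^sub>v x) = cnj (cinner (A *\<^sub>v x) y)"
    by (rule cinner_commute) (use mult_mat_vec_carrier[OF A(1)] x A in auto)
  then show ?thesis using cinner_hermitian[OF A x] by simp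
qed

lemma cinner_re_part:
  assumes A: "A \<in> carrier_mat n n" and x: "x \<in> carrier_vec n"
  shows "cinner x (re_part A *\<^sub>v x) = complex_of_real (Re (cinner x (A *\<^sub>v x)))"
proof -
  have Ax: "A *\<^sub>v x \<in> carrier_vec n" and A'x: "mat_adjoint A *\<^sub>v x \<in> carrier_vec n"
    by (rule mult_mat_vec_carrier[OF A x], rule mult_mat_vec_carrier[OF mat_adjoint_carrier[OF A] x])
  have "re_part A = (1/2 :: complex) \<cdot>\<^sub>m A + (1/2) \<cdot>\<^sub>m mat_adjoint A"
    unfolding re_part_def by (rule eq_matI) (use A in auto)
  then have "re_part A *\<^sub>v x = (1/2) \<cdot>\<^sub>v (A *\<^sub>v x) + (1/2) \<cdot>\<^sub>v (mat_adjoint A *\<^sub>v x)"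
    using mat_lincomb_vec[OF A mat_adjoint_carrier[OF A] x] by simp
  then have "cinner x (re_part A *\<^sub>v x) = (1/2) * cinner x (A *\<^sub>v x) + (1/2) * cinner x (mat_adjoint A *\<^sub>v x)"
    using cinner_lincomb_right[OF x Ax A'x] by simp
  moreover have "cinner x (mat_adjoint A *\<^sub>v x) = cnj (cinner x (A *\<^sub>v x))"
  proof -
    have "cinner x (mat_adjoint A *\<^sub>v x) = cinner (A *\<^sub>v x) x"
      using cinner_adjoint[OF mat_adjoint_carrier[OF A] x x] by simp
    also have "\<dots> = cnj (cinner x (A *\<^sub>v x))" by (rule cinner_commute) (use A x in auto)
    finally show ?thesis .
  qed
  ultimately show ?thesis by (simp add: complex_eq_iff)
qed

lemma ex_unit_phase: "\<exists>u. cmod u = 1 \<and> u * z = complex_of_real (cmod z)"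
proof (cases "z = 0")
  case False
  let ?u = "cnj z / complex_of_real (cmod z)"
  have "cmod ?u = 1" using False by (simp add: norm_divide)
  moreover have "?u * z = complex_of_real (cmod z)"
  proof -
    have "cnj z * z = complex_of_real (cmod z) * complex_of_real (cmod z)"
      using complex_norm_square[of z] by (simp add: power2_eq_square mult.commute)
    then show ?thesis using False by simp
  qed
  ultimately show ?thesis by blast
qed (auto intro: exI[of _ 1])

text \<open>For a = <q, M p> and b = <p, M q>, the numbers \<open>p\<close> and \<open>m\<close> are
  twice the off-diagonal values of T Re M + Im M and of T Re M - Im M. A suitable phase u turns the
  hypotheses into bounds on their moduli. Then a is recovered from (T - i) p - (T + i) m, both
  coefficients have modulus sqrt(1 + T^2), and Im \<Sigma> cancels in the sum of the bounds.\<close>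

lemma sector_cauchy_schwarz_scalar:
  fixes a b \<Sigma> :: complex and T :: real
  assumes T: "T > 0"
    and plus: "\<And>u. cmod u = 1 \<Longrightarrow> Re ((complex_of_real T - \<i>) * (u * a + cnj u * b)) \<le> T * Re \<Sigma> + Im \<Sigma>"
    and minus: "\<And>u. cmod u = 1 \<Longrightarrow> Re ((complex_of_real T + \<i>) * (u * a + cnj u * b)) \<le> T * Re \<Sigma> - Im \<Sigma>"
  shows "cmod a \<le> sqrt (1 + T\<^sup>2) / 2 * Re \<Sigma>"
proof -
  let ?T = "complex_of_real T"
  define p where "p = (?T - \<i>) * a + (?T + \<i>) * cnj b"
  define m where "m = (?T + \<i>) * a + (?T - \<i>) * cnj b"
  have p: "cmod p \<le> T * Re \<Sigma> + Im \<Sigma>"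
  proof -
    obtain u where u: "cmod u = 1" "u * p = complex_of_real (cmod p)" using ex_unit_phase by blast
    have "cmod p = Re (u * p)" using u(2) by simp
    also have "\<dots> = Re ((?T - \<i>) * (u * a + cnj u * b))" unfolding p_def by (simp add: algebra_simps)
    finally show ?thesis using plus[OF u(1)] by simp
  qed
  have m: "cmod m \<le> T * Re \<Sigma> - Im \<Sigma>"
  proof -
    obtain u where u: "cmod u = 1" "u * m = complex_of_real (cmod m)" using ex_unit_phase by blast
    have "cmod m = Re (u * m)" using u(2) by simp
    also have "\<dots> = Re ((?T + \<i>) * (u * a + cnj u * b))" unfolding m_def by (simp add: algebra_simps)
    finally show ?thesis using minus[OF u(1)] by simp
  qed
  have k: "cmod (?T - \<i>) = sqrt (1 + T\<^sup>2)" "cmod (?T + \<i>) = sqrt (1 + T\<^sup>2)"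
    by (simp_all add: cmod_def add.commute)
  have "(?T - \<i>) * p - (?T + \<i>) * m = - (4 * \<i> * ?T) * a"
    unfolding p_def m_def by (simp add: algebra_simps)
  then have "4 * T * cmod a = cmod ((?T - \<i>) * p - (?T + \<i>) * m)" using T by (simp add: norm_mult)
  also have "\<dots> \<le> sqrt (1 + T\<^sup>2) * cmod p + sqrt (1 + T\<^sup>2) * cmod m"
    using norm_triangle_ineq4[of "(?T - \<i>) * p" "(?T + \<i>) * m"] by (simp add: norm_mult k)
  also have "\<dots> \<le> sqrt (1 + T\<^sup>2) * (T * Re \<Sigma> + Im \<Sigma>) + sqrt (1 + T\<^sup>2) * (T * Re \<Sigma> - Im \<Sigma>)"
    by (intro add_mono mult_left_mono p m) auto
  also have "\<dots> = 4 * T * (sqrt (1 + T\<^sup>2) / 2 * Re \<Sigma>)" by (simp add: algebra_simps)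
  finally show ?thesis using T by (simp add: mult.commute)
qed

text \<open>For \<open>T > 0\<close> the forms \<open>T Re M \<plusminus> Im M\<close> are positive semidefinite and \<open>M\<close> is a combination of them; \<open>T = 0\<close> is a limit.\<close>

lemma sectorial_cauchy_schwarz:
  assumes M: "sectorial n T M" and T: "T \<ge> 0" and q: "q \<in> carrier_vec n" and p: "p \<in> carrier_vec n"
  shows "cmod (cinner q (M *\<^sub>v p)) \<le> sqrt (1 + T\<^sup>2) / 2 * (Re (cinner q (M *\<^sub>v q)) + Re (cinner p (M *\<^sub>v p)))"
proof -
  have Mc: "M \<in> carrier_mat n n" using M by (simp add: sectorial_def)
  have sec: "0 \<le> Re (cinner x (M *\<^sub>v x))" "\<bar>Im (cinner x (M *\<^sub>v x))\<bar> \<le> T * Re (cinner x (M *\<^sub>v x))" if "x \<in> carrier_vec n" for x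
    using M that unfolding sectorial_def by blast+
  let ?a = "cinner q (M *\<^sub>v p)" and ?b = "cinner p (M *\<^sub>v q)"
  let ?S = "cinner q (M *\<^sub>v q) + cinner p (M *\<^sub>v p)"
  have *: "cmod ?a \<le> sqrt (1 + T'\<^sup>2) / 2 * Re ?S" if T': "T' > T" for T'
  proof (rule sector_cauchy_schwarz_scalar)
    show pos: "T' > 0" using T T' by simp
    have key: "\<bar>Im ?S - Im (u * ?a + cnj u * ?b)\<bar> \<le> T' * (Re ?S - Re (u * ?a + cnj u * ?b))" if u: "cmod u = 1" for u
    proof -
      let ?x = "1 \<cdot>\<^sub>v q + (- u) \<cdot>\<^sub>v p"
      have x: "?x \<in> carrier_vec n" using q p by simp
      have e: "cinner ?x (M *\<^sub>v ?x) = ?S - (u * ?a + cnj u * ?b)"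
        unfolding form_expand[OF Mc q p] using u by (simp add: algebra_simps)
      have "\<bar>Im (cinner ?x (M *\<^sub>v ?x))\<bar> \<le> T' * Re (cinner ?x (M *\<^sub>v ?x))"
        using sec[OF x] mult_right_mono[OF less_imp_le[OF T'] sec(1)[OF x]] by linarith
      then show ?thesis unfolding e by simp
    qed
    show "Re ((complex_of_real T' - \<i>) * (u * ?a + cnj u * ?b)) \<le> T' * Re ?S + Im ?S" if "cmod u = 1" for u
      using key[OF that] pos by (simp add: algebra_simps abs_le_iff)
    show "Re ((complex_of_real T' + \<i>) * (u * ?a + cnj u * ?b)) \<le> T' * Re ?S - Im ?S" if "cmod u = 1" for u
      using key[OF that] pos by (simp add: algebra_simps abs_le_iff)
  qed
  have "(\<lambda>k. sqrt (1 + (T + 1 / real (Suc k))\<^sup>2) / 2 * Re ?S) \<longlonglongrightarrow> sqrt (1 + (T + 0)\<^sup>2) / 2 * Re ?S"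
    using LIMSEQ_inverse_real_of_nat by (intro tendsto_intros) (auto simp: inverse_eq_divide)
  then have "cmod ?a \<le> sqrt (1 + (T + 0)\<^sup>2) / 2 * Re ?S"
    by (rule LIMSEQ_le_const) (intro exI[of _ 0] allI impI *, simp)
  then show ?thesis by simp
qed

text \<open>\<open>hmat n t A\<close> is the value at \<open>A\<close> of the function \<open>x \<mapsto> x / ((1 - t) x + t)\<close>.\<close>

definition qmat :: "nat \<Rightarrow> real \<Rightarrow> complex mat \<Rightarrow> complex mat" where
  "qmat n t A = (1 - complex_of_real t) \<cdot>\<^sub>m A + complex_of_real t \<cdot>\<^sub>m 1\<^sub>m n"

definition hmat :: "nat \<Rightarrow> real \<Rightarrow> complex mat \<Rightarrow> complex mat" where
  "hmat n t A = A * minv n (qmat n t A)"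

lemma qmat_carrier[simp]: "A \<in> carrier_mat n n \<Longrightarrow> qmat n t A \<in> carrier_mat n n"
  by (simp add: qmat_def)

lemma qmat_vec:
  assumes "A \<in> carrier_mat n n" "w \<in> carrier_vec n"
  shows "qmat n t A *\<^sub>v w = (1 - complex_of_real t) \<cdot>\<^sub>v (A *\<^sub>v w) + complex_of_real t \<cdot>\<^sub>v w"
  unfolding qmat_def using mat_lincomb_vec[OF assms(1) one_carrier_mat assms(2)] assms(2) by simp

section \<open>Accretive matrices under the functions h_t\<close>

definition accretive_form :: "nat \<Rightarrow> complex mat \<Rightarrow> bool" where
  "accretive_form n A \<longleftrightarrow> A \<in> carrier_mat n n \<and>
    (\<forall>x\<in>carrier_vec n. x \<noteq> 0\<^sub>v n \<longrightarrow> Re (cinner x (A *\<^sub>v x)) > 0)"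

lemma accretive_formD:
  assumes "accretive_form n A"
  shows "A \<in> carrier_mat n n" "x \<in> carrier_vec n \<Longrightarrow> 0 \<le> Re (cinner x (A *\<^sub>v x))"
proof -
  show A: "A \<in> carrier_mat n n" using assms by (simp add: accretive_form_def)
  show "0 \<le> Re (cinner x (A *\<^sub>v x))" if x: "x \<in> carrier_vec n"
  proof (cases "x = 0\<^sub>v n")
    case True
    then show ?thesis by (simp add: cinner_def)
  qed (use assms x in \<open>auto simp: accretive_form_def less_imp_le\<close>)
qed

lemma accretive_form_re_part:
  assumes "accretive_form n A" shows "accretive_form n (re_part A)"
  using assms cinner_re_part[of A n] by (auto simp: accretive_form_def)

lemma accretive_form_det:
  assumes "accretive_form n A" shows "Determinant.det A \<noteq> 0"
proof
  assume "Determinant.det A = 0"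
  then obtain v where v: "v \<in> carrier_vec n" "v \<noteq> 0\<^sub>v n" "A *\<^sub>v v = 0\<^sub>v n"
    using det_0_iff_vec_prod_zero[OF accretive_formD(1)[OF assms]] by auto
  then have "cinner v (A *\<^sub>v v) = 0" by (simp add: cinner_def)
  then show False using assms v by (force simp: accretive_form_def)
qed

lemma accretive_form_one: "accretive_form n (1\<^sub>m n)"
proof -
  have "Re (cinner x x) > 0" if x: "x \<in> carrier_vec n" "x \<noteq> 0\<^sub>v n" for x
  proof -
    obtain k where k: "k < n" "x $ k \<noteq> 0" using x by (metis eq_vecI carrier_vecD index_zero_vec)
    have "0 < (cmod (x $ k))\<^sup>2" using k by simp
    also have "\<dots> \<le> (\<Sum>i<n. (cmod (x $ i))\<^sup>2)" using k by (intro member_le_sum) auto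
    finally show ?thesis using x by (simp add: cinner_self)
  qed
  then show ?thesis by (auto simp: accretive_form_def)
qed

lemma accretive_form_qmat:
  assumes A: "accretive_form n A" and t: "0 \<le> t" "t \<le> 1"
  shows "accretive_form n (qmat n t A)"
  unfolding accretive_form_def
proof (intro conjI ballI impI)
  note Ac = accretive_formD(1)[OF A]
  show "qmat n t A \<in> carrier_mat n n" using Ac by simp
  fix x :: "complex Matrix.vec" assume x: "x \<in> carrier_vec n" "x \<noteq> 0\<^sub>v n"
  have Ax: "A *\<^sub>v x \<in> carrier_vec n" by (rule mult_mat_vec_carrier[OF Ac x(1)])
  have "cinner x (qmat n t A *\<^sub>v x) = (1 - complex_of_real t) * cinner x (A *\<^sub>v x) + complex_of_real t * cinner x x"
    unfolding qmat_vec[OF Ac x(1)] by (rule cinner_lincomb_right[OF x(1) Ax x(1)])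
  then have e: "Re (cinner x (qmat n t A *\<^sub>v x)) = (1 - t) * Re (cinner x (A *\<^sub>v x)) + t * Re (cinner x x)" by simp
  have 1: "Re (cinner x (A *\<^sub>v x)) > 0" "Re (cinner x x) > 0"
    using A accretive_form_one[of n] x by (auto simp: accretive_form_def)
  show "0 < Re (cinner x (qmat n t A *\<^sub>v x))"
  proof (cases "t = 0")
    case False
    then have "t * Re (cinner x x) > 0" "(1 - t) * Re (cinner x (A *\<^sub>v x)) \<ge> 0" using t 1 by auto
    then show ?thesis unfolding e by linarith
  qed (use e 1 in simp)
qed

lemma
  assumes A: "accretive_form n A" and t: "0 \<le> t" "t \<le> 1"
  shows minv_qmat: "minv n (qmat n t A) \<in> carrier_mat n n" "qmat n t A * minv n (qmat n t A) = 1\<^sub>m n"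
    and hmat_carrier: "hmat n t A \<in> carrier_mat n n"
proof -
  note d = accretive_form_det[OF accretive_form_qmat[OF A t]]
  note Ac = accretive_formD(1)[OF A]
  show 1: "minv n (qmat n t A) \<in> carrier_mat n n" "qmat n t A * minv n (qmat n t A) = 1\<^sub>m n"
    using minv_inverse[OF qmat_carrier[OF Ac] d] by auto
  show "hmat n t A \<in> carrier_mat n n" unfolding hmat_def by (rule mult_carrier_mat[OF Ac 1(1)])
qed

text \<open>Trades the inverse for a vector: with x = (1 - t) A w + t w one gets <x, h_t(A) x> = (1
  - t) |A w|^2 + t <w, A w>, where only A itself occurs.\<close>

lemma hmat_solve:
  assumes A: "accretive_form n A" and t: "0 \<le> t" "t \<le> 1" and x: "x \<in> carrier_vec n"
  obtains w where "w \<in> carrier_vec n" "(1 - complex_of_real t) \<cdot>\<^sub>v (A *\<^sub>v w) + complex_of_real t \<cdot>\<^sub>v w = x"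
    "hmat n t A *\<^sub>v x = A *\<^sub>v w"
proof -
  note Ac = accretive_formD(1)[OF A] and R = minv_qmat[OF A t]
  let ?w = "minv n (qmat n t A) *\<^sub>v x"
  have w: "?w \<in> carrier_vec n" by (rule mult_mat_vec_carrier[OF R(1) x])
  have "qmat n t A *\<^sub>v ?w = x"
    using assoc_mult_mat_vec[OF qmat_carrier[OF Ac, of t] R(1) x] R(2) x by simp
  moreover have "hmat n t A *\<^sub>v x = A *\<^sub>v ?w"
    unfolding hmat_def by (rule assoc_mult_mat_vec[OF Ac R(1) x])
  ultimately show ?thesis using that[OF w] qmat_vec[OF Ac w] by metis
qed

lemma re_cinner_le:
  assumes "x \<in> carrier_vec n" "y \<in> carrier_vec n"
  shows "2 * Re (cinner x y) \<le> Re (cinner x x) + Re (cinner y y)"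
proof -
  have "0 \<le> Re (cinner (1 \<cdot>\<^sub>v x + (-1) \<cdot>\<^sub>v y) (1\<^sub>m n *\<^sub>v (1 \<cdot>\<^sub>v x + (-1) \<cdot>\<^sub>v y)))"
    by (rule accretive_formD(2)[OF accretive_form_one]) (use assms in auto)
  moreover have "cinner y x = cnj (cinner x y)" by (rule cinner_cnj[of _ n]) (use assms in auto)
  ultimately show ?thesis unfolding form_expand[OF one_carrier_mat assms] using assms by simp
qed

lemma hermitian_form_le:
  assumes H: "accretive_form n H" "mat_adjoint H = H" and x: "x \<in> carrier_vec n" "y \<in> carrier_vec n"
  shows "2 * Re (cinner x (H *\<^sub>v y)) \<le> Re (cinner x (H *\<^sub>v x)) + Re (cinner y (H *\<^sub>v y))"
proof -
  note Hc = accretive_formD(1)[OF H(1)]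
  have "0 \<le> Re (cinner (1 \<cdot>\<^sub>v x + (-1) \<cdot>\<^sub>v y) (H *\<^sub>v (1 \<cdot>\<^sub>v x + (-1) \<cdot>\<^sub>v y)))"
    by (rule accretive_formD(2)[OF H(1)]) (use x in auto)
  moreover have "cinner y (H *\<^sub>v x) = cnj (cinner x (H *\<^sub>v y))" by (rule cinner_hermitian_cnj[OF Hc H(2) x])
  ultimately show ?thesis unfolding form_expand[OF Hc x] by simp
qed

text \<open>Let H = Re A, a = A w and h = H w' for the two solutions attached to the same x. The
  sector survives because |A w|^2 is real. For the lower bound <x, h> is expanded through w, for the
  upper bound <x, a> through w'. Each mixed term is at most half the sum of two pure ones, and one
  of the two forms is then absorbed by the left side. The factor 1 + T^2 comes from <w', A w>, the
  mixed term in which A is not Hermitian.\<close>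

lemma hmat_forms:
  assumes A: "accretive_form n A" and sA: "sectorial n T A" and T: "T \<ge> 0" and t: "0 \<le> t" "t \<le> 1"
    and x: "x \<in> carrier_vec n"
  shows hmat_re_part_le: "Re (cinner x (hmat n t (re_part A) *\<^sub>v x)) \<le> Re (cinner x (hmat n t A *\<^sub>v x))"
    and hmat_le_re_part: "Re (cinner x (hmat n t A *\<^sub>v x)) \<le> (1 + T\<^sup>2) * Re (cinner x (hmat n t (re_part A) *\<^sub>v x))"
    and hmat_sector: "0 \<le> Re (cinner x (hmat n t A *\<^sub>v x))"
      "\<bar>Im (cinner x (hmat n t A *\<^sub>v x))\<bar> \<le> T * Re (cinner x (hmat n t A *\<^sub>v x))"
proof -
  let ?H = "re_part A"
  have H: "accretive_form n ?H" by (rule accretive_form_re_part[OF A])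
  note Ac = accretive_formD(1)[OF A] and Hc = accretive_formD(1)[OF H]
  note hH = re_part_adjoint[OF Ac]
  obtain w where w: "w \<in> carrier_vec n" "(1 - complex_of_real t) \<cdot>\<^sub>v (A *\<^sub>v w) + complex_of_real t \<cdot>\<^sub>v w = x"
    and hA: "hmat n t A *\<^sub>v x = A *\<^sub>v w" using hmat_solve[OF A t x] by blast
  obtain w' where w': "w' \<in> carrier_vec n" "(1 - complex_of_real t) \<cdot>\<^sub>v (?H *\<^sub>v w') + complex_of_real t \<cdot>\<^sub>v w' = x"
    and hHx: "hmat n t ?H *\<^sub>v x = ?H *\<^sub>v w'" using hmat_solve[OF H t x] by blast
  let ?a = "A *\<^sub>v w" and ?h = "?H *\<^sub>v w'"
  have a: "?a \<in> carrier_vec n" and h: "?h \<in> carrier_vec n"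
    by (rule mult_mat_vec_carrier[OF Ac w(1)], rule mult_mat_vec_carrier[OF Hc w'(1)])
  have xa: "cinner x v = (1 - complex_of_real t) * cinner ?a v + complex_of_real t * cinner w v" if "v \<in> carrier_vec n" for v
    using cinner_lincomb_left[OF that a w(1), of "1 - complex_of_real t" "complex_of_real t"] unfolding w(2) by simp
  have xh: "cinner x v = (1 - complex_of_real t) * cinner ?h v + complex_of_real t * cinner w' v" if "v \<in> carrier_vec n" for v
    using cinner_lincomb_left[OF that h w'(1), of "1 - complex_of_real t" "complex_of_real t"] unfolding w'(2) by simp
  have self: "cinner v v = complex_of_real (Re (cinner v v))" for v by (simp add: cinner_self)
  have reA: "cinner w (?H *\<^sub>v w) = complex_of_real (Re (cinner w ?a))" by (rule cinner_re_part[OF Ac w(1)])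
  define p q r where "p = Re (cinner ?a ?a)" "q = Re (cinner w ?a)" "r = Re (cinner ?h ?h)"
  note pqr = this
  define s where "s = Re (cinner w' ?h)"
  have qA: "Re (cinner x (hmat n t A *\<^sub>v x)) = (1 - t) * p + t * q"
    unfolding hA xa[OF a] pqr by simp
  have imA: "Im (cinner x (hmat n t A *\<^sub>v x)) = t * Im (cinner w ?a)"
    unfolding hA xa[OF a] by (simp add: cinner_self[of ?a])
  have qH: "Re (cinner x (hmat n t ?H *\<^sub>v x)) = (1 - t) * r + t * s"
    unfolding hHx xh[OF h] pqr s_def by simp
  have secw: "0 \<le> q" "\<bar>Im (cinner w ?a)\<bar> \<le> T * q" using sA w(1) by (auto simp: sectorial_def pqr)
  have p0: "p \<ge> 0" unfolding pqr by (simp add: cinner_self sum_nonneg)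
  show "0 \<le> Re (cinner x (hmat n t A *\<^sub>v x))"
    unfolding qA using p0 secw t by simp
  show "\<bar>Im (cinner x (hmat n t A *\<^sub>v x))\<bar> \<le> T * Re (cinner x (hmat n t A *\<^sub>v x))"
  proof -
    have "\<bar>Im (cinner x (hmat n t A *\<^sub>v x))\<bar> = t * \<bar>Im (cinner w ?a)\<bar>" unfolding imA using t by (simp add: abs_mult)
    also have "\<dots> \<le> t * (T * q)" using secw t by (intro mult_left_mono) auto
    also have "\<dots> \<le> T * ((1 - t) * p + t * q)"
    proof -
      have "t * q \<le> (1 - t) * p + t * q" using p0 t by simp
      from mult_left_mono[OF this T] show ?thesis by (simp add: ac_simps)
    qed
    finally show ?thesis unfolding qA .
  qed
  show "Re (cinner x (hmat n t ?H *\<^sub>v x)) \<le> Re (cinner x (hmat n t A *\<^sub>v x))"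
  proof -
    have "cinner ?h x = cnj (cinner x ?h)" by (rule cinner_cnj[of _ n]) (use x h in auto)
    then have "Re (cinner x ?h) = (1 - t) * r + t * s" using qH hHx by simp
    moreover have "cinner x ?h = (1 - complex_of_real t) * cinner ?a ?h + complex_of_real t * cinner w ?h" by (rule xa[OF h])
    ultimately have e: "(1 - t) * Re (cinner ?a ?h) + t * Re (cinner w ?h) = (1 - t) * r + t * s" by simp
    have "2 * Re (cinner ?a ?h) \<le> p + r" using re_cinner_le[OF a h] unfolding pqr .
    then have 1: "(1 - t) * (2 * Re (cinner ?a ?h)) \<le> (1 - t) * (p + r)" using t by (intro mult_left_mono) auto
    have "2 * Re (cinner w ?h) \<le> q + s"
      using hermitian_form_le[OF H hH w(1) w'(1)] unfolding reA pqr s_def by simp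
    then have 2: "t * (2 * Re (cinner w ?h)) \<le> t * (q + s)" using t by (intro mult_left_mono) auto
    show ?thesis unfolding qA qH using 1 2 e by (simp add: algebra_simps)
  qed
  show "Re (cinner x (hmat n t A *\<^sub>v x)) \<le> (1 + T\<^sup>2) * Re (cinner x (hmat n t ?H *\<^sub>v x))"
  proof -
    define \<kappa> where "\<kappa> = sqrt (1 + T\<^sup>2)"
    have k2: "\<kappa>\<^sup>2 = 1 + T\<^sup>2" by (simp add: \<kappa>_def)
    have kpos: "\<kappa> > 0" by (simp add: \<kappa>_def add_pos_nonneg)
    have "Re (cinner x (hmat n t A *\<^sub>v x)) = (1 - t) * Re (cinner ?h ?a) + t * Re (cinner w' ?a)"
      unfolding hA xh[OF a] by simp
    moreover have "2 * Re (cinner ?h ?a) \<le> \<kappa>\<^sup>2 * r + p"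
    proof -
      have "2 * Re (cinner ?h ?a) \<le> r + p" using re_cinner_le[OF h a] unfolding pqr .
      moreover have "T\<^sup>2 * r \<ge> 0" unfolding pqr by (simp add: cinner_self sum_nonneg)
      ultimately show ?thesis unfolding k2 by (simp add: algebra_simps)
    qed
    moreover have "2 * Re (cinner w' ?a) \<le> \<kappa>\<^sup>2 * s + q"
    proof -
      \<comment> \<open>The scaling balances the sectorial Cauchy-Schwarz inequality: the factor
        \<kappa> in front cancels, and the form of w' acquires \<kappa>^2.\<close>
      let ?v = "complex_of_real \<kappa> \<cdot>\<^sub>v w'"
      have v: "?v \<in> carrier_vec n" using w'(1) by simp
      have Aw': "A *\<^sub>v w' \<in> carrier_vec n" by (rule mult_mat_vec_carrier[OF Ac w'(1)])
      have "cmod (cinner ?v ?a) \<le> \<kappa> / 2 * (Re (cinner ?v (A *\<^sub>v ?v)) + q)"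
        using sectorial_cauchy_schwarz[OF sA T v w(1)] unfolding \<kappa>_def pqr .
      moreover have "cinner ?v ?a = \<kappa> * cinner w' ?a" using cinner_smult_left[OF a w'(1)] by simp
      moreover have "cinner ?v (A *\<^sub>v ?v) = complex_of_real (\<kappa> * \<kappa>) * cinner w' (A *\<^sub>v w')"
        unfolding mult_mat_vec[OF Ac w'(1)] using cinner_smult_left[OF _ w'(1)] cinner_smult_right[OF w'(1) Aw'] Aw' by simp
      moreover have "Re (cinner w' (A *\<^sub>v w')) = s" using cinner_re_part[OF Ac w'(1)] unfolding s_def by simp
      ultimately have "\<kappa> * cmod (cinner w' ?a) \<le> \<kappa> / 2 * (\<kappa>\<^sup>2 * s + q)"
        using kpos by (simp add: norm_mult power2_eq_square)
      then have "2 * cmod (cinner w' ?a) \<le> \<kappa>\<^sup>2 * s + q" using kpos by simp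
      then show ?thesis using complex_Re_le_cmod[of "cinner w' ?a"] by linarith
    qed
    ultimately have "2 * Re (cinner x (hmat n t A *\<^sub>v x)) \<le> (1 - t) * (\<kappa>\<^sup>2 * r + p) + t * (\<kappa>\<^sup>2 * s + q)"
      using t mult_left_mono[of "2 * Re (cinner ?h ?a)" _ "1 - t"] mult_left_mono[of "2 * Re (cinner w' ?a)" _ t] by fastforce
    then show ?thesis unfolding qA qH k2 by (simp add: algebra_simps)
  qed
qed

subsection \<open>Trace inequalities\<close>

text \<open>By Abel summation it suffices to compare partial sums, that is, to see that y = d b is
  majorised by b. In the k-th partial sum the entries of b carry weights in [0, 1] of total k + 1,
  and the value is largest when these sit on the k + 1 largest entries.\<close>

lemma rearrangement_doubly_stochastic:
  fixes a b :: "nat \<Rightarrow> real" and d :: "nat \<Rightarrow> nat \<Rightarrow> real"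
  assumes a: "\<And>i j. i \<le> j \<Longrightarrow> j < n \<Longrightarrow> a j \<le> a i" and b: "\<And>i j. i \<le> j \<Longrightarrow> j < n \<Longrightarrow> b j \<le> b i"
    and a0: "\<And>i. i < n \<Longrightarrow> 0 \<le> a i"
    and d0: "\<And>i j. i < n \<Longrightarrow> j < n \<Longrightarrow> 0 \<le> d i j"
    and row: "\<And>i. i < n \<Longrightarrow> (\<Sum>j<n. d i j) = 1" and col: "\<And>j. j < n \<Longrightarrow> (\<Sum>i<n. d i j) = 1"
  shows "(\<Sum>i<n. a i * (\<Sum>j<n. d i j * b j)) \<le> (\<Sum>i<n. a i * b i)"
proof -
  define y where "y i = (\<Sum>j<n. d i j * b j)" for i
  have partial: "(\<Sum>i\<le>k. y i) \<le> (\<Sum>i\<le>k. b i)" if k: "k < n" for k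
  proof -
    define w where "w j = (\<Sum>i\<le>k. d i j)" for j
    have w1: "w j \<le> 1" "0 \<le> w j" if "j < n" for j
    proof -
      have "w j \<le> (\<Sum>i<n. d i j)" unfolding w_def using k that d0 by (intro sum_mono2) auto
      then show "w j \<le> 1" using col[OF that] by simp
      show "0 \<le> w j" unfolding w_def using k that d0 by (intro sum_nonneg) auto
    qed
    have sw: "(\<Sum>j<n. w j) = real (Suc k)"
    proof -
      have "(\<Sum>j<n. w j) = (\<Sum>i\<le>k. \<Sum>j<n. d i j)" unfolding w_def by (rule sum.swap)
      also have "\<dots> = (\<Sum>i\<le>k. 1)" using row k by (intro sum.cong) auto
      finally show ?thesis by simp
    qed
    have split: "(\<Sum>j<n. g j) = (\<Sum>j\<le>k. g j) + (\<Sum>j\<in>{k<..<n}. g j)" for g :: "nat \<Rightarrow> real"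
      using k by (subst sum.union_disjoint[symmetric]) (auto intro!: sum.cong)
    have "(\<Sum>i\<le>k. y i) = (\<Sum>j<n. b j * w j)"
      unfolding y_def w_def sum_distrib_left by (subst sum.swap) (simp add: mult.commute)
    then have "(\<Sum>i\<le>k. y i) - (\<Sum>i\<le>k. b i) = (\<Sum>j\<le>k. b j * (w j - 1)) + (\<Sum>j\<in>{k<..<n}. b j * w j)"
      unfolding split[of "\<lambda>j. b j * w j"] by (simp add: sum_subtractf right_diff_distrib)
    also have "\<dots> \<le> (\<Sum>j\<le>k. b k * (w j - 1)) + (\<Sum>j\<in>{k<..<n}. b k * w j)"
    proof (intro add_mono sum_mono)
      fix j assume "j \<in> {..k}"
      then have "b k \<le> b j" "w j - 1 \<le> 0" using b[of j k] k w1[of j] by auto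
      then show "b j * (w j - 1) \<le> b k * (w j - 1)" by (rule mult_right_mono_neg)
    next
      fix j assume "j \<in> {k<..<n}"
      then show "b j * w j \<le> b k * w j" using b[of k j] w1[of j] by (intro mult_right_mono) auto
    qed
    also have "\<dots> = b k * ((\<Sum>j<n. w j) - real (Suc k))"
      unfolding split[of w] by (simp add: sum_subtractf sum_distrib_left[symmetric] algebra_simps)
    finally show ?thesis unfolding sw by simp
  qed
  \<comment> \<open>The last difference is a_{n-1} itself, which is where nonnegativity of a
    enters.\<close>
  define c where "c k = a k - (if Suc k < n then a (Suc k) else 0)" for k
  have c0: "0 \<le> c k" if "k < n" for k using a[of k "Suc k"] a0[OF that] by (auto simp: c_def)
  have ac: "a i = (\<Sum>k\<in>{i..<n}. c k)" if "i < n" for i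
  proof -
    define g where "g k = (if k < n then a k else 0)" for k
    have "(\<Sum>k\<in>{i..<n}. c k) = (\<Sum>k\<in>{i..<n}. g k - g (Suc k))"
      by (intro sum.cong) (auto simp: c_def g_def)
    also have "\<dots> = g i - g n" by (subst sum_Suc_diff'[of i n "\<lambda>k. - g k", simplified]) (use that in auto)
    finally show ?thesis using that by (simp add: g_def)
  qed
  have abel: "(\<Sum>i<n. a i * z i) = (\<Sum>k<n. c k * (\<Sum>i\<le>k. z i))" for z
  proof -
    have "(\<Sum>i<n. a i * z i) = (\<Sum>i<n. \<Sum>k<n. if i \<le> k then c k * z i else 0)"
    proof (rule sum.cong[OF refl])
      fix i assume "i \<in> {..<n}"
      then have "a i * z i = (\<Sum>k\<in>{i..<n}. c k * z i)" using ac by (simp add: sum_distrib_right)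
      also have "\<dots> = (\<Sum>k<n. if i \<le> k then c k * z i else 0)"
        by (subst sum.inter_filter[symmetric]) (auto intro!: sum.cong)
      finally show "a i * z i = (\<Sum>k<n. if i \<le> k then c k * z i else 0)" .
    qed
    also have "\<dots> = (\<Sum>k<n. \<Sum>i<n. if i \<le> k then c k * z i else 0)" by (rule sum.swap)
    also have "\<dots> = (\<Sum>k<n. c k * (\<Sum>i\<le>k. z i))"
    proof (rule sum.cong[OF refl])
      fix k assume "k \<in> {..<n}"
      then have "{i\<in>{..<n}. i \<le> k} = {..k}" by auto
      then show "(\<Sum>i<n. if i \<le> k then c k * z i else 0) = c k * (\<Sum>i\<le>k. z i)"
        by (subst sum.inter_filter[symmetric]) (auto simp: sum_distrib_left)
    qed
    finally show ?thesis .
  qed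
  have "(\<Sum>i<n. a i * y i) \<le> (\<Sum>i<n. a i * b i)"
    unfolding abel by (rule sum_mono) (auto intro!: mult_left_mono c0 partial)
  then show ?thesis unfolding y_def .
qed

text \<open>Chebyshev's symmetrisation: by symmetry of \<xi>, twice the difference of the two sides
  is the sum of (s_j - s_k) (d_k - d_j) \<xi>_kj. Each term is nonnegative because s decreases and d
  increases.\<close>

lemma symmetric_kernel_opposite_order:
  fixes s d :: "nat \<Rightarrow> real" and \<xi> :: "nat \<Rightarrow> nat \<Rightarrow> real"
  assumes sym: "\<And>i j. i < n \<Longrightarrow> j < n \<Longrightarrow> \<xi> i j = \<xi> j i" and pos: "\<And>i j. i < n \<Longrightarrow> j < n \<Longrightarrow> 0 \<le> \<xi> i j"
    and s: "\<And>i j. i \<le> j \<Longrightarrow> j < n \<Longrightarrow> s j \<le> s i" and d: "\<And>i j. i \<le> j \<Longrightarrow> j < n \<Longrightarrow> d i \<le> d j"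
  shows "(\<Sum>j<n. s j * (d j * (\<Sum>k<n. \<xi> k j))) \<le> (\<Sum>j<n. s j * (\<Sum>k<n. d k * \<xi> k j))"
proof -
  let ?L = "\<Sum>j<n. \<Sum>k<n. s j * (d k - d j) * \<xi> k j"
  have "?L = (\<Sum>j<n. \<Sum>k<n. s k * (d j - d k) * \<xi> k j)"
    by (subst sum.swap) (intro sum.cong refl, use sym in auto)
  then have "2 * ?L = ?L + (\<Sum>j<n. \<Sum>k<n. s k * (d j - d k) * \<xi> k j)" by simp
  also have "\<dots> = (\<Sum>j<n. \<Sum>k<n. (s j - s k) * (d k - d j) * \<xi> k j)"
    unfolding sum.distrib[symmetric] by (intro sum.cong refl) (simp add: algebra_simps)
  also have "\<dots> \<ge> 0"
  proof (intro sum_nonneg)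
    fix j k assume jk: "j \<in> {..<n}" "k \<in> {..<n}"
    then have q: "0 \<le> (s j - s k) * (d k - d j)"
      using s[of j k] d[of j k] s[of k j] d[of k j]
      by (cases "j \<le> k") (auto intro: mult_nonneg_nonneg mult_nonpos_nonpos)
    show "0 \<le> (s j - s k) * (d k - d j) * \<xi> k j" by (rule mult_nonneg_nonneg[OF q pos]) (use jk in auto)
  qed
  finally have "0 \<le> ?L" by simp
  then show ?thesis by (simp add: sum_distrib_left sum_subtractf algebra_simps)
qed

lemma unitary_cinner:
  assumes U: "unitary_mat n U" and x: "x \<in> carrier_vec n" and y: "y \<in> carrier_vec n"
  shows "cinner (mat_adjoint U *\<^sub>v x) (mat_adjoint U *\<^sub>v y) = cinner x y"
proof -
  note u = unitary_matD[OF U]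
  have "cinner (mat_adjoint U *\<^sub>v x) (mat_adjoint U *\<^sub>v y) = cinner x (U *\<^sub>v (mat_adjoint U *\<^sub>v y))"
    by (rule cinner_adjoint[OF u(1) x]) (rule mult_mat_vec_carrier[OF u(2) y])
  also have "U *\<^sub>v (mat_adjoint U *\<^sub>v y) = y"
    using assoc_mult_mat_vec[OF u(1,2) y] u(4) y by simp
  finally show ?thesis .
qed

lemma psd_sqrt:
  assumes A: "accretive_form n A" and hA: "mat_adjoint A = A"
  obtains X where "X \<in> carrier_mat n n" "mat_adjoint X = X" "X * X = A"
proof -
  note Ac = accretive_formD(1)[OF A]
  obtain V d where V: "unitary_mat n V" and Ad: "A = V * diag_of n (\<lambda>i. complex_of_real (d i)) * mat_adjoint V"
    using hermitian_spectral[OF Ac hA] by metis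
  note v = unitary_matD[OF V]
  have d: "d i \<ge> 0" if "i < n" for i
    using accretive_formD(2)[OF A unitary_col(1)[OF V that]] spectral_form_col[OF V that, of "\<lambda>i. complex_of_real (d i)"]
    unfolding Ad by simp
  define D where "D = diag_of n (\<lambda>i. complex_of_real (sqrt (d i)))"
  have Dc: "D \<in> carrier_mat n n" by (simp add: D_def)
  have hD: "mat_adjoint D = D" unfolding D_def mat_adjoint_diag_of by simp
  have DD: "D * D = diag_of n (\<lambda>i. complex_of_real (d i))"
    unfolding D_def diag_of_mult using d by (auto intro!: eq_matI simp flip: of_real_mult)
  let ?X = "V * D * mat_adjoint V"
  have "mat_adjoint ?X = ?X" by (simp only: mat_adjoint_adjoint sq_mat_simps[where n = n] v(1) Dc hD)
  moreover have "?X * ?X = A"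
  proof -
    have "?X * ?X = V * (D * ((mat_adjoint V * V) * D)) * mat_adjoint V" by (simp only: sq_mat_simps[where n = n] v(1) Dc)
    then show ?thesis unfolding v(3) Ad using Dc DD by simp
  qed
  moreover have "?X \<in> carrier_mat n n" by (simp only: sq_mat_simps[where n = n] v(1) Dc)
  ultimately show ?thesis using that by blast
qed

lemma
  fixes lm :: "nat \<Rightarrow> real"
  assumes U: "unitary_mat n U" and C: "C = U * diag_of n (\<lambda>i. complex_of_real (lm i)) * mat_adjoint U"
    and den: "\<And>i. i < n \<Longrightarrow> (1 - t) * lm i + t > 0"
  shows qmat_unitary_diag: "qmat n t C * (U * diag_of n (\<lambda>i. complex_of_real (1 / ((1 - t) * lm i + t))) * mat_adjoint U) = 1\<^sub>m n"
    and hmat_unitary_diag: "hmat n t C = U * diag_of n (\<lambda>i. complex_of_real (lm i / ((1 - t) * lm i + t))) * mat_adjoint U"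
proof -
  note u = unitary_matD[OF U]
  let ?q = "\<lambda>i. (1 - t) * lm i + t"
  have Cc: "C \<in> carrier_mat n n" unfolding C by (simp only: sq_mat_simps[where n = n] u(1))
  have dm: "(U * diag_of n a * mat_adjoint U) * (U * diag_of n b * mat_adjoint U) = U * diag_of n (\<lambda>i. a i * b i) * mat_adjoint U" for a b
  proof -
    have "(U * diag_of n a * mat_adjoint U) * (U * diag_of n b * mat_adjoint U)
      = U * (diag_of n a * ((mat_adjoint U * U) * diag_of n b)) * mat_adjoint U"
      by (simp only: sq_mat_simps[where n = n] u(1))
    then show ?thesis unfolding u(3) by (simp add: left_mult_one_mat[of _ n n] diag_of_mult)
  qed
  have d1: "U * diag_of n (\<lambda>i. 1) * mat_adjoint U = 1\<^sub>m n"
  proof -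
    have "diag_of n (\<lambda>i. 1) = 1\<^sub>m n" by (rule eq_matI) auto
    then show ?thesis using u by simp
  qed
  have "qmat n t C = U * diag_of n (\<lambda>i. complex_of_real (?q i)) * mat_adjoint U"
  proof (rule eq_matI)
    fix i j assume "i < dim_row (U * diag_of n (\<lambda>i. complex_of_real (?q i)) * mat_adjoint U)" "j < dim_col (U * diag_of n (\<lambda>i. complex_of_real (?q i)) * mat_adjoint U)"
    then have ij: "i < n" "j < n" using u by auto
    have "qmat n t C $$ (i,j) = (1 - complex_of_real t) * C $$ (i,j) + complex_of_real t * (U * diag_of n (\<lambda>i. 1) * mat_adjoint U) $$ (i,j)"
      unfolding d1 qmat_def using ij Cc by auto
    also have "\<dots> = (U * diag_of n (\<lambda>i. complex_of_real (?q i)) * mat_adjoint U) $$ (i,j)"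
      unfolding C conj_diag_index[OF u(1) ij] sum_distrib_left sum.distrib[symmetric]
      by (intro sum.cong refl) (simp add: algebra_simps)
    finally show "qmat n t C $$ (i,j) = (U * diag_of n (\<lambda>i. complex_of_real (?q i)) * mat_adjoint U) $$ (i,j)" .
  qed (use u in \<open>auto simp: qmat_def\<close>)
  note q = this
  have e: "diag_of n (\<lambda>i. complex_of_real (?q i) * complex_of_real (1 / ?q i)) = diag_of n (\<lambda>i. 1)"
  proof (rule eq_matI)
    fix i j assume "i < dim_row (diag_of n (\<lambda>i. 1 :: complex))" "j < dim_col (diag_of n (\<lambda>i. 1 :: complex))"
    then show "diag_of n (\<lambda>i. complex_of_real (?q i) * complex_of_real (1 / ?q i)) $$ (i,j) = diag_of n (\<lambda>i. 1) $$ (i,j)"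
      using den[of i] by (auto simp del: of_real_add simp flip: of_real_mult)
  qed auto
  show 1: "qmat n t C * (U * diag_of n (\<lambda>i. complex_of_real (1 / ?q i)) * mat_adjoint U) = 1\<^sub>m n"
    unfolding q dm e by (rule d1)
  have "minv n (qmat n t C) = U * diag_of n (\<lambda>i. complex_of_real (1 / ?q i)) * mat_adjoint U"
    by (rule minv_eqI[OF qmat_carrier[OF Cc] _ 1]) (simp only: sq_mat_simps[where n = n] u(1))
  then have "hmat n t C = C * (U * diag_of n (\<lambda>i. complex_of_real (1 / ?q i)) * mat_adjoint U)" by (simp add: hmat_def)
  also have "\<dots> = U * diag_of n (\<lambda>i. complex_of_real (lm i / ?q i)) * mat_adjoint U"
    unfolding C dm by simp
  finally show "hmat n t C = U * diag_of n (\<lambda>i. complex_of_real (lm i / ?q i)) * mat_adjoint U" .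
qed

lemma hfun_denom_pos:
  fixes x t :: real
  assumes "0 < x" "0 \<le> t" "t \<le> 1" shows "0 < (1 - t) * x + t"
proof (cases "t = 0")
  case False
  then have "(1 - t) * x \<ge> 0" using assms by simp
  then show ?thesis using False assms by linarith
qed (use assms in auto)

text \<open>With X the square root of A, h_t(A) = X ((1 - t) A + t)^{-1} X, which is at least X ((1
  - t) C + t)^{-1} X because A \<le> C. For \<xi>_kj = |<u_k, X u_j>|^2, the diagonal values of the
  latter are sum_k \<delta>_k \<xi>_kj, and those of A are sum_k \<xi>_kj. Since X is Hermitian,
  \<xi> is symmetric, and the opposite orders of s and \<delta> allow \<delta>_k to be replaced by
  \<delta>_j.\<close>

lemma weighted_trace_hmat:
  fixes s lm :: "nat \<Rightarrow> real"
  assumes A: "accretive_form n A" and hA: "mat_adjoint A = A"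
    and U: "unitary_mat n U" and C: "C = U * diag_of n (\<lambda>i. complex_of_real (lm i)) * mat_adjoint U"
    and AC: "\<And>x. x \<in> carrier_vec n \<Longrightarrow> Re (cinner x (A *\<^sub>v x)) \<le> Re (cinner x (C *\<^sub>v x))"
    and lm: "\<And>i j. i \<le> j \<Longrightarrow> j < n \<Longrightarrow> lm j \<le> lm i" "\<And>i. i < n \<Longrightarrow> 0 < lm i"
    and s: "\<And>i j. i \<le> j \<Longrightarrow> j < n \<Longrightarrow> s j \<le> s i" "\<And>i. i < n \<Longrightarrow> 0 \<le> s i"
    and t: "0 \<le> t" "t \<le> 1"
  shows "(\<Sum>j<n. s j * (Re (cinner (Matrix.col U j) (A *\<^sub>v Matrix.col U j)) / ((1 - t) * lm j + t)))
    \<le> (\<Sum>j<n. s j * Re (cinner (Matrix.col U j) (hmat n t A *\<^sub>v Matrix.col U j)))"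
proof -
  note Ac = accretive_formD(1)[OF A] and u = unitary_matD[OF U]
  obtain X where X: "X \<in> carrier_mat n n" "mat_adjoint X = X" "X * X = A" using psd_sqrt[OF A hA] by blast
  have Cc: "C \<in> carrier_mat n n" unfolding C by (simp only: sq_mat_simps[where n = n] u(1))
  have den: "(1 - t) * lm j + t > 0" if "j < n" for j using hfun_denom_pos[OF lm(2)[OF that] t] .
  define \<delta> where "\<delta> j = 1 / ((1 - t) * lm j + t)" for j
  define D where "D = U * diag_of n (\<lambda>i. complex_of_real (\<delta> i)) * mat_adjoint U"
  have Dc: "D \<in> carrier_mat n n" unfolding D_def by (simp only: sq_mat_simps[where n = n] u(1))
  define M where "M = mat_adjoint U * X * U"
  have Mc: "M \<in> carrier_mat n n" unfolding M_def by (simp only: sq_mat_simps[where n = n] u(1) X(1))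
  have hM: "mat_adjoint M = M" unfolding M_def by (simp only: mat_adjoint_adjoint sq_mat_simps[where n = n] u(1) X(1,2))
  define \<xi> where "\<xi> k j = (cmod (M $$ (k,j)))\<^sup>2" for k j
  have \<xi>sym: "\<xi> k j = \<xi> j k" if "k < n" "j < n" for k j
    using mat_adjoint_index[of k M j] that Mc hM unfolding \<xi>_def by auto
  have coef: "(mat_adjoint U *\<^sub>v (X *\<^sub>v Matrix.col U j)) $ k = M $$ (k,j)" if "k < n" "j < n" for k j
  proof -
    have "mat_adjoint U *\<^sub>v (X *\<^sub>v Matrix.col U j) = mat_adjoint U * X *\<^sub>v Matrix.col U j"
      by (rule assoc_mult_mat_vec[symmetric]) (use u X unitary_col(1)[OF U that(2)] in auto)
    moreover have "mat_adjoint U * X \<in> carrier_mat n n" by (simp only: sq_mat_simps[where n = n] u(1) X(1))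
    ultimately show ?thesis unfolding M_def using u(1) that by simp
  qed
  have QD: "qmat n t C *\<^sub>v (D *\<^sub>v v) = v" if v: "v \<in> carrier_vec n" for v
    using assoc_mult_mat_vec[OF qmat_carrier[OF Cc, of t] Dc v] qmat_unitary_diag[OF U C den] v
    unfolding D_def \<delta>_def by simp
  have step: "(\<Sum>k<n. \<delta> k * \<xi> k j) \<le> Re (cinner (Matrix.col U j) (hmat n t A *\<^sub>v Matrix.col U j))"
    and mass: "(\<Sum>k<n. \<xi> k j) = Re (cinner (Matrix.col U j) (A *\<^sub>v Matrix.col U j))" if j: "j < n" for j
  proof -
    let ?x = "Matrix.col U j"
    have x: "?x \<in> carrier_vec n" by (rule unitary_col(1)[OF U j])
    let ?v = "X *\<^sub>v ?x"
    have v: "?v \<in> carrier_vec n" by (rule mult_mat_vec_carrier[OF X(1) x])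
    have U'v: "mat_adjoint U *\<^sub>v ?v \<in> carrier_vec n" by (rule mult_mat_vec_carrier[OF u(2) v])
    have Avec: "A *\<^sub>v y = X *\<^sub>v (X *\<^sub>v y)" if "y \<in> carrier_vec n" for y
      using assoc_mult_mat_vec[OF X(1) X(1) that] unfolding X(3) .
    obtain w' where w': "w' \<in> carrier_vec n" "(1 - complex_of_real t) \<cdot>\<^sub>v (A *\<^sub>v w') + complex_of_real t \<cdot>\<^sub>v w' = ?x"
      and hx: "hmat n t A *\<^sub>v ?x = A *\<^sub>v w'" using hmat_solve[OF A t x] by blast
    let ?w = "X *\<^sub>v w'"
    have w: "?w \<in> carrier_vec n" by (rule mult_mat_vec_carrier[OF X(1) w'(1)])
    \<comment> \<open>X commutes with A = X^2, so applying X to the equation for w' gives the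
      equation for w = X w' with right side v = X u_j.\<close>
    have Pw: "qmat n t A *\<^sub>v ?w = ?v"
    proof -
      have "?v = X *\<^sub>v ((1 - complex_of_real t) \<cdot>\<^sub>v (A *\<^sub>v w') + complex_of_real t \<cdot>\<^sub>v w')" unfolding w'(2) ..
      also have "\<dots> = (1 - complex_of_real t) \<cdot>\<^sub>v (X *\<^sub>v (A *\<^sub>v w')) + complex_of_real t \<cdot>\<^sub>v ?w"
        by (rule mat_vec_lincomb[OF X(1) mult_mat_vec_carrier[OF Ac w'(1)] w'(1)])
      also have "X *\<^sub>v (A *\<^sub>v w') = A *\<^sub>v ?w" unfolding Avec[OF w'(1)] Avec[OF w] ..
      finally show ?thesis unfolding qmat_vec[OF Ac w] by simp
    qed
    let ?u = "D *\<^sub>v ?v"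
    have uc: "?u \<in> carrier_vec n" by (rule mult_mat_vec_carrier[OF Dc v])
    have Qu: "qmat n t C *\<^sub>v ?u = ?v" by (rule QD[OF v])
    have hP: "mat_adjoint (qmat n t A) = qmat n t A"
      unfolding qmat_def by (subst mat_adjoint_add[of _ n n]) (auto simp: mat_adjoint_smult hA Ac)
    have PQ: "Re (cinner ?u (qmat n t A *\<^sub>v ?u)) \<le> Re (cinner ?u (qmat n t C *\<^sub>v ?u))"
      unfolding qmat_vec[OF Ac uc] qmat_vec[OF Cc uc]
        cinner_lincomb_right[OF uc mult_mat_vec_carrier[OF Ac uc] uc] cinner_lincomb_right[OF uc mult_mat_vec_carrier[OF Cc uc] uc]
      using AC[OF uc] t by (simp add: mult_left_mono)
    \<comment> \<open>Antitonicity of the inverse in variational form. With P and Q the values of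
      \<open>qmat\<close> at A and C, and P w = v = Q u: 2 Re <u, v> = 2 Re <u, P w> is at most <u,
      P u> + <w, P w>, and <u, P u> \<le> <u, Q u> = <u, v>. Hence Re <u, v> \<le> Re <w,
      v>.\<close>
    have "2 * Re (cinner ?u (qmat n t A *\<^sub>v ?w)) \<le> Re (cinner ?u (qmat n t A *\<^sub>v ?u)) + Re (cinner ?w (qmat n t A *\<^sub>v ?w))"
      by (rule hermitian_form_le[OF accretive_form_qmat[OF A t] hP uc w])
    then have 1: "Re (cinner ?u ?v) \<le> Re (cinner ?w ?v)" using PQ unfolding Pw Qu by simp
    have "cinner ?x (A *\<^sub>v w') = cinner ?v ?w"
      unfolding Avec[OF w'(1)] using cinner_hermitian[OF X(1,2) x w] by simp
    moreover have "cinner ?v ?w = cnj (cinner ?w ?v)" by (rule cinner_cnj[of _ n]) (use v w in auto)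
    ultimately have 2: "Re (cinner ?x (hmat n t A *\<^sub>v ?x)) = Re (cinner ?w ?v)" unfolding hx by simp
    have "cinner ?v ?u = (\<Sum>k<n. complex_of_real (\<delta> k) * (cnj ((mat_adjoint U *\<^sub>v ?v) $ k) * (mat_adjoint U *\<^sub>v ?v) $ k))"
      unfolding D_def by (rule spectral_form[OF u(1) v v])
    also have "\<dots> = (\<Sum>k<n. complex_of_real (\<delta> k * \<xi> k j))"
      by (intro sum.cong refl) (simp add: coef j \<xi>_def complex_norm_square mult.commute del: index_mult_mat_vec of_real_power)
    finally have "Re (cinner ?v ?u) = (\<Sum>k<n. \<delta> k * \<xi> k j)" by simp
    moreover have "cinner ?v ?u = cnj (cinner ?u ?v)" by (rule cinner_cnj[of _ n]) (use v uc in auto)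
    ultimately show "(\<Sum>k<n. \<delta> k * \<xi> k j) \<le> Re (cinner ?x (hmat n t A *\<^sub>v ?x))" using 1 2 by simp
    have "cinner ?x (A *\<^sub>v ?x) = cinner ?v ?v"
      unfolding Avec[OF x] using cinner_hermitian[OF X(1,2) x v] by simp
    also have "\<dots> = cinner (mat_adjoint U *\<^sub>v ?v) (mat_adjoint U *\<^sub>v ?v)" by (rule unitary_cinner[OF U v v, symmetric])
    also have "\<dots> = complex_of_real (\<Sum>k<n. \<xi> k j)"
      unfolding cinner_self carrier_vecD[OF U'v]
      by (intro arg_cong[of _ _ complex_of_real] sum.cong refl) (simp add: coef j \<xi>_def del: index_mult_mat_vec)
    finally show "(\<Sum>k<n. \<xi> k j) = Re (cinner ?x (A *\<^sub>v ?x))" by simp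
  qed
  have "(\<Sum>j<n. s j * (\<delta> j * (\<Sum>k<n. \<xi> k j))) \<le> (\<Sum>j<n. s j * (\<Sum>k<n. \<delta> k * \<xi> k j))"
  proof (rule symmetric_kernel_opposite_order[OF \<xi>sym _ s(1)])
    fix i j assume ij: "i \<le> j" "j < n"
    have "(1 - t) * lm j \<le> (1 - t) * lm i" using lm(1)[OF ij] t by (intro mult_left_mono) auto
    then show "\<delta> i \<le> \<delta> j" unfolding \<delta>_def using den[of j] den[of i] ij by (intro divide_left_mono mult_pos_pos) auto
  qed (auto simp: \<xi>_def)
  also have "\<dots> \<le> (\<Sum>j<n. s j * Re (cinner (Matrix.col U j) (hmat n t A *\<^sub>v Matrix.col U j)))"
    using step s(2) by (intro sum_mono mult_left_mono) auto
  finally show ?thesis using mass by (simp add: \<delta>_def)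
qed

subsection \<open>Trace dominance\<close>

definition gmat :: "nat \<Rightarrow> nat \<Rightarrow> (nat \<Rightarrow> real) \<Rightarrow> (nat \<Rightarrow> real) \<Rightarrow> complex mat \<Rightarrow> complex mat" where
  "gmat n m w t A = Matrix.mat n n (\<lambda>(i,j). \<Sum>l<m. complex_of_real (w l) * hmat n (t l) A $$ (i,j))"

lemma gmat_carrier[simp]: "gmat n m w t A \<in> carrier_mat n n"
  by (simp add: gmat_def)

lemma cinner_gmat:
  assumes A: "accretive_form n A" and wt: "weights m w t" and x: "x \<in> carrier_vec n" "y \<in> carrier_vec n"
  shows "cinner x (gmat n m w t A *\<^sub>v y) = (\<Sum>l<m. complex_of_real (w l) * cinner x (hmat n (t l) A *\<^sub>v y))"
proof -
  have "cinner x (gmat n m w t A *\<^sub>v y) = (\<Sum>i<n. \<Sum>j<n. \<Sum>l<m. complex_of_real (w l) * (cnj (x $ i) * hmat n (t l) A $$ (i,j) * y $ j))"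
    unfolding cinner_mat[OF gmat_carrier x] by (simp add: gmat_def sum_distrib_left sum_distrib_right ac_simps)
  also have "\<dots> = (\<Sum>i<n. \<Sum>l<m. \<Sum>j<n. complex_of_real (w l) * (cnj (x $ i) * hmat n (t l) A $$ (i,j) * y $ j))"
    by (intro sum.cong refl sum.swap)
  also have "\<dots> = (\<Sum>l<m. \<Sum>i<n. \<Sum>j<n. complex_of_real (w l) * (cnj (x $ i) * hmat n (t l) A $$ (i,j) * y $ j))"
    by (rule sum.swap)
  also have "\<dots> = (\<Sum>l<m. complex_of_real (w l) * cinner x (hmat n (t l) A *\<^sub>v y))"
  proof (rule sum.cong[OF refl])
    fix l assume "l \<in> {..<m}"
    then have "0 \<le> t l" "t l \<le> 1" using wt by (auto simp: weights_def)
    from hmat_carrier[OF A this]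
    show "(\<Sum>i<n. \<Sum>j<n. complex_of_real (w l) * (cnj (x $ i) * hmat n (t l) A $$ (i,j) * y $ j))
      = complex_of_real (w l) * cinner x (hmat n (t l) A *\<^sub>v y)"
      by (simp add: cinner_mat[OF _ x] sum_distrib_left)
  qed
  finally show ?thesis .
qed

lemma re_cinner_gmat:
  assumes "accretive_form n A" "weights m w t" "x \<in> carrier_vec n"
  shows "Re (cinner x (gmat n m w t A *\<^sub>v x)) = (\<Sum>l<m. w l * Re (cinner x (hmat n (t l) A *\<^sub>v x)))"
  using cinner_gmat[OF assms assms(3)] by simp

text \<open>The constants in \<open>hmat_forms\<close> do not depend on t, so the estimates pass to
  combinations with nonnegative weights.\<close>

lemma
  assumes A: "accretive_form n A" and sA: "sectorial n T A" and T: "T \<ge> 0" and wt: "weights m w t"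
  shows gmat_sectorial: "sectorial n T (gmat n m w t A)"
    and gmat_re_part_le: "x \<in> carrier_vec n \<Longrightarrow>
      Re (cinner x (gmat n m w t (re_part A) *\<^sub>v x)) \<le> Re (cinner x (gmat n m w t A *\<^sub>v x))"
    and gmat_le_re_part: "x \<in> carrier_vec n \<Longrightarrow>
      Re (cinner x (gmat n m w t A *\<^sub>v x)) \<le> (1 + T\<^sup>2) * Re (cinner x (gmat n m w t (re_part A) *\<^sub>v x))"
proof -
  have w: "0 \<le> w l" "0 \<le> t l" "t l \<le> 1" if "l < m" for l using wt that by (auto simp: weights_def)
  note H = accretive_form_re_part[OF A]
  note forms = hmat_forms[OF A sA T]
  show "Re (cinner x (gmat n m w t (re_part A) *\<^sub>v x)) \<le> Re (cinner x (gmat n m w t A *\<^sub>v x))" if x: "x \<in> carrier_vec n"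
    unfolding re_cinner_gmat[OF A wt x] re_cinner_gmat[OF H wt x]
    using w forms(1)[OF _ _ x] by (intro sum_mono mult_left_mono) auto
  show "Re (cinner x (gmat n m w t A *\<^sub>v x)) \<le> (1 + T\<^sup>2) * Re (cinner x (gmat n m w t (re_part A) *\<^sub>v x))" if x: "x \<in> carrier_vec n"
  proof -
    have "(\<Sum>l<m. w l * Re (cinner x (hmat n (t l) A *\<^sub>v x))) \<le> (\<Sum>l<m. w l * ((1 + T\<^sup>2) * Re (cinner x (hmat n (t l) (re_part A) *\<^sub>v x))))"
      using w forms(2)[OF _ _ x] by (intro sum_mono mult_left_mono) auto
    then show ?thesis unfolding re_cinner_gmat[OF A wt x] re_cinner_gmat[OF H wt x]
      by (simp add: sum_distrib_left ac_simps)
  qed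
  show "sectorial n T (gmat n m w t A)"
    unfolding sectorial_def
  proof (intro conjI ballI gmat_carrier)
    fix x :: "complex Matrix.vec" assume x: "x \<in> carrier_vec n"
    show "0 \<le> Re (cinner x (gmat n m w t A *\<^sub>v x))"
      unfolding re_cinner_gmat[OF A wt x] using w forms(3)[OF _ _ x] by (intro sum_nonneg mult_nonneg_nonneg) auto
    have "\<bar>Im (cinner x (gmat n m w t A *\<^sub>v x))\<bar> = \<bar>\<Sum>l<m. w l * Im (cinner x (hmat n (t l) A *\<^sub>v x))\<bar>"
      unfolding cinner_gmat[OF A wt x x] by simp
    also have "\<dots> \<le> (\<Sum>l<m. w l * (T * Re (cinner x (hmat n (t l) A *\<^sub>v x))))"
      by (rule order_trans[OF sum_abs], rule sum_mono)
        (use w forms(4)[OF _ _ x] in \<open>auto simp: abs_mult intro!: mult_left_mono\<close>)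
    finally show "\<bar>Im (cinner x (gmat n m w t A *\<^sub>v x))\<bar> \<le> T * Re (cinner x (gmat n m w t A *\<^sub>v x))"
      unfolding re_cinner_gmat[OF A wt x] by (simp add: sum_distrib_left ac_simps)
  qed
qed

section \<open>Traces and singular values\<close>

definition tr :: "complex mat \<Rightarrow> complex" where
  "tr A = (\<Sum>i<dim_row A. A $$ (i,i))"

lemma tr_mult_commute:
  assumes "A \<in> carrier_mat n n" "B \<in> carrier_mat n n"
  shows "tr (A * B) = tr (B * A)"
proof -
  have "tr (A * B) = (\<Sum>i<n. \<Sum>l<n. A $$ (i,l) * B $$ (l,i))"
    unfolding tr_def using assms by (auto intro!: sum.cong mat_mult_index simp del: index_mult_mat(1))
  also have "\<dots> = (\<Sum>l<n. \<Sum>i<n. B $$ (l,i) * A $$ (i,l))"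
    by (subst sum.swap) (simp add: mult.commute)
  also have "\<dots> = tr (B * A)"
    unfolding tr_def using assms by (auto intro!: sum.cong mat_mult_index[symmetric] simp del: index_mult_mat(1))
  finally show ?thesis .
qed

lemma cinner_cols:
  assumes Q: "Q \<in> carrier_mat n n" and S: "S \<in> carrier_mat n n" and P: "P \<in> carrier_mat n n" and ij: "i < n" "j < n"
  shows "(mat_adjoint Q * S * P) $$ (i,j) = cinner (Matrix.col Q i) (S *\<^sub>v Matrix.col P j)"
proof -
  have q: "Matrix.col Q i \<in> carrier_vec n" and p: "Matrix.col P j \<in> carrier_vec n" using Q P by auto
  have QS: "mat_adjoint Q * S \<in> carrier_mat n n" by (rule mult_carrier_mat[OF mat_adjoint_carrier[OF Q] S])
  have "cinner (Matrix.col Q i) (S *\<^sub>v Matrix.col P j) = (\<Sum>k<n. \<Sum>l<n. cnj (Q $$ (k,i)) * S $$ (k,l) * P $$ (l,j))"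
    unfolding cinner_mat[OF S q p] using Q P ij by simp
  also have "\<dots> = (\<Sum>l<n. \<Sum>k<n. cnj (Q $$ (k,i)) * S $$ (k,l) * P $$ (l,j))" by (rule sum.swap)
  also have "\<dots> = (\<Sum>l<n. (mat_adjoint Q * S) $$ (i,l) * P $$ (l,j))"
  proof (rule sum.cong[OF refl])
    fix l assume "l \<in> {..<n}"
    then show "(\<Sum>k<n. cnj (Q $$ (k,i)) * S $$ (k,l) * P $$ (l,j)) = (mat_adjoint Q * S) $$ (i,l) * P $$ (l,j)"
      using ij Q by (subst mat_mult_index[OF mat_adjoint_carrier[OF Q] S]) (auto simp: sum_distrib_right)
  qed
  also have "\<dots> = (mat_adjoint Q * S * P) $$ (i,j)" by (rule mat_mult_index[OF QS P ij, symmetric])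
  finally show ?thesis ..
qed

lemma tr_diag_mult:
  assumes "M \<in> carrier_mat n n" shows "tr (diag_of n d * M) = (\<Sum>j<n. d j * M $$ (j,j))"
  unfolding mult_diag_of_left[OF assms] by (simp add: tr_def)

lemma unitary_col_nonzero:
  assumes U: "unitary_mat n U" and i: "i < n" shows "Matrix.col U i \<noteq> 0\<^sub>v n"
proof
  assume "Matrix.col U i = 0\<^sub>v n"
  then show False using spectral_form_col[OF U i, of "\<lambda>_. 1"] by (simp add: cinner_def)
qed

text \<open>Read off from the spectral decomposition Q diag(e) Q^* of W^* W, with s = sqrt e and P =
  W Q diag(1/s). Invertibility of W makes every s_i positive, so P is unitary as it stands and no
  partial isometry has to be completed.\<close>

lemma singular_value_decomposition:
  assumes W: "W \<in> carrier_mat n n" and d: "Determinant.det W \<noteq> 0"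
  obtains P Q s where "unitary_mat n P" "unitary_mat n Q"
    "W = P * diag_of n (\<lambda>i. complex_of_real (s i)) * mat_adjoint Q"
    "\<And>i j. i \<le> j \<Longrightarrow> j < n \<Longrightarrow> s j \<le> s i" "\<And>i. i < n \<Longrightarrow> 0 \<le> (s i :: real)"
proof -
  let ?G = "mat_adjoint W * W"
  have W': "mat_adjoint W \<in> carrier_mat n n" using W by simp
  have G: "?G \<in> carrier_mat n n" by (rule mult_carrier_mat[OF W' W])
  have hG: "mat_adjoint ?G = ?G" by (simp only: mat_adjoint_adjoint sq_mat_simps[where n = n] W)
  obtain Q e where Q: "unitary_mat n Q" and Gd: "?G = Q * diag_of n (\<lambda>i. complex_of_real (e i)) * mat_adjoint Q"
    and e: "\<And>i j. i \<le> j \<Longrightarrow> j < n \<Longrightarrow> e j \<le> e i"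
    using hermitian_spectral[OF G hG] by metis
  note q = unitary_matD[OF Q]
  have epos: "e i > 0" if i: "i < n" for i
  proof -
    let ?c = "Matrix.col Q i"
    have c: "?c \<in> carrier_vec n" "?c \<noteq> 0\<^sub>v n"
      by (rule unitary_col(1)[OF Q i], rule unitary_col_nonzero[OF Q i])
    have Wc: "W *\<^sub>v ?c \<in> carrier_vec n" by (rule mult_mat_vec_carrier[OF W c(1)])
    have "W *\<^sub>v ?c \<noteq> 0\<^sub>v n" using det_0_iff_vec_prod_zero[OF W] d c by blast
    then have "0 < Re (cinner (W *\<^sub>v ?c) (W *\<^sub>v ?c))"
      using accretive_form_one[of n] Wc by (auto simp: accretive_form_def)
    also have "cinner (W *\<^sub>v ?c) (W *\<^sub>v ?c) = cinner ?c (mat_adjoint W *\<^sub>v (W *\<^sub>v ?c))"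
      using cinner_adjoint[OF W' c(1) Wc] by simp
    also have "mat_adjoint W *\<^sub>v (W *\<^sub>v ?c) = ?G *\<^sub>v ?c" by (rule assoc_mult_mat_vec[OF W' W c(1), symmetric])
    also have "cinner ?c (?G *\<^sub>v ?c) = complex_of_real (e i)" unfolding Gd by (rule spectral_form_col[OF Q i])
    finally show ?thesis by simp
  qed
  define s where "s i = sqrt (e i)" for i
  define D where "D = diag_of n (\<lambda>i. complex_of_real (1 / s i))"
  define \<Sigma> where "\<Sigma> = diag_of n (\<lambda>i. complex_of_real (s i))"
  define E where "E = diag_of n (\<lambda>i. complex_of_real (e i))"
  have Dc: "D \<in> carrier_mat n n" "\<Sigma> \<in> carrier_mat n n" "E \<in> carrier_mat n n" by (auto simp: D_def \<Sigma>_def E_def)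
  have hD: "mat_adjoint D = D" unfolding D_def mat_adjoint_diag_of by simp
  have spos: "s i > 0" if "i < n" for i using epos[OF that] by (simp add: s_def)
  have s0: "s i \<noteq> 0" if "i < n" for i using spos[OF that] by simp
  have DS: "D * \<Sigma> = 1\<^sub>m n" unfolding D_def \<Sigma>_def diag_of_mult
    by (intro eq_matI) (use s0 in \<open>auto simp flip: of_real_mult\<close>)
  have DED: "D * (E * D) = 1\<^sub>m n" unfolding D_def E_def diag_of_mult
  proof (rule eq_matI)
    fix i j assume "i < dim_row (1\<^sub>m n :: complex mat)" "j < dim_col (1\<^sub>m n :: complex mat)"
    moreover have "complex_of_real (1 / s i) * (complex_of_real (e i) * complex_of_real (1 / s i)) = 1" if "i < n"
    proof -
      have "1 / s i * (e i * (1 / s i)) = 1" using epos[OF that] spos[OF that] by (simp add: s_def)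
      then show ?thesis unfolding of_real_mult[symmetric] by (metis of_real_1)
    qed
    ultimately show "diag_of n (\<lambda>i. complex_of_real (1 / s i) * (complex_of_real (e i) * complex_of_real (1 / s i))) $$ (i,j) = 1\<^sub>m n $$ (i,j)"
      by (cases "i = j") (simp_all del: of_real_divide)
  qed auto
  define P where "P = W * Q * D"
  have Pc: "P \<in> carrier_mat n n" unfolding P_def by (simp only: sq_mat_simps[where n = n] W q(1) Dc)
  have "mat_adjoint P * P = D * (mat_adjoint Q * (?G * (Q * D)))"
    unfolding P_def by (simp only: sq_mat_simps[where n = n] W q(1) Dc hD)
  also have "\<dots> = D * ((mat_adjoint Q * Q) * (E * ((mat_adjoint Q * Q) * D)))"
    unfolding Gd E_def[symmetric] by (simp only: sq_mat_simps[where n = n] q(1) Dc)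
  also have "\<dots> = 1\<^sub>m n" unfolding q(3) using Dc DED by simp
  finally have P: "unitary_mat n P" using Pc by (simp add: unitary_mat_def)
  have "P * \<Sigma> * mat_adjoint Q = W * (Q * ((D * \<Sigma>) * mat_adjoint Q))"
    unfolding P_def by (simp only: sq_mat_simps[where n = n] W q(1) Dc)
  also have "\<dots> = W" unfolding DS using q W by simp
  finally have "W = P * \<Sigma> * mat_adjoint Q" ..
  moreover have "s j \<le> s i" if "i \<le> j" "j < n" for i j using e[OF that] by (simp add: s_def)
  ultimately show ?thesis using that[OF P Q, of s] spos unfolding \<Sigma>_def by (simp add: less_imp_le)
qed

lemma unitary_row_col_sums:
  assumes V: "unitary_mat n V" and i: "i < n"
  shows "(\<Sum>k<n. (cmod (V $$ (k,i)))\<^sup>2) = 1" "(\<Sum>k<n. (cmod (V $$ (i,k)))\<^sup>2) = 1"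
proof -
  have col: "(\<Sum>k<n. (cmod (W $$ (k,i)))\<^sup>2) = 1" if W: "unitary_mat n W" for W
  proof -
    note w = unitary_matD[OF W]
    have "(\<Sum>k<n. mat_adjoint W $$ (i,k) * W $$ (k,i)) = 1"
      using mat_mult_index[OF w(2,1) i i] w(3) i by simp
    then have "(\<Sum>k<n. complex_of_real ((cmod (W $$ (k,i)))\<^sup>2)) = 1"
      using w(1) i by (simp add: complex_norm_square mult.commute del: of_real_power)
    then show ?thesis unfolding of_real_sum[symmetric] of_real_eq_1_iff .
  qed
  show "(\<Sum>k<n. (cmod (V $$ (k,i)))\<^sup>2) = 1" by (rule col[OF V])
  have "(\<Sum>k<n. (cmod (mat_adjoint V $$ (k,i)))\<^sup>2) = 1" by (rule col[OF unitary_mat_adjoint[OF V]])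
  then show "(\<Sum>k<n. (cmod (V $$ (i,k)))\<^sup>2) = 1" using unitary_matD(1)[OF V] i by simp
qed

text \<open>g(C) has eigenvalues \<gamma>_k along U, so its diagonal along Q consists of averages of
  \<gamma> with the doubly stochastic weights |<u_k, q_j>|^2. Each h_t is increasing, hence \<gamma>
  is ordered like \<open>lm\<close> and the rearrangement lemma applies.\<close>

lemma weighted_trace_le_sorted:
  fixes s lm :: "nat \<Rightarrow> real"
  assumes U: "unitary_mat n U" and Q: "unitary_mat n Q"
    and C: "accretive_form n C" "C = U * diag_of n (\<lambda>i. complex_of_real (lm i)) * mat_adjoint U"
    and lm: "\<And>i j. i \<le> j \<Longrightarrow> j < n \<Longrightarrow> lm j \<le> lm i" "\<And>i. i < n \<Longrightarrow> 0 < lm i"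
    and s: "\<And>i j. i \<le> j \<Longrightarrow> j < n \<Longrightarrow> s j \<le> s i" "\<And>i. i < n \<Longrightarrow> 0 \<le> s i"
    and wt: "weights m w t"
  shows "(\<Sum>j<n. s j * Re (cinner (Matrix.col Q j) (gmat n m w t C *\<^sub>v Matrix.col Q j)))
    \<le> (\<Sum>j<n. s j * (\<Sum>l<m. w l * (lm j / ((1 - t l) * lm j + t l))))"
proof -
  have w: "0 \<le> w l" "0 \<le> t l" "t l \<le> 1" if "l < m" for l using wt that by (auto simp: weights_def)
  note u = unitary_matD[OF U] and q = unitary_matD[OF Q]
  define \<gamma> where "\<gamma> k = (\<Sum>l<m. w l * (lm k / ((1 - t l) * lm k + t l)))" for k
  define V where "V = mat_adjoint U * Q"
  have V: "unitary_mat n V" unfolding V_def by (rule unitary_mat_mult[OF unitary_mat_adjoint[OF U] Q])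
  have form: "Re (cinner (Matrix.col Q j) (gmat n m w t C *\<^sub>v Matrix.col Q j)) = (\<Sum>k<n. (cmod (V $$ (k,j)))\<^sup>2 * \<gamma> k)" if j: "j < n" for j
  proof -
    let ?c = "Matrix.col Q j"
    have c: "?c \<in> carrier_vec n" by (rule unitary_col(1)[OF Q j])
    have Vk: "(mat_adjoint U *\<^sub>v ?c) $ k = V $$ (k,j)" if "k < n" for k
      unfolding V_def using u q that j by simp
    have "Re (cinner ?c (hmat n (t l) C *\<^sub>v ?c)) = (\<Sum>k<n. (cmod (V $$ (k,j)))\<^sup>2 * (lm k / ((1 - t l) * lm k + t l)))" if l: "l < m" for l
    proof -
      have "hmat n (t l) C = U * diag_of n (\<lambda>i. complex_of_real (lm i / ((1 - t l) * lm i + t l))) * mat_adjoint U"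
        by (rule hmat_unitary_diag[OF U C(2)]) (use hfun_denom_pos lm(2) w[OF l] in blast)
      then have "cinner ?c (hmat n (t l) C *\<^sub>v ?c) = (\<Sum>k<n. complex_of_real (lm k / ((1 - t l) * lm k + t l)) * (cnj ((mat_adjoint U *\<^sub>v ?c) $ k) * (mat_adjoint U *\<^sub>v ?c) $ k))"
        using spectral_form[OF u(1) c c] by simp
      also have "\<dots> = (\<Sum>k<n. complex_of_real ((cmod (V $$ (k,j)))\<^sup>2 * (lm k / ((1 - t l) * lm k + t l))))"
      proof (rule sum.cong[OF refl])
        fix k assume "k \<in> {..<n}"
        then have k: "k < n" by simp
        have "cnj (V $$ (k,j)) * V $$ (k,j) = complex_of_real ((cmod (V $$ (k,j)))\<^sup>2)"
          using complex_norm_square[of "V $$ (k,j)"] by (simp add: mult.commute)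
        then show "complex_of_real (lm k / ((1 - t l) * lm k + t l)) * (cnj ((mat_adjoint U *\<^sub>v ?c) $ k) * (mat_adjoint U *\<^sub>v ?c) $ k)
           = complex_of_real ((cmod (V $$ (k,j)))\<^sup>2 * (lm k / ((1 - t l) * lm k + t l)))"
          unfolding Vk[OF k] by simp
      qed
      finally show ?thesis by simp
    qed
    then have "(\<Sum>l<m. w l * Re (cinner ?c (hmat n (t l) C *\<^sub>v ?c))) = (\<Sum>l<m. \<Sum>k<n. (cmod (V $$ (k,j)))\<^sup>2 * (w l * (lm k / ((1 - t l) * lm k + t l))))"
      by (intro sum.cong refl) (simp add: sum_distrib_left ac_simps)
    also have "\<dots> = (\<Sum>k<n. (cmod (V $$ (k,j)))\<^sup>2 * \<gamma> k)"
      unfolding \<gamma>_def sum_distrib_left by (rule sum.swap)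
    finally show ?thesis unfolding re_cinner_gmat[OF C(1) wt c] .
  qed
  have "(\<Sum>j<n. s j * Re (cinner (Matrix.col Q j) (gmat n m w t C *\<^sub>v Matrix.col Q j)))
     = (\<Sum>j<n. s j * (\<Sum>k<n. (cmod (V $$ (k,j)))\<^sup>2 * \<gamma> k))" by (intro sum.cong refl) (simp add: form)
  also have "\<dots> \<le> (\<Sum>j<n. s j * \<gamma> j)"
  proof (rule rearrangement_doubly_stochastic[OF s(1) _ s(2)])
    fix i j assume ij: "i \<le> j" "j < n"
    show "\<gamma> j \<le> \<gamma> i" unfolding \<gamma>_def
    proof (intro sum_mono mult_left_mono)
      fix l assume "l \<in> {..<m}"
      then have l: "l < m" by simp
      have d: "0 < (1 - t l) * lm i + t l" "0 < (1 - t l) * lm j + t l"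
        using hfun_denom_pos lm(2) w[OF l] ij by (meson le_less_trans)+
      \<comment> \<open>After cross-multiplication the products (1 - t_l) lm_i lm_j cancel, and this
        is what remains.\<close>
      have "t l * lm j \<le> t l * lm i" using lm(1)[OF ij] w[OF l] by (intro mult_left_mono) auto
      then show "lm j / ((1 - t l) * lm j + t l) \<le> lm i / ((1 - t l) * lm i + t l)"
        using d by (simp add: divide_le_eq le_divide_eq) (simp add: algebra_simps divide_simps)
      show "0 \<le> w l" using w[OF l] by simp
    qed
  qed (use unitary_row_col_sums[OF V] in auto)
  finally show ?thesis unfolding \<gamma>_def .
qed

section \<open>Sums of accretive matrices and the trace bound\<close>

lemma cinner_add_mat:
  assumes "A \<in> carrier_mat n n" "B \<in> carrier_mat n n" "x \<in> carrier_vec n"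
  shows "cinner x ((A + B) *\<^sub>v x) = cinner x (A *\<^sub>v x) + cinner x (B *\<^sub>v x)"
  unfolding add_mult_distrib_mat_vec[OF assms]
  by (rule cinner_add_right[OF assms(3) mult_mat_vec_carrier[OF assms(1,3)] mult_mat_vec_carrier[OF assms(2,3)]])

lemma accretive_form_add:
  assumes "accretive_form n A" "accretive_form n B" shows "accretive_form n (A + B)"
  using assms cinner_add_mat[of A n B] by (auto simp: accretive_form_def intro: add_pos_pos)

lemma sectorial_add:
  assumes A: "sectorial n T A" and B: "sectorial n T B" shows "sectorial n T (A + B)"
  unfolding sectorial_def
proof (intro conjI ballI)
  have Ac: "A \<in> carrier_mat n n" and Bc: "B \<in> carrier_mat n n" using A B by (auto simp: sectorial_def)
  then show "A + B \<in> carrier_mat n n" by simp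
  fix x :: "complex Matrix.vec" assume x: "x \<in> carrier_vec n"
  have a: "0 \<le> Re (cinner x (A *\<^sub>v x))" "\<bar>Im (cinner x (A *\<^sub>v x))\<bar> \<le> T * Re (cinner x (A *\<^sub>v x))"
    and b: "0 \<le> Re (cinner x (B *\<^sub>v x))" "\<bar>Im (cinner x (B *\<^sub>v x))\<bar> \<le> T * Re (cinner x (B *\<^sub>v x))"
    using A B x by (auto simp: sectorial_def)
  show "0 \<le> Re (cinner x ((A + B) *\<^sub>v x))" unfolding cinner_add_mat[OF Ac Bc x] using a b by simp
  show "\<bar>Im (cinner x ((A + B) *\<^sub>v x))\<bar> \<le> T * Re (cinner x ((A + B) *\<^sub>v x))"
    unfolding cinner_add_mat[OF Ac Bc x] using a b abs_triangle_ineq[of "Im (cinner x (A *\<^sub>v x))" "Im (cinner x (B *\<^sub>v x))"]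
    by (simp add: ring_distribs)
qed

lemma trace_dominance:
  assumes A: "accretive_form n A" "sectorial n T A" and B: "accretive_form n B" "sectorial n T B" and T: "T \<ge> 0"
    and wt: "weights m w t" and W: "W \<in> carrier_mat n n" "Determinant.det W \<noteq> 0"
  obtains U V where "unitary_mat n U" "unitary_mat n V"
    "cmod (tr (W * gmat n m w t (A + B)))
      \<le> sqrt (1 + T\<^sup>2) ^ 3 * Re (tr (W * (U * (gmat n m w t A + gmat n m w t B) * V)))"
proof -
  have w: "0 \<le> w l" "0 \<le> t l" "t l \<le> 1" if "l < m" for l using wt that by (auto simp: weights_def)
  note Ac = accretive_formD(1)[OF A(1)] and Bc = accretive_formD(1)[OF B(1)]
  have ABc: "A + B \<in> carrier_mat n n" using Ac Bc by simp
  note ABform = cinner_add_mat[OF Ac Bc]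
  have AB: "accretive_form n (A + B)" by (rule accretive_form_add[OF A(1) B(1)])
  have sAB: "sectorial n T (A + B)" by (rule sectorial_add[OF A(2) B(2)])
  let ?S = "gmat n m w t (A + B)" and ?Z = "gmat n m w t A + gmat n m w t B"
  let ?C = "re_part (A + B)"
  define \<kappa> where "\<kappa> = sqrt (1 + T\<^sup>2)"
  have \<kappa>: "\<kappa>\<^sup>2 = 1 + T\<^sup>2" "\<kappa> \<ge> 0" by (simp_all add: \<kappa>_def)
  have Zc: "?Z \<in> carrier_mat n n" by simp
  have C: "accretive_form n ?C" by (rule accretive_form_re_part[OF AB])
  note Cc = accretive_formD(1)[OF C]
  obtain U lm where U: "unitary_mat n U" and Cd: "?C = U * diag_of n (\<lambda>i. complex_of_real (lm i)) * mat_adjoint U"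
    and lm: "\<And>i j. i \<le> j \<Longrightarrow> j < n \<Longrightarrow> lm j \<le> lm i"
    using hermitian_spectral[OF Cc re_part_adjoint[OF ABc]] by metis
  note u = unitary_matD[OF U]
  note col0 = unitary_col_nonzero[OF U]
  have lmc: "complex_of_real (lm j) = cinner (Matrix.col U j) (?C *\<^sub>v Matrix.col U j)" if "j < n" for j
    using spectral_form_col[OF U that, of "\<lambda>i. complex_of_real (lm i)"] unfolding Cd by simp
  have lmpos: "lm j > 0" if "j < n" for j
  proof -
    have "0 < Re (cinner (Matrix.col U j) (?C *\<^sub>v Matrix.col U j))"
      using C unitary_col(1)[OF U that] col0[OF that] by (auto simp: accretive_form_def)
    then show ?thesis unfolding lmc[OF that, symmetric] by simp
  qed
  obtain P Q s where P: "unitary_mat n P" and Q: "unitary_mat n Q"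
    and Wd: "W = P * diag_of n (\<lambda>i. complex_of_real (s i)) * mat_adjoint Q"
    and s: "\<And>i j. i \<le> j \<Longrightarrow> j < n \<Longrightarrow> s j \<le> s i" "\<And>i. i < n \<Longrightarrow> 0 \<le> (s i :: real)"
    using singular_value_decomposition[OF W] by blast
  note p = unitary_matD[OF P] and q = unitary_matD[OF Q]
  define \<Sigma> where "\<Sigma> = diag_of n (\<lambda>i. complex_of_real (s i))"
  have Sc: "\<Sigma> \<in> carrier_mat n n" by (simp add: \<Sigma>_def)
  have gS: "?S \<in> carrier_mat n n" by simp
  define b where "b j = (\<Sum>l<m. w l * (lm j / ((1 - t l) * lm j + t l)))" for j
  \<comment> \<open>Needed for both bases P and Q: the Cauchy-Schwarz inequality bounds <q_j, S p_j>
    by the diagonal values of S along each of them, and neither is related to the eigenbasis of C.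
    The rearrangement makes the bound independent of the basis.\<close>
  have cols: "(\<Sum>j<n. s j * Re (cinner (Matrix.col R j) (?S *\<^sub>v Matrix.col R j))) \<le> \<kappa>\<^sup>2 * (\<Sum>j<n. s j * b j)" if R: "unitary_mat n R" for R
  proof -
    have "(\<Sum>j<n. s j * Re (cinner (Matrix.col R j) (?S *\<^sub>v Matrix.col R j)))
      \<le> (\<Sum>j<n. s j * (\<kappa>\<^sup>2 * Re (cinner (Matrix.col R j) (gmat n m w t ?C *\<^sub>v Matrix.col R j))))"
      unfolding \<kappa>(1) using s(2) gmat_le_re_part[OF AB sAB T wt unitary_col(1)[OF R]]
      by (intro sum_mono mult_left_mono) auto
    also have "\<dots> = \<kappa>\<^sup>2 * (\<Sum>j<n. s j * Re (cinner (Matrix.col R j) (gmat n m w t ?C *\<^sub>v Matrix.col R j)))"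
      by (simp add: sum_distrib_left ac_simps)
    also have "\<dots> \<le> \<kappa>\<^sup>2 * (\<Sum>j<n. s j * b j)"
      unfolding b_def by (intro mult_left_mono weighted_trace_le_sorted[OF U R C Cd lm lmpos s wt]) auto
    finally show ?thesis .
  qed
  have "tr (W * ?S) = tr (P * (\<Sigma> * (mat_adjoint Q * ?S)))"
    unfolding Wd \<Sigma>_def[symmetric] by (simp only: sq_mat_simps[where n = n] p(1) q(1) Sc gS)
  also have "\<dots> = tr ((\<Sigma> * (mat_adjoint Q * ?S)) * P)"
    by (rule tr_mult_commute[OF p(1)]) (simp only: sq_mat_simps[where n = n] q(1) Sc gS)
  also have "(\<Sigma> * (mat_adjoint Q * ?S)) * P = \<Sigma> * (mat_adjoint Q * ?S * P)"
    by (simp only: sq_mat_simps[where n = n] p(1) q(1) Sc gS)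
  also have "tr \<dots> = (\<Sum>j<n. complex_of_real (s j) * (mat_adjoint Q * ?S * P) $$ (j,j))"
    unfolding \<Sigma>_def by (rule tr_diag_mult) (simp only: sq_mat_simps[where n = n] p(1) q(1) gS)
  also have "\<dots> = (\<Sum>j<n. complex_of_real (s j) * cinner (Matrix.col Q j) (?S *\<^sub>v Matrix.col P j))"
    by (intro sum.cong refl) (simp only: cinner_cols[OF q(1) gS p(1)] lessThan_iff)
  finally have "cmod (tr (W * ?S)) \<le> (\<Sum>j<n. s j * cmod (cinner (Matrix.col Q j) (?S *\<^sub>v Matrix.col P j)))"
    using s(2) by (auto intro!: sum_norm_le simp: norm_mult)
  also have "\<dots> \<le> (\<Sum>j<n. s j * (\<kappa> / 2 * (Re (cinner (Matrix.col Q j) (?S *\<^sub>v Matrix.col Q j)) + Re (cinner (Matrix.col P j) (?S *\<^sub>v Matrix.col P j)))))"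
    unfolding \<kappa>_def using s(2) sectorial_cauchy_schwarz[OF gmat_sectorial[OF AB sAB T wt] T unitary_col(1)[OF Q] unitary_col(1)[OF P]]
    by (intro sum_mono mult_left_mono) auto
  also have "\<dots> = \<kappa> / 2 * ((\<Sum>j<n. s j * Re (cinner (Matrix.col Q j) (?S *\<^sub>v Matrix.col Q j))) + (\<Sum>j<n. s j * Re (cinner (Matrix.col P j) (?S *\<^sub>v Matrix.col P j))))"
    by (simp add: sum_distrib_left sum.distrib ring_distribs ac_simps)
  also have "\<dots> \<le> \<kappa> / 2 * (\<kappa>\<^sup>2 * (\<Sum>j<n. s j * b j) + \<kappa>\<^sup>2 * (\<Sum>j<n. s j * b j))"
    using \<kappa>(2) by (intro mult_left_mono add_mono cols P Q) auto
  also have "\<dots> = \<kappa> ^ 3 * (\<Sum>j<n. s j * b j)" by (simp add: power3_eq_cube power2_eq_square)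
  finally have 1: "cmod (tr (W * ?S)) \<le> \<kappa> ^ 3 * (\<Sum>j<n. s j * b j)" .
  let ?HA = "re_part A" and ?HB = "re_part B"
  note HA = accretive_form_re_part[OF A(1)] and HB = accretive_form_re_part[OF B(1)]
  have Cform: "Re (cinner x (?C *\<^sub>v x)) = Re (cinner x (?HA *\<^sub>v x)) + Re (cinner x (?HB *\<^sub>v x))" if x: "x \<in> carrier_vec n" for x
    unfolding cinner_re_part[OF ABc x] cinner_re_part[OF Ac x] cinner_re_part[OF Bc x] ABform[OF x] by simp
  have leA: "Re (cinner x (?HA *\<^sub>v x)) \<le> Re (cinner x (?C *\<^sub>v x))" and leB: "Re (cinner x (?HB *\<^sub>v x)) \<le> Re (cinner x (?C *\<^sub>v x))"
    if x: "x \<in> carrier_vec n" for x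
    unfolding Cform[OF x] using accretive_formD(2)[OF HA x] accretive_formD(2)[OF HB x] by auto
  have "(\<Sum>j<n. s j * b j) = (\<Sum>l<m. w l * (\<Sum>j<n. s j * (lm j / ((1 - t l) * lm j + t l))))"
    unfolding b_def sum_distrib_left by (subst sum.swap) (simp add: ac_simps)
  also have "\<dots> \<le> (\<Sum>l<m. w l * ((\<Sum>j<n. s j * Re (cinner (Matrix.col U j) (hmat n (t l) ?HA *\<^sub>v Matrix.col U j)))
     + (\<Sum>j<n. s j * Re (cinner (Matrix.col U j) (hmat n (t l) ?HB *\<^sub>v Matrix.col U j)))))"
  proof (intro sum_mono mult_left_mono)
    fix l assume "l \<in> {..<m}"
    then have l: "l < m" by simp
    show "0 \<le> w l" using w[OF l] by simp
    \<comment> \<open>The eigenvalue is the sum of the diagonal values of Re A and Re B at u_j, so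
      h_t at this eigenvalue splits into two fractions over a common denominator. That is the left
      side of \<open>weighted_trace_hmat\<close> for each of them.\<close>
    have "lm j = Re (cinner (Matrix.col U j) (?HA *\<^sub>v Matrix.col U j)) + Re (cinner (Matrix.col U j) (?HB *\<^sub>v Matrix.col U j))" if "j < n" for j
      using arg_cong[OF lmc[OF that], of Re] Cform[OF unitary_col(1)[OF U that]] by simp
    then have "(\<Sum>j<n. s j * (lm j / ((1 - t l) * lm j + t l)))
      = (\<Sum>j<n. s j * ((Re (cinner (Matrix.col U j) (?HA *\<^sub>v Matrix.col U j)) + Re (cinner (Matrix.col U j) (?HB *\<^sub>v Matrix.col U j))) / ((1 - t l) * lm j + t l)))"
      by (intro sum.cong refl) simp
    also have "\<dots> = (\<Sum>j<n. s j * (Re (cinner (Matrix.col U j) (?HA *\<^sub>v Matrix.col U j)) / ((1 - t l) * lm j + t l)))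
      + (\<Sum>j<n. s j * (Re (cinner (Matrix.col U j) (?HB *\<^sub>v Matrix.col U j)) / ((1 - t l) * lm j + t l)))"
      unfolding sum.distrib[symmetric] by (intro sum.cong refl) (simp add: add_divide_distrib ring_distribs)
    also have "\<dots> \<le> (\<Sum>j<n. s j * Re (cinner (Matrix.col U j) (hmat n (t l) ?HA *\<^sub>v Matrix.col U j)))
      + (\<Sum>j<n. s j * Re (cinner (Matrix.col U j) (hmat n (t l) ?HB *\<^sub>v Matrix.col U j)))"
      by (intro add_mono weighted_trace_hmat[OF HA re_part_adjoint[OF Ac] U Cd leA lm lmpos s w(2,3)[OF l]]
        weighted_trace_hmat[OF HB re_part_adjoint[OF Bc] U Cd leB lm lmpos s w(2,3)[OF l]])
    finally show "(\<Sum>j<n. s j * (lm j / ((1 - t l) * lm j + t l))) \<le> (\<Sum>j<n. s j * Re (cinner (Matrix.col U j) (hmat n (t l) ?HA *\<^sub>v Matrix.col U j)))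
      + (\<Sum>j<n. s j * Re (cinner (Matrix.col U j) (hmat n (t l) ?HB *\<^sub>v Matrix.col U j)))" .
  qed
  also have "\<dots> = (\<Sum>l<m. w l * (\<Sum>j<n. s j * Re (cinner (Matrix.col U j) (hmat n (t l) ?HA *\<^sub>v Matrix.col U j))))
     + (\<Sum>l<m. w l * (\<Sum>j<n. s j * Re (cinner (Matrix.col U j) (hmat n (t l) ?HB *\<^sub>v Matrix.col U j))))"
    by (simp add: sum.distrib ring_distribs)
  also have "\<dots> = (\<Sum>j<n. s j * Re (cinner (Matrix.col U j) (gmat n m w t ?HA *\<^sub>v Matrix.col U j)))
     + (\<Sum>j<n. s j * Re (cinner (Matrix.col U j) (gmat n m w t ?HB *\<^sub>v Matrix.col U j)))"
  proof -
    have "(\<Sum>l<m. w l * (\<Sum>j<n. s j * Re (cinner (Matrix.col U j) (hmat n (t l) H *\<^sub>v Matrix.col U j))))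
      = (\<Sum>j<n. s j * Re (cinner (Matrix.col U j) (gmat n m w t H *\<^sub>v Matrix.col U j)))" if H: "accretive_form n H" for H
    proof -
      have "(\<Sum>l<m. w l * (\<Sum>j<n. s j * Re (cinner (Matrix.col U j) (hmat n (t l) H *\<^sub>v Matrix.col U j))))
        = (\<Sum>j<n. s j * (\<Sum>l<m. w l * Re (cinner (Matrix.col U j) (hmat n (t l) H *\<^sub>v Matrix.col U j))))"
        unfolding sum_distrib_left by (subst sum.swap) (simp add: ac_simps)
      also have "\<dots> = (\<Sum>j<n. s j * Re (cinner (Matrix.col U j) (gmat n m w t H *\<^sub>v Matrix.col U j)))"
        by (intro sum.cong refl) (simp only: re_cinner_gmat[OF H wt unitary_col(1)[OF U]] lessThan_iff)
      finally show ?thesis .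
    qed
    then show ?thesis using HA HB by simp
  qed
  also have "\<dots> \<le> (\<Sum>j<n. s j * Re (cinner (Matrix.col U j) (gmat n m w t A *\<^sub>v Matrix.col U j)))
     + (\<Sum>j<n. s j * Re (cinner (Matrix.col U j) (gmat n m w t B *\<^sub>v Matrix.col U j)))"
    using s(2) gmat_re_part_le[OF A T wt unitary_col(1)[OF U]] gmat_re_part_le[OF B T wt unitary_col(1)[OF U]]
    by (intro add_mono sum_mono mult_left_mono) auto
  also have "\<dots> = (\<Sum>j<n. s j * Re (cinner (Matrix.col U j) (?Z *\<^sub>v Matrix.col U j)))"
    unfolding sum.distrib[symmetric]
  proof (rule sum.cong[OF refl])
    fix j assume "j \<in> {..<n}"
    then have c: "Matrix.col U j \<in> carrier_vec n" using unitary_col(1)[OF U] by simp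
    show "s j * Re (cinner (Matrix.col U j) (gmat n m w t A *\<^sub>v Matrix.col U j)) + s j * Re (cinner (Matrix.col U j) (gmat n m w t B *\<^sub>v Matrix.col U j))
      = s j * Re (cinner (Matrix.col U j) (?Z *\<^sub>v Matrix.col U j))"
      unfolding add_mult_distrib_mat_vec[OF gmat_carrier gmat_carrier c]
        cinner_add_right[OF c mult_mat_vec_carrier[OF gmat_carrier c] mult_mat_vec_carrier[OF gmat_carrier c]]
      by (simp add: ring_distribs)
  qed
  \<comment> \<open>The unitary factors Q U^* and U P^* are made for this identity: after a cyclic
    shift under the trace, the factors P and Q of W cancel and tr(\<Sigma> U^* Z U) is left.\<close>
  also have "\<dots> = Re (tr (W * ((Q * mat_adjoint U) * ?Z * (U * mat_adjoint P))))"
  proof -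
    have "tr (W * ((Q * mat_adjoint U) * ?Z * (U * mat_adjoint P)))
      = tr (P * (\<Sigma> * ((mat_adjoint Q * Q) * (mat_adjoint U * ?Z * U)) * mat_adjoint P))"
      unfolding Wd \<Sigma>_def[symmetric] by (simp only: sq_mat_simps[where n = n] p(1) q(1) u(1) Sc Zc)
    also have "\<dots> = tr ((\<Sigma> * ((mat_adjoint Q * Q) * (mat_adjoint U * ?Z * U)) * mat_adjoint P) * P)"
      by (rule tr_mult_commute[OF p(1)]) (simp only: sq_mat_simps[where n = n] p(1) q(1) u(1) Sc Zc)
    also have "(\<Sigma> * ((mat_adjoint Q * Q) * (mat_adjoint U * ?Z * U)) * mat_adjoint P) * P
      = (\<Sigma> * ((mat_adjoint Q * Q) * (mat_adjoint U * ?Z * U))) * (mat_adjoint P * P)"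
      by (simp only: sq_mat_simps[where n = n] p(1) q(1) u(1) Sc Zc)
    also have "\<dots> = \<Sigma> * (mat_adjoint U * ?Z * U)"
    proof -
      have c: "mat_adjoint U * ?Z * U \<in> carrier_mat n n" by (simp only: sq_mat_simps[where n = n] u(1) Zc)
      have "\<Sigma> * (mat_adjoint U * ?Z * U) \<in> carrier_mat n n" by (rule mult_carrier_mat[OF Sc c])
      then show ?thesis unfolding p(3) q(3) left_mult_one_mat[OF c] by (rule right_mult_one_mat)
    qed
    also have "tr \<dots> = (\<Sum>j<n. complex_of_real (s j) * (mat_adjoint U * ?Z * U) $$ (j,j))"
      unfolding \<Sigma>_def by (rule tr_diag_mult) (simp only: sq_mat_simps[where n = n] u(1) Zc)
    also have "\<dots> = (\<Sum>j<n. complex_of_real (s j) * cinner (Matrix.col U j) (?Z *\<^sub>v Matrix.col U j))"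
      by (intro sum.cong refl) (simp only: cinner_cols[OF u(1) Zc u(1)] lessThan_iff)
    finally show ?thesis by simp
  qed
  finally have 2: "(\<Sum>j<n. s j * b j) \<le> Re (tr (W * ((Q * mat_adjoint U) * ?Z * (U * mat_adjoint P))))" .
  have "cmod (tr (W * ?S)) \<le> \<kappa> ^ 3 * Re (tr (W * ((Q * mat_adjoint U) * ?Z * (U * mat_adjoint P))))"
    by (rule order_trans[OF 1 mult_left_mono[OF 2]]) (simp add: \<kappa>(2))
  then show ?thesis
    using that[OF unitary_mat_mult[OF Q unitary_mat_adjoint[OF U]] unitary_mat_mult[OF U unitary_mat_adjoint[OF P]]]
    unfolding \<kappa>_def by blast
qed

subsection \<open>Unitarily invariant norms\<close>

text \<open>The real inner product behind the Frobenius norm; the separating functionals below are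
  of the form X |-> \<open>frob W X\<close>.\<close>

definition frob :: "complex mat \<Rightarrow> complex mat \<Rightarrow> real" where
  "frob X Y = (\<Sum>i<dim_row X. \<Sum>j<dim_col X. Re (cnj (X $$ (i,j)) * Y $$ (i,j)))"

lemma frob_index: "X \<in> carrier_mat n n \<Longrightarrow> frob X Y = (\<Sum>i<n. \<Sum>j<n. Re (cnj (X $$ (i,j)) * Y $$ (i,j)))"
  by (auto simp: frob_def)

lemma frob_self: "X \<in> carrier_mat n n \<Longrightarrow> frob X X = (\<Sum>i<n. \<Sum>j<n. (cmod (X $$ (i,j)))\<^sup>2)"
  unfolding frob_index by (intro sum.cong refl) (simp add: cmod_power2 power2_eq_square[symmetric])

lemma frob_self_nonneg: "X \<in> carrier_mat n n \<Longrightarrow> 0 \<le> frob X X"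
  unfolding frob_self by (intro sum_nonneg) auto

lemma frob_tr:
  assumes "X \<in> carrier_mat n n" "Y \<in> carrier_mat n n"
  shows "frob X Y = Re (tr (mat_adjoint X * Y))"
proof -
  have "tr (mat_adjoint X * Y) = (\<Sum>j<n. \<Sum>i<n. cnj (X $$ (i,j)) * Y $$ (i,j))"
    unfolding tr_def using assms
    by (auto intro!: sum.cong simp: mat_mult_index[OF mat_adjoint_carrier] simp del: index_mult_mat(1))
  then show ?thesis unfolding frob_index[OF assms(1)] by (subst sum.swap) simp
qed

lemma tr_add: "\<lbrakk>X \<in> carrier_mat n n; Y \<in> carrier_mat n n\<rbrakk> \<Longrightarrow> tr (X + Y) = tr X + tr Y"
  by (auto simp: tr_def sum.distrib)

lemma frob_diff_scale:
  assumes W: "W \<in> carrier_mat n n" and V: "V \<in> carrier_mat n n"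
  shows "frob (W - complex_of_real \<theta> \<cdot>\<^sub>m V) (W - complex_of_real \<theta> \<cdot>\<^sub>m V) = frob W W - 2 * \<theta> * frob W V + \<theta>\<^sup>2 * frob V V"
proof -
  have c: "W - complex_of_real \<theta> \<cdot>\<^sub>m V \<in> carrier_mat n n" using V by (intro minus_carrier_mat) simp
  show ?thesis
    unfolding frob_index[OF c] frob_index[OF W] frob_index[OF V] sum_distrib_left sum_subtractf[symmetric] sum.distrib[symmetric]
    using W V by (intro sum.cong refl) (auto simp: power2_eq_square algebra_simps)
qed

lemma frob_diff_right:
  assumes "W \<in> carrier_mat n n" "X \<in> carrier_mat n n" "Y \<in> carrier_mat n n"
  shows "frob W (X - Y) = frob W X - frob W Y"
  unfolding frob_index[OF assms(1)] sum_subtractf[symmetric]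
  using assms by (intro sum.cong refl) (auto simp: algebra_simps)

lemma mat_segment:
  fixes X Y :: "complex mat"
  assumes "X \<in> carrier_mat n n" "Y \<in> carrier_mat n n"
  shows "X + complex_of_real \<theta> \<cdot>\<^sub>m (Y - X) = complex_of_real (1 - \<theta>) \<cdot>\<^sub>m X + complex_of_real \<theta> \<cdot>\<^sub>m Y"
  by (rule eq_matI) (use assms in \<open>auto simp: algebra_simps\<close>)

lemma frob_smult_right:
  assumes "W \<in> carrier_mat n n" "X \<in> carrier_mat n n"
  shows "frob W (complex_of_real c \<cdot>\<^sub>m X) = c * frob W X"
  unfolding frob_index[OF assms(1)] sum_distrib_left
  using assms by (intro sum.cong refl) (auto simp: algebra_simps)

lemma frob_smult:
  assumes X: "X \<in> carrier_mat n n"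
  shows "frob (complex_of_real c \<cdot>\<^sub>m X) (complex_of_real c \<cdot>\<^sub>m X) = c\<^sup>2 * frob X X"
  unfolding frob_self[OF smult_carrier_mat[OF X]] frob_self[OF X] sum_distrib_left
  using X by (intro sum.cong refl) (auto simp: norm_mult power_mult_distrib)

lemma frob_diff_le:
  assumes X: "X \<in> carrier_mat n n" and Y: "Y \<in> carrier_mat n n"
  shows "frob (X - Y) (X - Y) \<le> 2 * frob X X + 2 * frob Y Y"
proof -
  have c: "X - Y \<in> carrier_mat n n" by (rule minus_carrier_mat[OF Y])
  have *: "(cmod (a - b))\<^sup>2 \<le> 2 * (cmod a)\<^sup>2 + 2 * (cmod b)\<^sup>2" for a b
  proof -
    have "(cmod (a - b))\<^sup>2 \<le> (cmod a + cmod b)\<^sup>2" by (intro power_mono norm_triangle_ineq4) auto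
    also have "\<dots> \<le> 2 * (cmod a)\<^sup>2 + 2 * (cmod b)\<^sup>2" using sum_squares_bound[of "cmod a" "cmod b"] by (simp add: power2_sum)
    finally show ?thesis .
  qed
  show ?thesis
    unfolding frob_self[OF c] frob_self[OF X] frob_self[OF Y] sum_distrib_left sum.distrib[symmetric]
    using X Y * by (intro sum_mono) auto
qed

lemma frob_unitary:
  assumes U: "unitary_mat n U" and V: "unitary_mat n V" and X: "X \<in> carrier_mat n n"
  shows "frob (U * X * V) (U * X * V) = frob X X"
proof -
  note u = unitary_matD[OF U] and v = unitary_matD[OF V]
  have c: "U * X * V \<in> carrier_mat n n" by (simp only: sq_mat_simps[where n = n] u(1) v(1) X)
  have XX: "mat_adjoint X * X \<in> carrier_mat n n" by (simp only: sq_mat_simps[where n = n] X)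
  have "mat_adjoint (U * X * V) * (U * X * V) = mat_adjoint V * ((mat_adjoint X * ((mat_adjoint U * U) * X)) * V)"
    by (simp only: sq_mat_simps[where n = n] u(1) v(1) X)
  also have "\<dots> = mat_adjoint V * ((mat_adjoint X * X) * V)" unfolding u(3) using X by simp
  finally have "tr (mat_adjoint (U * X * V) * (U * X * V)) = tr (mat_adjoint V * ((mat_adjoint X * X) * V))" by simp
  also have "\<dots> = tr ((mat_adjoint X * X) * V * mat_adjoint V)"
    by (rule tr_mult_commute[OF v(2) mult_carrier_mat[OF XX v(1)]])
  also have "(mat_adjoint X * X) * V * mat_adjoint V = (mat_adjoint X * X) * (V * mat_adjoint V)"
    by (simp only: sq_mat_simps[where n = n] v(1) X)
  also have "\<dots> = mat_adjoint X * X" unfolding v(4) by (rule right_mult_one_mat[OF XX])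
  finally show ?thesis unfolding frob_tr[OF c c] frob_tr[OF X X] by simp
qed

lemma tr_bound:
  assumes X: "X \<in> carrier_mat n n" shows "cmod (tr X) \<le> n + frob X X"
proof -
  have "cmod (tr X) \<le> (\<Sum>i<n. cmod (X $$ (i,i)))" unfolding tr_def using X by (auto intro: norm_sum)
  also have "\<dots> \<le> (\<Sum>i<n. 1 + (\<Sum>j<n. (cmod (X $$ (i,j)))\<^sup>2))"
  proof (rule sum_mono)
    fix i assume "i \<in> {..<n}"
    then have "(cmod (X $$ (i,i)))\<^sup>2 \<le> (\<Sum>j<n. (cmod (X $$ (i,j)))\<^sup>2)" by (intro member_le_sum) auto
    moreover have "cmod (X $$ (i,i)) \<le> 1 + (cmod (X $$ (i,i)))\<^sup>2"
    proof -
      have "2 * cmod (X $$ (i,i)) \<le> 1 + (cmod (X $$ (i,i)))\<^sup>2"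
        using sum_squares_bound[of 1 "cmod (X $$ (i,i))"] by simp
      then show ?thesis using norm_ge_zero[of "X $$ (i,i)"] by linarith
    qed
    ultimately show "cmod (X $$ (i,i)) \<le> 1 + (\<Sum>j<n. (cmod (X $$ (i,j)))\<^sup>2)" by linarith
  qed
  finally show ?thesis unfolding frob_self[OF X] by (simp add: sum.distrib)
qed

lemma uin_D:
  assumes "unitarily_invariant_norm n N"
  shows "X \<in> carrier_mat n n \<Longrightarrow> 0 \<le> N X" "N (0\<^sub>m n n) = 0"
    "X \<in> carrier_mat n n \<Longrightarrow> N (c \<cdot>\<^sub>m X) = cmod c * N X"
    "\<lbrakk>X \<in> carrier_mat n n; Y \<in> carrier_mat n n\<rbrakk> \<Longrightarrow> N (X + Y) \<le> N X + N Y"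
    "\<lbrakk>unitary_mat n U; unitary_mat n V; X \<in> carrier_mat n n\<rbrakk> \<Longrightarrow> N (U * X * V) = N X"
  using assms unfolding unitarily_invariant_norm_def by auto

text \<open>Expansion into matrix units, M being the sum of their norms. It makes the norm
  continuous in the entries and comparable with the Frobenius norm.\<close>

lemma uin_entry_bound:
  assumes N: "unitarily_invariant_norm n N"
  obtains M where "M \<ge> 0" "\<And>X. X \<in> carrier_mat n n \<Longrightarrow> N X \<le> M * (\<Sum>i<n. \<Sum>j<n. cmod (X $$ (i,j)))"
proof -
  define E where "E p = Matrix.mat n n (\<lambda>q. if q = p then 1 else 0 :: complex)" for p :: "nat \<times> nat"
  have E: "E p \<in> carrier_mat n n" for p by (simp add: E_def)
  define M where "M = (\<Sum>p\<in>{..<n}\<times>{..<n}. N (E p))"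
  have M: "M \<ge> 0" unfolding M_def using uin_D(1)[OF N E] by (intro sum_nonneg) auto
  define R where "R X A = Matrix.mat n n (\<lambda>q. if q \<in> A then X $$ q else 0 :: complex)" for X A
  have part: "N (R X A) \<le> (\<Sum>p\<in>A. cmod (X $$ p) * N (E p))" if "finite A" for X A
    using that
  proof (induction A)
    case empty
    have "R X {} = 0\<^sub>m n n" by (rule eq_matI) (auto simp: R_def)
    then show ?case using uin_D(2)[OF N] by simp
  next
    case (insert p A)
    have "R X (insert p A) = (X $$ p) \<cdot>\<^sub>m E p + R X A"
      using insert(2) by (intro eq_matI) (auto simp: R_def E_def)
    moreover have "N ((X $$ p) \<cdot>\<^sub>m E p + R X A) \<le> N ((X $$ p) \<cdot>\<^sub>m E p) + N (R X A)"
      by (rule uin_D(4)[OF N]) (auto simp: E_def R_def)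
    ultimately show ?case using insert uin_D(3)[OF N E] by simp
  qed
  have "N X \<le> M * (\<Sum>i<n. \<Sum>j<n. cmod (X $$ (i,j)))" if X: "X \<in> carrier_mat n n" for X
  proof -
    let ?A = "{..<n} \<times> {..<n}"
    have "X = R X ?A" using X by (intro eq_matI) (auto simp: R_def)
    then have "N X \<le> (\<Sum>p\<in>?A. cmod (X $$ p) * N (E p))" using part[of ?A X] by simp
    also have "\<dots> \<le> (\<Sum>p\<in>?A. cmod (X $$ p) * M)"
      unfolding M_def using uin_D(1)[OF N E] by (intro sum_mono mult_left_mono member_le_sum) auto
    also have "\<dots> = M * (\<Sum>i<n. \<Sum>j<n. cmod (X $$ (i,j)))"
      by (simp add: sum.cartesian_product sum_distrib_left mult.commute case_prod_beta)
    finally show ?thesis .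
  qed
  then show ?thesis using that M by blast
qed

lemma uin_frob_bound:
  assumes N: "unitarily_invariant_norm n N"
  obtains L where "L > 0" "\<And>X. X \<in> carrier_mat n n \<Longrightarrow> (N X)\<^sup>2 \<le> L * frob X X"
proof -
  obtain M where M: "M \<ge> 0" and b: "\<And>X. X \<in> carrier_mat n n \<Longrightarrow> N X \<le> M * (\<Sum>i<n. \<Sum>j<n. cmod (X $$ (i,j)))"
    using uin_entry_bound[OF N] by blast
  \<comment> \<open>The Cauchy-Schwarz inequality over n^2 entries; the added 1 keeps the constant
    positive when M or n is 0.\<close>
  have "(N X)\<^sup>2 \<le> (M\<^sup>2 * real (n * n) + 1) * frob X X" if X: "X \<in> carrier_mat n n" for X
  proof -
    let ?A = "{..<n} \<times> {..<n}"
    have e: "(\<Sum>i<n. \<Sum>j<n. cmod (X $$ (i,j))) = (\<Sum>p\<in>?A. cmod (X $$ p))" "frob X X = (\<Sum>p\<in>?A. (cmod (X $$ p))\<^sup>2)"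
      unfolding frob_self[OF X] by (simp_all add: sum.cartesian_product case_prod_beta)
    have "(N X)\<^sup>2 \<le> (M * (\<Sum>p\<in>?A. cmod (X $$ p)))\<^sup>2"
      using b[OF X] uin_D(1)[OF N X] unfolding e by (intro power_mono) auto
    also have "\<dots> = M\<^sup>2 * (\<Sum>p\<in>?A. cmod (X $$ p))\<^sup>2" by (simp add: power_mult_distrib)
    also have "\<dots> \<le> M\<^sup>2 * ((\<Sum>p\<in>?A. (cmod (X $$ p))\<^sup>2) * card ?A)"
      by (intro mult_left_mono sum_squared_le_sum_of_squares) auto
    also have "\<dots> \<le> (M\<^sup>2 * real (n * n) + 1) * frob X X"
      unfolding e(2)[symmetric] using frob_self_nonneg[OF X] by (simp add: algebra_simps)
    finally show ?thesis .
  qed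
  moreover have "M\<^sup>2 * real (n * n) + 1 > 0" by (intro add_nonneg_pos) auto
  ultimately show ?thesis using that by blast
qed

text \<open>There are infinitely many candidates h, but -W has only finitely many eigenvalues.
  Domination is available for invertible W alone, whereas the separating functional may be
  singular.\<close>

lemma invertible_perturbation:
  assumes W: "(W :: complex mat) \<in> carrier_mat n n" and e: "\<eta> > 0"
  obtains h :: real where "0 < h" "h \<le> \<eta>" "Determinant.det (W + complex_of_real h \<cdot>\<^sub>m 1\<^sub>m n) \<noteq> 0"
proof -
  let ?X = "(-1) \<cdot>\<^sub>m W"
  have X: "?X \<in> carrier_mat n n" using W by simp
  have "infinite (complex_of_real ` {0<..\<eta>})"
    using e by (subst finite_image_iff) (auto simp: inj_on_def)
  then obtain z where "z \<in> complex_of_real ` {0<..\<eta>}" "\<not> eigenvalue ?X z"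
    using finite_eigenvalues[OF X] by (metis finite_subset mem_Collect_eq subsetI)
  then obtain h where h: "0 < h" "h \<le> \<eta>" "\<not> eigenvalue ?X (complex_of_real h)" by auto
  have "complex_of_real h \<cdot>\<^sub>m 1\<^sub>m n - ?X = W + complex_of_real h \<cdot>\<^sub>m 1\<^sub>m n"
    using W by (intro eq_matI) auto
  then show ?thesis using that[OF h(1,2)] det_resolvent_nonzero[OF X h(3)] by simp
qed

text \<open>If \<open>N S > c N Z\<close>, a point \<open>K\<close> of the ball \<open>{X. N X \<le> c N Z}\<close> almost closest to \<open>S\<close> in the Frobenius norm
  gives a functional \<open>X \<mapsto> Re tr ((S - K)\<^sup>* X)\<close> that separates \<open>S\<close> from all \<open>c U Z V\<close>.\<close>

lemma uin_dominance:
  assumes N: "unitarily_invariant_norm n N" and S: "S \<in> carrier_mat n n" and Z: "Z \<in> carrier_mat n n" and c: "c \<ge> 0"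
    and dom: "\<And>W. \<lbrakk>W \<in> carrier_mat n n; Determinant.det W \<noteq> 0\<rbrakk> \<Longrightarrow>
      \<exists>U V. unitary_mat n U \<and> unitary_mat n V \<and> cmod (tr (W * S)) \<le> c * Re (tr (W * (U * Z * V)))"
  shows "N S \<le> c * N Z"
proof (rule ccontr)
  assume "\<not> N S \<le> c * N Z"
  then have gap: "N S - c * N Z > 0" by simp
  define Bd where "Bd = c * (n + frob Z Z) + (n + frob S S)"
  have Bd0: "Bd \<ge> 0" unfolding Bd_def using c frob_self_nonneg[OF Z] frob_self_nonneg[OF S] by simp
  \<comment> \<open>The assumption is applied to W^* + h. The additional trace terms cost at most h
    times \<open>Bd\<close>, uniformly in U and V because the Frobenius norm of U Z V is that of Z,
    so a small h makes the loss at most \<eta>.\<close>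
  have approx: "\<exists>U V. unitary_mat n U \<and> unitary_mat n V \<and> frob W S \<le> c * frob W (U * Z * V) + \<eta>"
    if W: "W \<in> carrier_mat n n" and \<eta>: "\<eta> > 0" for W \<eta>
  proof -
    let ?W = "mat_adjoint W"
    have W': "?W \<in> carrier_mat n n" using W by simp
    obtain h where h: "0 < h" "h \<le> \<eta> / (Bd + 1)" and det: "Determinant.det (?W + complex_of_real h \<cdot>\<^sub>m 1\<^sub>m n) \<noteq> 0"
      using invertible_perturbation[OF W', of "\<eta> / (Bd + 1)"] \<eta> Bd0 by auto
    let ?Wh = "?W + complex_of_real h \<cdot>\<^sub>m 1\<^sub>m n"
    have Wh: "?Wh \<in> carrier_mat n n" using W' by simp
    obtain U V where U: "unitary_mat n U" and V: "unitary_mat n V"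
      and le: "cmod (tr (?Wh * S)) \<le> c * Re (tr (?Wh * (U * Z * V)))" using dom[OF Wh det] by blast
    let ?X = "U * Z * V"
    have X: "?X \<in> carrier_mat n n" by (simp only: sq_mat_simps[where n = n] unitary_matD(1)[OF U] unitary_matD(1)[OF V] Z)
    have split: "Re (tr (?Wh * Y)) = frob W Y + h * Re (tr Y)" if Y: "Y \<in> carrier_mat n n" for Y
    proof -
      have "?Wh * Y = ?W * Y + complex_of_real h \<cdot>\<^sub>m Y"
        using W' Y by (subst add_mult_distrib_mat[of _ n n _ _ n]) (auto simp: mult_smult_assoc_mat[of _ n n _ n])
      moreover have "tr (complex_of_real h \<cdot>\<^sub>m Y) = complex_of_real h * tr Y"
        using Y by (auto simp: tr_def sum_distrib_left)
      ultimately show ?thesis using W' Y by (simp add: frob_tr[OF W Y] tr_add[of _ n])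
    qed
    have trb: "\<bar>Re (tr Y)\<bar> \<le> n + frob Y Y" if "Y \<in> carrier_mat n n" for Y
      using tr_bound[OF that] abs_Re_le_cmod[of "tr Y"] by linarith
    have "frob W S + h * Re (tr S) \<le> c * (frob W ?X + h * Re (tr ?X))"
      using le complex_Re_le_cmod[of "tr (?Wh * S)"] unfolding split[OF S] split[OF X] by linarith
    then have "frob W S \<le> c * frob W ?X + h * (c * Re (tr ?X) - Re (tr S))" by (simp add: algebra_simps)
    also have "\<dots> \<le> c * frob W ?X + h * Bd"
    proof -
      have "c * Re (tr ?X) \<le> c * (n + frob Z Z)"
        using trb[OF X] c unfolding frob_unitary[OF U V Z] by (intro mult_left_mono) auto
      moreover have "- Re (tr S) \<le> n + frob S S" using trb[OF S] by linarith
      ultimately show ?thesis unfolding Bd_def using h(1) by (intro add_left_mono mult_left_mono) auto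
    qed
    also have "h * Bd \<le> \<eta>"
    proof -
      have "h * Bd \<le> \<eta> / (Bd + 1) * (Bd + 1)" using h Bd0 by (intro mult_mono) auto
      then show ?thesis using Bd0 by simp
    qed
    finally show ?thesis using U V by auto
  qed
  define K where "K = {X \<in> carrier_mat n n. N X \<le> c * N Z}"
  define D where "D = (\<lambda>X. frob (S - X) (S - X)) ` K"
  define m where "m = Inf D"
  obtain L where L: "L > 0" "\<And>X. X \<in> carrier_mat n n \<Longrightarrow> (N X)\<^sup>2 \<le> L * frob X X" using uin_frob_bound[OF N] by blast
  have K0: "0\<^sub>m n n \<in> K" unfolding K_def using uin_D(1,2)[OF N] Z c by simp
  have Sc: "S - X \<in> carrier_mat n n" if "X \<in> K" for X using that by (auto simp: K_def intro: minus_carrier_mat)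
  \<comment> \<open>By the triangle inequality N (S - X) is at least the gap, and the comparison
    with the Frobenius norm turns this into a positive distance from S to the ball.\<close>
  have lower: "(N S - c * N Z)\<^sup>2 / L \<le> frob (S - X) (S - X)" if X: "X \<in> K" for X
  proof -
    have Xc: "X \<in> carrier_mat n n" using X by (simp add: K_def)
    have "S = (S - X) + X" using S Xc by (intro eq_matI) auto
    then have "N S \<le> N (S - X) + N X" using uin_D(4)[OF N Sc[OF X] Xc] by simp
    then have "(N S - c * N Z)\<^sup>2 \<le> (N (S - X))\<^sup>2" using X gap by (intro power_mono) (auto simp: K_def)
    also have "\<dots> \<le> L * frob (S - X) (S - X)" by (rule L(2)[OF Sc[OF X]])
    finally show ?thesis using L(1) by (simp add: field_simps)
  qed
  have bdd: "bdd_below D" unfolding D_def using lower by (intro bdd_belowI2) auto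
  have Dne: "D \<noteq> {}" using K0 by (auto simp: D_def)
  have m_le: "m \<le> frob (S - X) (S - X)" if "X \<in> K" for X
    unfolding m_def by (rule cInf_lower[OF _ bdd]) (use that in \<open>auto simp: D_def\<close>)
  have mpos: "m > 0"
  proof -
    have "(N S - c * N Z)\<^sup>2 / L \<le> m" unfolding m_def by (rule cInf_greatest[OF Dne]) (use lower in \<open>auto simp: D_def\<close>)
    moreover have "(N S - c * N Z)\<^sup>2 / L > 0" using gap L(1) by simp
    ultimately show ?thesis by linarith
  qed
  \<comment> \<open>Bounds \<open>frob (X - X0) (X - X0)\<close> for X = c U Z V and any X0 in the
    ball with \<open>frob (S - X0) (S - X0)\<close> at most m + 1; it comes from two uses of
    \<open>frob_diff_le\<close>.\<close>
  define \<Lambda> where "\<Lambda> = 2 * (c\<^sup>2 * frob Z Z) + 2 * (2 * frob S S + 2 * (m + 1))"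
  have \<Lambda>0: "\<Lambda> \<ge> 0" unfolding \<Lambda>_def using frob_self_nonneg[OF Z] frob_self_nonneg[OF S] mpos by simp
  \<comment> \<open>X0 is within \<theta>^2 of the infimum and is moved by the fraction \<theta>
    towards X = c U Z V, staying in the ball by convexity. Near-minimality makes the inner product
    of S - X0 with X - X0 of order \<theta>, while the domination bounds |S - X0|^2 by that inner
    product plus \<theta>.\<close>
  have est: "m \<le> \<theta> * (1 + \<Lambda>) / 2 + \<theta>" if \<theta>: "0 < \<theta>" "\<theta> \<le> 1" for \<theta>
  proof -
    have "\<exists>d\<in>D. d < m + \<theta>\<^sup>2" unfolding m_def by (rule cInf_lessD[OF Dne]) (use \<theta> in simp)
    then obtain X0 where X0: "X0 \<in> K" and near: "frob (S - X0) (S - X0) < m + \<theta>\<^sup>2" by (auto simp: D_def)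
    let ?W = "S - X0"
    have X0c: "X0 \<in> carrier_mat n n" and NX0: "N X0 \<le> c * N Z" using X0 by (auto simp: K_def)
    note Wc = Sc[OF X0]
    obtain U V where U: "unitary_mat n U" and V: "unitary_mat n V"
      and le: "frob ?W S \<le> c * frob ?W (U * Z * V) + \<theta>" using approx[OF Wc \<theta>(1)] by blast
    let ?Y = "U * Z * V"
    have Y: "?Y \<in> carrier_mat n n" by (simp only: sq_mat_simps[where n = n] unitary_matD(1)[OF U] unitary_matD(1)[OF V] Z)
    let ?X = "complex_of_real c \<cdot>\<^sub>m ?Y"
    have X: "?X \<in> carrier_mat n n" using Y by simp
    have NX: "N ?X = c * N Z" using uin_D(3)[OF N Y] uin_D(5)[OF N U V Z] c by simp
    have fX: "frob ?X ?X = c\<^sup>2 * frob Z Z"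
      unfolding frob_unitary[OF U V Z, symmetric] by (rule frob_smult[OF Y])
    have fWX: "frob ?W ?X = c * frob ?W ?Y"
      by (rule frob_smult_right[OF Wc Y])
    let ?V = "?X - X0"
    have Vc: "?V \<in> carrier_mat n n" by (rule minus_carrier_mat[OF X0c])
    have "S - (X0 + complex_of_real \<theta> \<cdot>\<^sub>m ?V) = ?W - complex_of_real \<theta> \<cdot>\<^sub>m ?V"
      by (rule eq_matI) (use S X0c X in \<open>auto simp del: index_mult_mat(1)\<close>)
    moreover have "X0 + complex_of_real \<theta> \<cdot>\<^sub>m ?V \<in> K"
    proof -
      have seg: "X0 + complex_of_real \<theta> \<cdot>\<^sub>m ?V = complex_of_real (1 - \<theta>) \<cdot>\<^sub>m X0 + complex_of_real \<theta> \<cdot>\<^sub>m ?X"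
        by (rule mat_segment[OF X0c X])
      have "N (complex_of_real (1 - \<theta>) \<cdot>\<^sub>m X0 + complex_of_real \<theta> \<cdot>\<^sub>m ?X) \<le> N (complex_of_real (1 - \<theta>) \<cdot>\<^sub>m X0) + N (complex_of_real \<theta> \<cdot>\<^sub>m ?X)"
        by (rule uin_D(4)[OF N]) (use X0c X in auto)
      moreover have "N (complex_of_real (1 - \<theta>) \<cdot>\<^sub>m X0) = (1 - \<theta>) * N X0" "N (complex_of_real \<theta> \<cdot>\<^sub>m ?X) = \<theta> * (c * N Z)"
        unfolding uin_D(3)[OF N X0c] uin_D(3)[OF N X] NX norm_of_real using \<theta> by simp_all
      moreover have "(1 - \<theta>) * N X0 \<le> (1 - \<theta>) * (c * N Z)" using NX0 \<theta> by (intro mult_left_mono) auto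
      ultimately have "N (X0 + complex_of_real \<theta> \<cdot>\<^sub>m ?V) \<le> (1 - \<theta>) * (c * N Z) + \<theta> * (c * N Z)"
        unfolding seg by linarith
      then have "N (X0 + complex_of_real \<theta> \<cdot>\<^sub>m ?V) \<le> c * N Z" by (simp add: algebra_simps)
      then show ?thesis unfolding K_def using X0c Vc by simp
    qed
    ultimately have "m \<le> frob ?W ?W - 2 * \<theta> * frob ?W ?V + \<theta>\<^sup>2 * frob ?V ?V"
      using m_le frob_diff_scale[OF Wc Vc, of \<theta>] by metis
    then have "2 * \<theta> * frob ?W ?V \<le> \<theta>\<^sup>2 + \<theta>\<^sup>2 * frob ?V ?V" using near by linarith
    also have "\<dots> \<le> \<theta>\<^sup>2 + \<theta>\<^sup>2 * \<Lambda>"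
    proof -
      have "S - ?W = X0" using S X0c by (intro eq_matI) auto
      then have "frob X0 X0 \<le> 2 * frob S S + 2 * frob ?W ?W" using frob_diff_le[OF S Wc] by simp
      moreover have "frob ?W ?W \<le> m + 1"
      proof -
        have "\<theta>\<^sup>2 \<le> 1" using \<theta> by (simp add: power_le_one)
        then show ?thesis using near by (meson add_left_mono less_imp_le order_trans)
      qed
      ultimately have "frob X0 X0 \<le> 2 * frob S S + 2 * (m + 1)" by argo
      then have "frob ?V ?V \<le> \<Lambda>" using frob_diff_le[OF X X0c] unfolding \<Lambda>_def fX by argo
      then show ?thesis by (intro add_left_mono mult_left_mono) auto
    qed
    also have "\<dots> = (2 * \<theta>) * (\<theta> * (1 + \<Lambda>) / 2)" by (simp add: power2_eq_square algebra_simps)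
    finally have 1: "frob ?W ?V \<le> \<theta> * (1 + \<Lambda>) / 2" using \<theta>(1) by simp
    have "frob ?W ?W = frob ?W S - frob ?W X0" by (rule frob_diff_right[OF Wc S X0c])
    also have "\<dots> \<le> frob ?W ?X + \<theta> - frob ?W X0" using le unfolding fWX by simp
    also have "\<dots> = frob ?W ?V + \<theta>" unfolding frob_diff_right[OF Wc X X0c] by simp
    finally show ?thesis using m_le[OF X0] 1 by linarith
  qed
  \<comment> \<open>The estimate reads m \<le> \<theta> (3 + \<Lambda>) / 2, and this \<theta> makes
    the right side at most m / 2.\<close>
  define \<theta> where "\<theta> = min 1 (m / (3 + \<Lambda>))"
  have \<theta>: "0 < \<theta>" "\<theta> \<le> 1" using mpos \<Lambda>0 by (auto simp: \<theta>_def)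
  have "\<theta> \<le> m / (3 + \<Lambda>)" unfolding \<theta>_def by simp
  then have "\<theta> * (3 + \<Lambda>) \<le> m" using \<Lambda>0 by (simp add: pos_le_divide_eq)
  moreover have "m \<le> (\<theta> * (3 + \<Lambda>)) / 2" using est[OF \<theta>] by (simp add: field_simps)
  ultimately show False using mpos by argo
qed

subsection \<open>The main theorem\<close>

text \<open>The reverse triangle inequality together with the entrywise bound on N (X_k -
  Y).\<close>

lemma uin_tendsto:
  assumes N: "unitarily_invariant_norm n N" and X: "\<And>k. X k \<in> carrier_mat n n" and Y: "Y \<in> carrier_mat n n"
    and lim: "\<And>i j. i < n \<Longrightarrow> j < n \<Longrightarrow> (\<lambda>k. X k $$ (i,j)) \<longlonglongrightarrow> Y $$ (i,j)"
  shows "(\<lambda>k. N (X k)) \<longlonglongrightarrow> N Y"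
proof -
  obtain M where M: "\<And>X. X \<in> carrier_mat n n \<Longrightarrow> N X \<le> M * (\<Sum>i<n. \<Sum>j<n. cmod (X $$ (i,j)))"
    using uin_entry_bound[OF N] by blast
  have "(\<lambda>k. M * (\<Sum>i<n. \<Sum>j<n. cmod (X k $$ (i,j) - Y $$ (i,j)))) \<longlonglongrightarrow> M * (\<Sum>i<n. \<Sum>j<n. cmod (Y $$ (i,j) - Y $$ (i,j)))"
    by (intro tendsto_intros lim) auto
  then have lim0: "(\<lambda>k. M * (\<Sum>i<n. \<Sum>j<n. cmod (X k $$ (i,j) - Y $$ (i,j)))) \<longlonglongrightarrow> 0" by simp
  have "norm (N (X k) - N Y) \<le> M * (\<Sum>i<n. \<Sum>j<n. cmod (X k $$ (i,j) - Y $$ (i,j)))" for k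
  proof -
    have D: "X k - Y \<in> carrier_mat n n" by (rule minus_carrier_mat[OF Y])
    have "N (X k - Y) \<le> M * (\<Sum>i<n. \<Sum>j<n. cmod ((X k - Y) $$ (i,j)))" by (rule M[OF D])
    also have "(\<Sum>i<n. \<Sum>j<n. cmod ((X k - Y) $$ (i,j))) = (\<Sum>i<n. \<Sum>j<n. cmod (X k $$ (i,j) - Y $$ (i,j)))"
      using Y by (intro sum.cong refl) auto
    finally have b: "N (X k - Y) \<le> M * (\<Sum>i<n. \<Sum>j<n. cmod (X k $$ (i,j) - Y $$ (i,j)))" .
    have "X k = Y + (X k - Y)" using X[of k] Y by (intro eq_matI) auto
    then have "N (X k) \<le> N Y + N (X k - Y)" using uin_D(4)[OF N Y D] by simp
    moreover have "N Y \<le> N (X k) + N (X k - Y)"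
    proof -
      have "Y = X k + (-1) \<cdot>\<^sub>m (X k - Y)" using X[of k] Y by (intro eq_matI) auto
      then have "N Y \<le> N (X k) + N ((-1) \<cdot>\<^sub>m (X k - Y))" using uin_D(4)[OF N X[of k], of "(-1) \<cdot>\<^sub>m (X k - Y)"] D by simp
      then show ?thesis using uin_D(3)[OF N D, of "-1"] by simp
    qed
    ultimately show ?thesis using b by (simp add: abs_le_iff)
  qed
  then have "(\<lambda>k. N (X k) - N Y) \<longlonglongrightarrow> 0" by (intro Lim_null_comparison[OF always_eventually lim0]) auto
  then show ?thesis using LIM_zero_iff by blast
qed

lemma accretive_imp_form:
  assumes A: "A \<in> carrier_mat n n" and acc: "accretive A"
  shows "accretive_form n A"
proof -
  have "pos_def_mat (re_part A)" using acc unfolding accretive_def re_part_def by simp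
  moreover have "dim_row (re_part A) = n" using A by (simp add: re_part_def)
  ultimately have "Re (qform (re_part A) x) > 0" if "x \<in> carrier_vec n" "x \<noteq> 0\<^sub>v n" for x
    using that unfolding pos_def_mat_def by simp
  then show ?thesis using A by (simp add: accretive_form_def qform_cinner cinner_re_part[OF A])
qed

text \<open>Normalising x divides the form by |x|^2, and the sector is invariant under positive
  scaling. The zero vector is treated apart, since the sector excludes 0.\<close>

lemma sectorial_of_numerical_range:
  assumes A: "A \<in> carrier_mat n n" and W: "numerical_range A \<subseteq> sector \<alpha>"
  shows "sectorial n (tan \<alpha>) A"
  unfolding sectorial_def
proof (rule conjI[OF A], rule ballI)
  fix x :: "complex Matrix.vec" assume x: "x \<in> carrier_vec n"
  show "0 \<le> Re (cinner x (A *\<^sub>v x)) \<and> \<bar>Im (cinner x (A *\<^sub>v x))\<bar> \<le> tan \<alpha> * Re (cinner x (A *\<^sub>v x))"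
  proof (cases "x = 0\<^sub>v n")
    case True
    then show ?thesis by (simp add: cinner_def)
  next
    case False
    define \<nu> where "\<nu> = Re (cinner x x)"
    have \<nu>: "\<nu> > 0" using accretive_form_one[of n] x False by (auto simp: accretive_form_def \<nu>_def)
    define a where "a = complex_of_real (1 / sqrt \<nu>)"
    have aa: "cnj a * a = complex_of_real (1 / \<nu>)" using \<nu> by (simp add: a_def flip: of_real_mult)
    let ?y = "a \<cdot>\<^sub>v x"
    have y: "?y \<in> carrier_vec n" using x by simp
    have Ax: "A *\<^sub>v x \<in> carrier_vec n" by (rule mult_mat_vec_carrier[OF A x])
    have sc: "cinner ?y (a \<cdot>\<^sub>v z) = complex_of_real (1 / \<nu>) * cinner x z" if z: "z \<in> carrier_vec n" for z
    proof -
      have "cinner ?y (a \<cdot>\<^sub>v z) = cnj a * (a * cinner x z)"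
        using cinner_smult_left[of "a \<cdot>\<^sub>v z" n x a] cinner_smult_right[OF x z, of a] x z by simp
      then show ?thesis unfolding mult.assoc[symmetric] aa .
    qed
    have "complex_of_real (\<Sum>i<n. (cmod (?y $ i))\<^sup>2) = cinner ?y ?y" unfolding cinner_self using y x by simp
    also have "\<dots> = complex_of_real (1 / \<nu>) * complex_of_real \<nu>"
      unfolding sc[OF x] by (simp add: \<nu>_def cinner_self)
    also have "\<dots> = complex_of_real 1" unfolding of_real_mult[symmetric] using \<nu> by simp
    finally have "(\<Sum>i<n. (cmod (?y $ i))\<^sup>2) = 1" by (simp only: of_real_eq_iff)
    then have "qform A ?y \<in> numerical_range A"
      using y A unfolding numerical_range_def by auto
    then have s: "qform A ?y \<in> sector \<alpha>" using W by blast
    have "qform A ?y = complex_of_real (1 / \<nu>) * cinner x (A *\<^sub>v x)"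
      unfolding qform_cinner mult_mat_vec[OF A x] by (rule sc[OF Ax])
    then have "Re (cinner x (A *\<^sub>v x)) / \<nu> > 0" "\<bar>Im (cinner x (A *\<^sub>v x)) / \<nu>\<bar> \<le> tan \<alpha> * (Re (cinner x (A *\<^sub>v x)) / \<nu>)"
      using s unfolding sector_def by auto
    then show ?thesis using \<nu> by (simp add: abs_divide field_simps zero_less_divide_iff)
  qed
qed

text \<open>The form at an eigenvector is w |v|^2. This puts the spectrum in the right half-plane,
  where the circles live.\<close>

lemma accretive_form_eigenvalue:
  assumes A: "accretive_form n A" and w: "eigenvalue A w" shows "Re w > 0"
proof -
  note Ac = accretive_formD(1)[OF A]
  obtain v where v: "v \<in> carrier_vec n" "v \<noteq> 0\<^sub>v n" "A *\<^sub>v v = w \<cdot>\<^sub>v v"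
    using w Ac by (auto simp: eigenvalue_def eigenvector_def)
  have "cinner v (A *\<^sub>v v) = w * cinner v v" unfolding v(3) by (rule cinner_smult_right[OF v(1,1)])
  also have "\<dots> = w * complex_of_real (Re (cinner v v))" by (simp add: cinner_self)
  finally have "Re (cinner v (A *\<^sub>v v)) = Re w * Re (cinner v v)" by simp
  moreover have "Re (cinner v (A *\<^sub>v v)) > 0" "Re (cinner v v) > 0"
    using A accretive_form_one[of n] v(1,2) by (auto simp: accretive_form_def)
  ultimately show ?thesis by (simp add: zero_less_mult_iff)
qed

lemma (in disc_contour) cfc_hcomb:
  assumes A: "accretive_form n A" and ev: "\<And>w. eigenvalue A w \<Longrightarrow> w \<in> ball (complex_of_real c) r"
    and wt: "weights m w t" and ij: "i < n" "j < n"
  shows "cfc \<gamma> (hcomb m w t) A $$ (i,j) = gmat n m w t A $$ (i,j)"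
proof -
  note Ac = accretive_formD(1)[OF A]
  have w: "0 \<le> t l" "t l \<le> 1" if "l < m" for l using wt that by (auto simp: weights_def)
  have "cfc \<gamma> (hcomb m w t) A $$ (i,j) = (\<Sum>l<m. complex_of_real (w l) * cfc \<gamma> (hfun (t l)) A $$ (i,j))"
    unfolding hcomb_def[abs_def]
    by (rule cfc_sum[OF Ac ij ev])
      (use w in \<open>auto intro!: holomorphic_on_imp_continuous_on holomorphic_on_subset[OF holomorphic_hfun sphere_slit]\<close>)
  also have "\<dots> = (\<Sum>l<m. complex_of_real (w l) * hmat n (t l) A $$ (i,j))"
  proof (rule sum.cong[OF refl])
    fix l assume "l \<in> {..<m}"
    then have t: "0 \<le> t l" "t l \<le> 1" using w by auto
    note R = minv_qmat[OF A t]
    have "cfc \<gamma> (hfun (t l)) A = A * minv n (qmat n (t l) A)"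
      by (rule cfc_hfun[OF Ac ev t R(1)]) (assumption, unfold qmat_def[symmetric], rule R(2))
    then show "complex_of_real (w l) * cfc \<gamma> (hfun (t l)) A $$ (i,j) = complex_of_real (w l) * hmat n (t l) A $$ (i,j)"
      by (simp add: hmat_def)
  qed
  finally show ?thesis using ij by (simp add: gmat_def)
qed

theorem mainTheorem17:
  fixes A B :: "complex mat" and n :: nat and \<alpha> :: real
    and N :: "complex mat \<Rightarrow> real" and f :: "real \<Rightarrow> real" and F :: "complex \<Rightarrow> complex"
  assumes "A \<in> carrier_mat n n" and "B \<in> carrier_mat n n"
    and "accretive A" and "accretive B"
    and "0 \<le> \<alpha>" and "\<alpha> < pi / 2"
    and "numerical_range A \<subseteq> sector \<alpha>" and "numerical_range B \<subseteq> sector \<alpha>"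
    and "unitarily_invariant_norm n N"
    and "matrix_monotone_class f"
    and "F holomorphic_on slit_plane"
    and "\<forall>x>0. F (complex_of_real x) = complex_of_real (f x)"
  shows "N (holo_fun F (A + B)) \<le> (1 / cos \<alpha>) ^ 3 * N (holo_fun F A + holo_fun F B)"
proof -
  note N = assms(9)
  have fF: "F (complex_of_real x) = complex_of_real (f x)" if "x > 0" for x using assms(12) that by simp
  have A: "accretive_form n A" and B: "accretive_form n B"
    by (rule accretive_imp_form[OF assms(1,3)], rule accretive_imp_form[OF assms(2,4)])
  have AB: "accretive_form n (A + B)" by (rule accretive_form_add[OF A B])
  have sA: "sectorial n (tan \<alpha>) A" and sB: "sectorial n (tan \<alpha>) B"
    by (rule sectorial_of_numerical_range[OF assms(1,7)], rule sectorial_of_numerical_range[OF assms(2,8)])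
  have cos: "cos \<alpha> > 0" using assms(5,6) by (intro cos_gt_zero_pi) auto
  have T: "tan \<alpha> \<ge> 0" unfolding tan_def using cos assms(5,6) by (intro divide_nonneg_nonneg sin_ge_zero) auto
  have sec: "sqrt (1 + (tan \<alpha>)\<^sup>2) = 1 / cos \<alpha>"
  proof -
    have "1 + (tan \<alpha>)\<^sup>2 = (1 / cos \<alpha>)\<^sup>2"
      using cos tan_sec[of \<alpha>] by (simp add: inverse_eq_divide power_one_over)
    then show ?thesis using cos by simp
  qed
  \<comment> \<open>One circle encloses the spectra of A, B and A + B, so a single interpretation of
    the locale represents all three values of \<open>holo_fun\<close>.\<close>
  let ?S = "{w. eigenvalue A w} \<union> {w. eigenvalue B w} \<union> {w. eigenvalue (A + B) w}"
  have fin: "finite ?S"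
    using finite_eigenvalues[OF accretive_formD(1)[OF A]] finite_eigenvalues[OF accretive_formD(1)[OF B]]
      finite_eigenvalues[OF accretive_formD(1)[OF AB]] by simp
  have pos: "Re w > 0" if "w \<in> ?S" for w using that accretive_form_eigenvalue A B AB by blast
  obtain c r where cr: "disc_contour c r" and S: "?S \<subseteq> ball (complex_of_real c) r"
    by (rule ex_disc_contour[OF fin pos])
  interpret disc_contour c r "circlepath (complex_of_real c) r" by (rule cr) simp
  obtain m w t where wt: "\<And>k. weights (m k) (w k) (t k)"
    and ulim: "\<And>K. \<lbrakk>compact K; K \<subseteq> slit_plane\<rbrakk> \<Longrightarrow> uniform_limit K (\<lambda>k. hcomb (m k) (w k) (t k)) F sequentially"
    using hcomb_approximation[OF assms(10,11) fF] by blast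
  \<comment> \<open>For each k the same combination is applied to A, B and A + B, since
    \<open>trace_dominance\<close> compares values of one function.\<close>
  define g where "g k = gmat n (m k) (w k) (t k)" for k
  have hc: "holo_fun F X \<in> carrier_mat n n"
    and lim: "i < n \<Longrightarrow> j < n \<Longrightarrow> (\<lambda>k. g k X $$ (i,j)) \<longlonglongrightarrow> holo_fun F X $$ (i,j)"
    if X: "accretive_form n X" and sub: "{w. eigenvalue X w} \<subseteq> ball (complex_of_real c) r" for X i j
  proof -
    note Xc = accretive_formD(1)[OF X]
    have ev: "w \<in> ball (complex_of_real c) r" if "eigenvalue X w" for w using sub that by blast
    have h: "holo_fun F X = cfc (circlepath (complex_of_real c) r) F X"
      by (rule holo_fun_eq_cfc[OF Xc assms(11) ev])
    then show "holo_fun F X \<in> carrier_mat n n" using Xc by simp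
    show "(\<lambda>k. g k X $$ (i,j)) \<longlonglongrightarrow> holo_fun F X $$ (i,j)" if ij: "i < n" "j < n"
    proof -
      have "(\<lambda>k. cfc (circlepath (complex_of_real c) r) (hcomb (m k) (w k) (t k)) X $$ (i,j)) \<longlonglongrightarrow> cfc (circlepath (complex_of_real c) r) F X $$ (i,j)"
      proof (rule cfc_tendsto[OF Xc ij ev])
        show "continuous_on (sphere (complex_of_real c) r) (hcomb (m k) (w k) (t k))" for k
          by (rule holomorphic_on_imp_continuous_on[OF holomorphic_on_subset[OF holomorphic_hcomb[OF wt] sphere_slit]])
        show "uniform_limit (sphere (complex_of_real c) r) (\<lambda>k. hcomb (m k) (w k) (t k)) F sequentially"
          by (rule ulim[OF compact_sphere sphere_slit])
      qed
      moreover have "cfc (circlepath (complex_of_real c) r) (hcomb (m k) (w k) (t k)) X $$ (i,j) = g k X $$ (i,j)" for k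
        unfolding g_def by (rule cfc_hcomb[OF X ev wt ij])
      ultimately show ?thesis unfolding h by simp
    qed
  qed
  have SA: "{w. eigenvalue A w} \<subseteq> ball (complex_of_real c) r" and SB: "{w. eigenvalue B w} \<subseteq> ball (complex_of_real c) r"
    and SAB: "{w. eigenvalue (A + B) w} \<subseteq> ball (complex_of_real c) r" using S by auto
  have gc: "g k X \<in> carrier_mat n n" for k X by (simp add: g_def)
  have "N (g k (A + B)) \<le> (1 / cos \<alpha>) ^ 3 * N (g k A + g k B)" for k
  proof (rule uin_dominance[OF N gc])
    show "g k A + g k B \<in> carrier_mat n n" using gc[of k A] gc[of k B] by simp
    show "0 \<le> (1 / cos \<alpha>) ^ 3" using cos by simp
    fix W :: "complex mat" assume W: "W \<in> carrier_mat n n" "Determinant.det W \<noteq> 0"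
    show "\<exists>U V. unitary_mat n U \<and> unitary_mat n V \<and>
      cmod (tr (W * g k (A + B))) \<le> (1 / cos \<alpha>) ^ 3 * Re (tr (W * (U * (g k A + g k B) * V)))"
      using trace_dominance[OF A sA B sB T wt W, of k] unfolding sec g_def by blast
  qed
  moreover have "(\<lambda>k. N (g k (A + B))) \<longlonglongrightarrow> N (holo_fun F (A + B))"
    by (rule uin_tendsto[OF N gc hc[OF AB SAB] lim[OF AB SAB]])
  moreover have "(\<lambda>k. N (g k A + g k B)) \<longlonglongrightarrow> N (holo_fun F A + holo_fun F B)"
  proof (rule uin_tendsto[OF N])
    show "g k A + g k B \<in> carrier_mat n n" for k using gc[of k A] gc[of k B] by simp
    show "holo_fun F A + holo_fun F B \<in> carrier_mat n n" using hc[OF A SA] hc[OF B SB] by simp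
    fix i j assume ij: "i < n" "j < n"
    have "(g k A + g k B) $$ (i,j) = g k A $$ (i,j) + g k B $$ (i,j)" for k
      using gc[of k A] gc[of k B] ij by auto
    moreover have "(holo_fun F A + holo_fun F B) $$ (i,j) = holo_fun F A $$ (i,j) + holo_fun F B $$ (i,j)"
      using hc[OF A SA] hc[OF B SB] ij by auto
    ultimately show "(\<lambda>k. (g k A + g k B) $$ (i,j)) \<longlonglongrightarrow> (holo_fun F A + holo_fun F B) $$ (i,j)"
      using tendsto_add[OF lim[OF A SA ij] lim[OF B SB ij]] by simp
  qed
  ultimately show ?thesis
    by (intro LIMSEQ_le[OF _ tendsto_mult[OF tendsto_const]]) auto
qed

end
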